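(* (a) There exists an affine periodic reduced sequence $\{r_j\}_{j\ge 1}$ of simple reflections in $W$, with corresponding simple roots $\gamma_j$ and associated positive roots $\tau_j=w_{j-1}^{-1}\cdot\gamma_j=r_1\cdots r_{j-1}\cdot\gamma_j$, such that $$\{\tau_j:1\le j<\infty\}=\{k d^*-\dot\alpha:\ \dot\alpha>0,\ k=1,2,\dots\},$$ i.e. such that the span of the corresponding root spaces is $\dot{\mathfrak n}^-(z\mathbb C[z])$. The period can be chosen to be any point in $C\cap\check{\dot T}$. (b) Let $\{r_j\}_{j\ge1}$ be a reduced sequence as in (a), and let $\dot w_0=r_{-N}\cdots r_0$ be a reduced expression for the longest element $\dot w_0$ of $\dot W$ in terms of simple reflections. Then the sequence $$r_{-N},\dots,r_0,r_1,r_2,\dots$$ is another reduced sequence. The corresponding set of positive roots mapped to negative roots is $$\{k d^*+\dot\alpha:\ \dot\alpha>0,\ k=0,1,2,\dots\},$$ i.e. the span of the corresponding root spaces is $\dot{\mathfrak n}^+(\mathbb C[z])$.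
   Context: Let $\dot K$ be a simply connected compact Lie group with simple Lie algebra $\dot{\mathfrak k}$, $\dot{\mathfrak g}=\dot{\mathfrak k}^{\mathbb C}$, with triangular decomposition $\dot{\mathfrak g}=\dot{\mathfrak n}^-\oplus\dot{\mathfrak h}\oplus\dot{\mathfrak n}^+$ such that $\dot{\mathfrak h}\cap\dot{\mathfrak k}$ is maximal abelian in $\dot{\mathfrak k}$. Let $\dot\alpha_1,\dots,\dot\alpha_r$ be the simple roots, $\dot h_1,\dots,\dot h_r$ the simple coroots, $\dot\theta$ the highest root, $\dot h_{\dot\theta}$ its coroot, $\dot W$ the Weyl group; $\dot\alpha>0$ means that $\dot\alpha$ is a positive root of $\dot{\mathfrak g}$. Let $\check{\dot T}=\bigoplus_i\mathbb Z\dot h_i$ be the coroot lattice, and $C=\{x\in\dot{\mathfrak h}_{\mathbb R}:\dot\alpha_i(x)>0,\ i=1,\dots,r\}$ the open positive Weyl chamber. Affine Weyl group. The group $W\cong \dot W\ltimes\check{\dot T}$ acts on $\dot{\mathfrak h}_{\mathbb R}$ by affine transformations and is generated by the simple reflections $r_{\alpha_0},r_{\alpha_1},\dots,r_{\alpha_r}$, where $r_{\alpha_i}=r_{\dot\alpha_i}$ for $i>0$ and $r_{\alpha_0}(x)=r_{\dot\theta}(x)+\dot h_{\dot\theta}$ (reflection in the hyperplane $\dot\theta(x)=1$). The identification of the translation subgroup with $\check{\dot T}$ is the one for which $r_{\alpha_0}=r_{\dot\theta}\circ\dot h_{\dot\theta}$; thus $h\in\check{\dot T}$ corresponds to the element $w\in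 W$ with $w^{-1}(x)=x+h$. Affine roots. The roots of the affine algebra are written $k d^*+\dot\alpha$ ($k\in\mathbb Z$, $\dot\alpha$ a root of $\dot{\mathfrak g}$, the real roots) and $kd^*$ ($k\neq0$); $kd^*+\dot\alpha$ is viewed as the affine function $x\mapsto k+\dot\alpha(x)$ on $\dot{\mathfrak h}_{\mathbb R}$, and $W$ acts by $(w\cdot\beta)(x)=\beta(w^{-1}x)$. A real root is positive if $k>0$, or $k=0$ and $\dot\alpha>0$. The simple roots are $\alpha_0=d^*-\dot\theta$ and $\alpha_i=\dot\alpha_i$, $i=1,\dots,r$. The root space of $kd^*+\dot\alpha$ is $z^k\dot{\mathfrak g}_{\dot\alpha}$ in the loop algebra $\dot{\mathfrak g}\otimes\mathbb C[z,z^{-1}]$. $\dot{\mathfrak n}^-(z\mathbb C[z])$ means $\dot{\mathfrak n}^-\otimes z\mathbb C[z]$, and similarly $\dot{\mathfrak n}^+(\mathbb C[z])=\dot{\mathfrak n}^+\otimes\mathbb C[z]$. Reduced sequences. A sequence of simple reflections $r_1,r_2,\dots$ in $W$ is reduced if $w_n=r_nr_{n-1}\cdots r_1$ is a reduced expression for each $n$ ($w_0=1$); similarly for a sequence starting at another index. If $r_j$ corresponds to the simple root $\gamma_j$, then $\tau_1,\dots,\tau_n$, with $\tau_j=w_{j-1}^{-1}\cdot\gamma_j$, are exactly the positive roots mapped to negative roots by $w_n$; the "corresponding set of positive roots mapped to negative roots" for the whole sequence is the union over $n$ of these sets. A reduced sequence is affine periodic if there is $l\geq 1$ such that (1) $w_l\in\check{\dot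 T}$ (i.e. $w_l$ is a translation) and (2) $w_{s+l}=w_s\circ w_l$ for all $s$; then $w_l$, regarded as an element of $\check{\dot T}$, is called the period. *)

theory Defs
  imports "HOL-Analysis.Analysis" "HOL-Library.Poly_Mapping"
begin

section \<open>Compact simple Lie algebras\<close>

text \<open>
  The Lie algebra of the compact group is a type \<open>'k::euclidean_space\<close> with a bracket. The class
  only provides a finite-dimensional real vector space; its inner product is not assumed to be
  related to the bracket, and enters only through the trace in the Killing form.
  The group itself is determined by its Lie algebra (being simply connected), and a simple real Lie
  algebra belongs to a compact group iff its Killing form is negative definite.
\<close>

definition lie_bracket :: "('k::real_vector \<Rightarrow> 'k \<Rightarrow> 'k) \<Rightarrow> bool" where
  "lie_bracket br \<longleftrightarrow> bilinear br \<and> (\<forall>x. br x x = 0) \<and>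
     (\<forall>x y z. br x (br y z) + br y (br z x) + br z (br x y) = 0)"

definition lie_ideal :: "('k::real_vector \<Rightarrow> 'k \<Rightarrow> 'k) \<Rightarrow> 'k set \<Rightarrow> bool" where
  "lie_ideal br I \<longleftrightarrow> subspace I \<and> (\<forall>x. \<forall>y\<in>I. br x y \<in> I)"

definition simple_lie :: "('k::real_vector \<Rightarrow> 'k \<Rightarrow> 'k) \<Rightarrow> bool" where
  "simple_lie br \<longleftrightarrow> lie_bracket br \<and> (\<exists>x y. br x y \<noteq> 0) \<and>
     (\<forall>I. lie_ideal br I \<longrightarrow> I = {0} \<or> I = UNIV)"

text \<open>Trace of \<open>ad x \<circ> ad y\<close>, in the standard orthonormal basis.\<close>

definition killing_form :: "('k::euclidean_space \<Rightarrow> 'k \<Rightarrow> 'k) \<Rightarrow> 'k \<Rightarrow> 'k \<Rightarrow> real" where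
  "killing_form br x y = (\<Sum>b\<in>Basis. br x (br y b) \<bullet> b)"

definition compact_lie :: "('k::euclidean_space \<Rightarrow> 'k \<Rightarrow> 'k) \<Rightarrow> bool" where
  "compact_lie br \<longleftrightarrow> (\<forall>x. x \<noteq> 0 \<longrightarrow> killing_form br x x < 0)"

definition abelian_subalgebra :: "('k::real_vector \<Rightarrow> 'k \<Rightarrow> 'k) \<Rightarrow> 'k set \<Rightarrow> bool" where
  "abelian_subalgebra br s \<longleftrightarrow> subspace s \<and> (\<forall>x\<in>s. \<forall>y\<in>s. br x y = 0)"

definition maximal_abelian :: "('k::real_vector \<Rightarrow> 'k \<Rightarrow> 'k) \<Rightarrow> 'k set \<Rightarrow> bool" where
  "maximal_abelian br t \<longleftrightarrow> abelian_subalgebra br t \<and>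
     (\<forall>s. abelian_subalgebra br s \<and> t \<subseteq> s \<longrightarrow> s = t)"


section \<open>The complexification\<close>

text \<open>The pair \<open>(x, y)\<close> stands for \<open>x + \<i> y\<close>.\<close>

type_synonym 'k cplx = "'k \<times> 'k"

definition cscale :: "complex \<Rightarrow> 'k::real_vector cplx \<Rightarrow> 'k cplx" where
  "cscale c v = (Re c *\<^sub>R fst v - Im c *\<^sub>R snd v, Re c *\<^sub>R snd v + Im c *\<^sub>R fst v)"

definition cbracket :: "('k::real_vector \<Rightarrow> 'k \<Rightarrow> 'k) \<Rightarrow> 'k cplx \<Rightarrow> 'k cplx \<Rightarrow> 'k cplx" where
  "cbracket br v w =
     (br (fst v) (fst w) - br (snd v) (snd w), br (fst v) (snd w) + br (snd v) (fst w))"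

global_interpretation cvec: vector_space "cscale :: complex \<Rightarrow> 'k::real_vector cplx \<Rightarrow> 'k cplx"
  defines cspan = cvec.span
  by unfold_locales (auto simp: cscale_def algebra_simps prod_eq_iff)


section \<open>Triangular decomposition, roots and coroots\<close>

text \<open>
  The fields of the record are: the bracket of the compact simple Lie algebra, the maximal abelian
  subalgebra, the number r and the enumeration \<open>1..r\<close> of the simple roots, and the highest root.
\<close>

record 'k lie_data =
  lbr :: "'k \<Rightarrow> 'k \<Rightarrow> 'k"
  torus :: "'k set"
  rk :: nat
  simple_root :: "nat \<Rightarrow> 'k cplx \<Rightarrow> complex"
  highest_root :: "'k cplx \<Rightarrow> complex"

definition cartan :: "'k lie_data \<Rightarrow> 'k cplx set" where
  "cartan G = torus G \<times> torus G"

text \<open>Linear functionals on the Cartan subalgebra are extended by 0 to the whole Lie algebra,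
  so that equality of functionals is equality of functions.\<close>

definition cartan_dual :: "('k::real_vector) lie_data \<Rightarrow> ('k cplx \<Rightarrow> complex) set" where
  "cartan_dual G = {\<alpha>.
     (\<forall>x\<in>cartan G. \<forall>y\<in>cartan G. \<alpha> (x + y) = \<alpha> x + \<alpha> y) \<and>
     (\<forall>c. \<forall>x\<in>cartan G. \<alpha> (cscale c x) = c * \<alpha> x) \<and>
     (\<forall>x. x \<notin> cartan G \<longrightarrow> \<alpha> x = 0)}"

definition root_space :: "('k::real_vector) lie_data \<Rightarrow> ('k cplx \<Rightarrow> complex) \<Rightarrow> 'k cplx set" where
  "root_space G \<alpha> = {x. \<forall>h\<in>cartan G. cbracket (lbr G) h x = cscale (\<alpha> h) x}"

definition roots :: "('k::real_vector) lie_data \<Rightarrow> ('k cplx \<Rightarrow> complex) set" where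
  "roots G = {\<alpha> \<in> cartan_dual G. \<alpha> \<noteq> (\<lambda>x. 0) \<and> root_space G \<alpha> \<noteq> {0}}"

definition neg_fun :: "('v \<Rightarrow> complex) \<Rightarrow> 'v \<Rightarrow> complex" where
  "neg_fun \<alpha> = (\<lambda>x. - \<alpha> x)"

definition simple_comb :: "'k lie_data \<Rightarrow> (nat \<Rightarrow> complex) \<Rightarrow> 'k cplx \<Rightarrow> complex" where
  "simple_comb G c = (\<lambda>x. \<Sum>i=1..rk G. c i * simple_root G i x)"

definition nonneg_combs :: "'k lie_data \<Rightarrow> ('k cplx \<Rightarrow> complex) set" where
  "nonneg_combs G = {simple_comb G (\<lambda>i. of_nat (n i)) | n. True}"

definition positive_roots :: "('k::real_vector) lie_data \<Rightarrow> ('k cplx \<Rightarrow> complex) set" where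
  "positive_roots G = roots G \<inter> nonneg_combs G"

text \<open>The triangular decomposition is given by a system of simple roots (a base).\<close>

definition is_simple_system :: "('k::real_vector) lie_data \<Rightarrow> bool" where
  "is_simple_system G \<longleftrightarrow>
     (\<forall>i\<in>{1..rk G}. simple_root G i \<in> roots G) \<and>
     (\<forall>c. simple_comb G c = (\<lambda>x. 0) \<longrightarrow> (\<forall>i\<in>{1..rk G}. c i = 0)) \<and>
     (\<forall>\<alpha>\<in>roots G. \<alpha> \<in> nonneg_combs G \<or> neg_fun \<alpha> \<in> nonneg_combs G)"

definition is_highest_root :: "('k::real_vector) lie_data \<Rightarrow> ('k cplx \<Rightarrow> complex) \<Rightarrow> bool" where
  "is_highest_root G \<theta> \<longleftrightarrow>
     \<theta> \<in> roots G \<and> (\<forall>\<beta>\<in>roots G. (\<lambda>x. \<theta> x - \<beta> x) \<in> nonneg_combs G)"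

definition lie_setting :: "('k::euclidean_space) lie_data \<Rightarrow> bool" where
  "lie_setting G \<longleftrightarrow> simple_lie (lbr G) \<and> compact_lie (lbr G) \<and>
     maximal_abelian (lbr G) (torus G) \<and> is_simple_system G \<and>
     is_highest_root G (highest_root G)"

definition nplus :: "('k::real_vector) lie_data \<Rightarrow> 'k cplx set" where
  "nplus G = cspan (\<Union>\<alpha>\<in>positive_roots G. root_space G \<alpha>)"

definition nminus :: "('k::real_vector) lie_data \<Rightarrow> 'k cplx set" where
  "nminus G = cspan (\<Union>\<alpha>\<in>positive_roots G. root_space G (neg_fun \<alpha>))"

definition coroot :: "('k::real_vector) lie_data \<Rightarrow> ('k cplx \<Rightarrow> complex) \<Rightarrow> 'k cplx" where
  "coroot G \<alpha> = (THE h.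
     h \<in> cspan {cbracket (lbr G) x y | x y. x \<in> root_space G \<alpha> \<and> y \<in> root_space G (neg_fun \<alpha>)} \<and>
     \<alpha> h = 2)"

text \<open>The real form of the Cartan subalgebra (real span of the coroots). All roots take real
  values on it.\<close>

definition cartan_real :: "('k::real_vector) lie_data \<Rightarrow> 'k cplx set" where
  "cartan_real G = span ((\<lambda>i. coroot G (simple_root G i)) ` {1..rk G})"

definition coroot_lattice :: "('k::real_vector) lie_data \<Rightarrow> 'k cplx set" where
  "coroot_lattice G =
     {(\<Sum>i=1..rk G. of_int (c i) *\<^sub>R coroot G (simple_root G i)) | c :: nat \<Rightarrow> int. True}"

definition chamber :: "('k::real_vector) lie_data \<Rightarrow> 'k cplx set" where
  "chamber G = {x \<in> cartan_real G. \<forall>i\<in>{1..rk G}. 0 < Re (simple_root G i x)}"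


section \<open>The finite and the affine Weyl group\<close>

text \<open>Transformations of the real Cartan subalgebra are represented by functions that are the
  identity elsewhere, so that they compose with \<open>\<circ>\<close> and are inverted by \<open>inv\<close>.\<close>

definition reflection :: "('k::real_vector) lie_data \<Rightarrow> ('k cplx \<Rightarrow> complex) \<Rightarrow> 'k cplx \<Rightarrow> 'k cplx" where
  "reflection G \<alpha> = (\<lambda>x. if x \<in> cartan_real G then x - cscale (\<alpha> x) (coroot G \<alpha>) else x)"

definition translation :: "('k::real_vector) lie_data \<Rightarrow> 'k cplx \<Rightarrow> 'k cplx \<Rightarrow> 'k cplx" where
  "translation G h = (\<lambda>x. if x \<in> cartan_real G then x + h else x)"

definition simple_reflection :: "('k::real_vector) lie_data \<Rightarrow> nat \<Rightarrow> 'k cplx \<Rightarrow> 'k cplx" where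
  "simple_reflection G i =
     (if i = 0
      then translation G (coroot G (highest_root G)) \<circ> reflection G (highest_root G)
      else reflection G (simple_root G i))"

inductive_set finite_weyl_group :: "('k::real_vector) lie_data \<Rightarrow> ('k cplx \<Rightarrow> 'k cplx) set"
  for G :: "'k lie_data" where
  weyl_id: "id \<in> finite_weyl_group G"
| weyl_refl: "w \<in> finite_weyl_group G \<Longrightarrow> \<alpha> \<in> roots G \<Longrightarrow> reflection G \<alpha> \<circ> w \<in> finite_weyl_group G"

text \<open>A word \<open>[i, j, \<dots>]\<close> stands for the product \<open>r\<^sub>i \<circ> r\<^sub>j \<circ> \<dots>\<close> of simple reflections.
  Expressions and lengths are relative to a set \<open>I\<close> of letters: \<open>{0..rk G}\<close> for the affine and
  \<open>{1..rk G}\<close> for the finite Weyl group.\<close>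

definition word_prod :: "('k::real_vector) lie_data \<Rightarrow> nat list \<Rightarrow> 'k cplx \<Rightarrow> 'k cplx" where
  "word_prod G u = foldr (\<lambda>i w. simple_reflection G i \<circ> w) u id"

definition weyl_length :: "('k::real_vector) lie_data \<Rightarrow> nat set \<Rightarrow> ('k cplx \<Rightarrow> 'k cplx) \<Rightarrow> nat" where
  "weyl_length G I w = (LEAST n. \<exists>u. set u \<subseteq> I \<and> length u = n \<and> word_prod G u = w)"

definition reduced_expression :: "('k::real_vector) lie_data \<Rightarrow> nat set \<Rightarrow> nat list \<Rightarrow> bool" where
  "reduced_expression G I u \<longleftrightarrow> set u \<subseteq> I \<and> length u = weyl_length G I (word_prod G u)"

definition is_longest_element :: "('k::real_vector) lie_data \<Rightarrow> ('k cplx \<Rightarrow> 'k cplx) \<Rightarrow> bool" where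
  "is_longest_element G w \<longleftrightarrow> w \<in> finite_weyl_group G \<and>
     (\<forall>v\<in>finite_weyl_group G. weyl_length G {1..rk G} v \<le> weyl_length G {1..rk G} w)"


section \<open>Real affine roots\<close>

text \<open>\<open>aff G k \<alpha>\<close> is the affine root \<open>k d\<^sup>* + \<alpha>\<close>, viewed as an affine function on the real Cartan
  subalgebra (and extended by 0).  Imaginary roots are constant functions, hence fixed by
  the affine Weyl group, and never change sign.\<close>

definition aff :: "('k::real_vector) lie_data \<Rightarrow> int \<Rightarrow> ('k cplx \<Rightarrow> complex) \<Rightarrow> 'k cplx \<Rightarrow> complex" where
  "aff G k \<alpha> = (\<lambda>x. if x \<in> cartan_real G then of_int k + \<alpha> x else 0)"

definition affine_roots :: "('k::real_vector) lie_data \<Rightarrow> ('k cplx \<Rightarrow> complex) set" where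
  "affine_roots G = {aff G k \<alpha> | k \<alpha>. \<alpha> \<in> roots G}"

definition positive_affine_roots :: "('k::real_vector) lie_data \<Rightarrow> ('k cplx \<Rightarrow> complex) set" where
  "positive_affine_roots G =
     {aff G k \<alpha> | k \<alpha>. \<alpha> \<in> roots G \<and> (k > 0 \<or> k = 0 \<and> \<alpha> \<in> positive_roots G)}"

definition negative_affine_roots :: "('k::real_vector) lie_data \<Rightarrow> ('k cplx \<Rightarrow> complex) set" where
  "negative_affine_roots G = affine_roots G - positive_affine_roots G"

definition simple_affine_root :: "('k::real_vector) lie_data \<Rightarrow> nat \<Rightarrow> 'k cplx \<Rightarrow> complex" where
  "simple_affine_root G i =
     (if i = 0 then aff G 1 (neg_fun (highest_root G)) else aff G 0 (simple_root G i))"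

definition weyl_act :: "('v \<Rightarrow> 'v) \<Rightarrow> ('v \<Rightarrow> complex) \<Rightarrow> 'v \<Rightarrow> complex" where
  "weyl_act w \<beta> = \<beta> \<circ> inv w"

definition inversions :: "('k::real_vector) lie_data \<Rightarrow> ('k cplx \<Rightarrow> 'k cplx) \<Rightarrow> ('k cplx \<Rightarrow> complex) set" where
  "inversions G w = {\<beta> \<in> positive_affine_roots G. weyl_act w \<beta> \<in> negative_affine_roots G}"


section \<open>The loop algebra\<close>

text \<open>Laurent polynomials in z with coefficients in the complex Lie algebra;
  \<open>Poly_Mapping.single k x\<close> is \<open>z\<^sup>k x\<close>.\<close>

type_synonym 'k loop = "int \<Rightarrow>\<^sub>0 'k cplx"

definition loop_scale :: "complex \<Rightarrow> ('k::real_vector) loop \<Rightarrow> 'k loop" where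
  "loop_scale c f = Poly_Mapping.map (cscale c) f"

lemma lookup_loop_scale [simp]:
  "Poly_Mapping.lookup (loop_scale c f) k = cscale c (Poly_Mapping.lookup f k)"
  by (simp add: loop_scale_def Poly_Mapping.map.rep_eq when_def)

global_interpretation lvec: vector_space "loop_scale :: complex \<Rightarrow> ('k::real_vector) loop \<Rightarrow> 'k loop"
  defines loop_span = lvec.span
  by unfold_locales
    (auto intro!: poly_mapping_eqI simp: lookup_add cvec.scale_right_distrib cvec.scale_left_distrib)

definition affine_root_space :: "('k::real_vector) lie_data \<Rightarrow> ('k cplx \<Rightarrow> complex) \<Rightarrow> 'k loop set" where
  "affine_root_space G \<beta> =
     {Poly_Mapping.single k x | k \<alpha> x. \<alpha> \<in> roots G \<and> \<beta> = aff G k \<alpha> \<and> x \<in> root_space G \<alpha>}"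

text \<open>\<open>V \<otimes> z\<^sup>m \<complex>[z]\<close>\<close>

definition loops_from :: "int \<Rightarrow> 'k::real_vector cplx set \<Rightarrow> 'k loop set" where
  "loops_from m V = {f. \<forall>k. Poly_Mapping.lookup f k \<in> V \<and> (k < m \<longrightarrow> Poly_Mapping.lookup f k = 0)}"


section \<open>Reduced sequences\<close>

text \<open>A sequence of simple reflections is an integer-indexed sequence \<open>\<rho>\<close> of letters, of which only
  the part from the starting index \<open>s\<close> on matters. \<open>wseq G \<rho> s n\<close> is the product
  \<open>r\<^sub>n \<circ> r\<^bsub>n-1\<^esub> \<circ> \<dots> \<circ> r\<^sub>s\<close>, which is the identity for \<open>n < s\<close>.\<close>

definition seq_word :: "(int \<Rightarrow> nat) \<Rightarrow> int \<Rightarrow> int \<Rightarrow> nat list" where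
  "seq_word \<rho> s n = map \<rho> (rev [s..n])"

definition wseq :: "('k::real_vector) lie_data \<Rightarrow> (int \<Rightarrow> nat) \<Rightarrow> int \<Rightarrow> int \<Rightarrow> 'k cplx \<Rightarrow> 'k cplx" where
  "wseq G \<rho> s n = word_prod G (seq_word \<rho> s n)"

definition reduced_sequence :: "('k::real_vector) lie_data \<Rightarrow> (int \<Rightarrow> nat) \<Rightarrow> int \<Rightarrow> bool" where
  "reduced_sequence G \<rho> s \<longleftrightarrow> (\<forall>n\<ge>s. reduced_expression G {0..rk G} (seq_word \<rho> s n))"

definition tau :: "('k::real_vector) lie_data \<Rightarrow> (int \<Rightarrow> nat) \<Rightarrow> int \<Rightarrow> 'k cplx \<Rightarrow> complex" where
  "tau G \<rho> j = weyl_act (inv (wseq G \<rho> 1 (j - 1))) (simple_affine_root G (\<rho> j))"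

text \<open>The translation \<open>w\<^sub>l\<close> corresponds to the lattice point \<open>h\<close> with \<open>w\<^sub>l\<^sup>-\<^sup>1 x = x + h\<close>. Any \<open>l \<ge> 1\<close>
  is allowed, not just the least one.\<close>

definition has_period :: "('k::real_vector) lie_data \<Rightarrow> (int \<Rightarrow> nat) \<Rightarrow> 'k cplx \<Rightarrow> bool" where
  "has_period G \<rho> h \<longleftrightarrow> h \<in> coroot_lattice G \<and>
     (\<exists>l\<ge>1. inv (wseq G \<rho> 1 l) = translation G h \<and>
        (\<forall>s\<ge>0. wseq G \<rho> 1 (s + l) = wseq G \<rho> 1 s \<circ> wseq G \<rho> 1 l))"

definition affine_periodic :: "('k::real_vector) lie_data \<Rightarrow> (int \<Rightarrow> nat) \<Rightarrow> bool" where
  "affine_periodic G \<rho> \<longleftrightarrow> (\<exists>h. has_period G \<rho> h)"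

definition lower_sequence :: "('k::real_vector) lie_data \<Rightarrow> (int \<Rightarrow> nat) \<Rightarrow> bool" where
  "lower_sequence G \<rho> \<longleftrightarrow> reduced_sequence G \<rho> 1 \<and> affine_periodic G \<rho> \<and>
     {tau G \<rho> j | j. 1 \<le> j} = {aff G k (neg_fun \<alpha>) | k \<alpha>. \<alpha> \<in> positive_roots G \<and> 1 \<le> k}"

end

theory Submission
  imports Defs
begin

text \<open>
  Two facts carry the proof. In a group generated by reflections in affine functions the least number
  of generators needed for \<open>w\<close> is the number of positive roots that \<open>w\<close> makes negative
  (\<open>word_length_eq_card_inverted\<close>). And a translation has easily computed inversions: for a lattice
  point \<open>h\<close> of the open chamber, the element \<open>w\<close> with \<open>w\<^sup>-\<^sup>1 x = x + h\<close> inverts exactly the roots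
  \<open>k d\<^sup>* - \<beta>\<close> with \<open>\<beta> > 0\<close> and \<open>1 \<le> k \<le> \<beta>(h)\<close> (\<open>inverted_translation\<close>). Replacing \<open>h\<close> by \<open>n h\<close>
  multiplies the number of these roots by \<open>n\<close>, so the \<open>n\<close>-fold repetition of a reduced word for \<open>w\<close>
  has as many letters as its product has inversions, hence is reduced. The periodic sequence obtained
  in this way inverts, in the limit, all \<open>k d\<^sup>* - \<beta>\<close> with \<open>k \<ge> 1\<close>. The sum of the positive coroots is a
  lattice point of the chamber, so such sequences exist.

  If the longest element \<open>w\<^sub>0\<close> of the finite group is put in front, the product of the first letters
  becomes \<open>w\<^sub>n w\<^sub>0\<^sup>-\<^sup>1\<close>. It inverts the positive roots with \<open>k = 0\<close>, because \<open>w\<^sub>0\<^sup>-\<^sup>1\<close> does and \<open>w\<^sub>n\<close>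
  inverts no root with \<open>k = 0\<close>, and it inverts the images under \<open>w\<^sub>0\<close> of the roots inverted by
  \<open>w\<^sub>n\<close>, which are of the form \<open>k d\<^sup>* + \<alpha>\<close> with \<open>\<alpha> > 0\<close> and \<open>k \<ge> 1\<close>. These are as many roots as there
  are letters, so the sequence is reduced and the roots are all of its inversions
  (\<open>longest_prefix\<close>).

  Translations by coroots have to be products of simple affine reflections. The translation by
  \<open>h\<^sub>\<alpha>\<close> is the product of the reflections in \<open>d\<^sup>* - \<alpha>\<close> and \<open>\<alpha>\<close>, and every positive affine root
  can be lowered to a simple one by simple reflections (\<open>affine_root_induct\<close>), so its reflection is a
  conjugate of a simple reflection.

  The properties of roots and coroots behind all this are obtained from the negative definite Killing
  form. It yields a positive form on the complexification for which the adjoint of \<open>ad e\<close> is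
  \<open>ad (star e)\<close>; for a root vector \<open>e\<close> the elements \<open>e\<close>, \<open>star e\<close> and their bracket span \<open>sl\<^sub>2\<close>. The
  identity \<open>norm_raise\<close> for the norms of raised and lowered vectors shows that root spaces are lines
  and that \<open>n \<alpha>\<close> is not a root for \<open>n \<ge> 2\<close>; highest weight vectors give
  integrality and the invariance of the roots under reflections. The locale \<open>root_datum\<close> collects
  what is used of this later.
\<close>


section \<open>The Killing form as an inner product\<close>

lemma trace_mult_commute:
  fixes A B :: "'a::euclidean_space \<Rightarrow> 'a"
  assumes "linear A" "linear B"
  shows "(\<Sum>b\<in>Basis. A (B b) \<bullet> b) = (\<Sum>b\<in>Basis. B (A b) \<bullet> b)"
proof -
  have expand: "(\<Sum>b\<in>Basis. F (H b) \<bullet> b) = (\<Sum>b\<in>Basis. \<Sum>c\<in>Basis. (H b \<bullet> c) * (F c \<bullet> b))"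
    if "linear F" for F H :: "'a \<Rightarrow> 'a"
  proof (rule sum.cong[OF refl])
    fix b :: 'a
    have "F (H b) = F (\<Sum>c\<in>Basis. (H b \<bullet> c) *\<^sub>R c)"
      by (simp add: euclidean_representation)
    also have "\<dots> = (\<Sum>c\<in>Basis. (H b \<bullet> c) *\<^sub>R F c)"
      using that by (simp add: linear_sum linear_cmul)
    finally show "F (H b) \<bullet> b = (\<Sum>c\<in>Basis. (H b \<bullet> c) * (F c \<bullet> b))"
      by (simp add: inner_sum_left)
  qed
  show ?thesis
    unfolding expand[OF assms(1)] expand[OF assms(2)]
    by (subst sum.swap) (simp add: mult.commute)
qed

text \<open>Minus the conjugation with respect to the compact form. It is the adjoint: see \<open>ip_cb_adjoint\<close>.\<close>

definition star :: "'k::real_vector cplx \<Rightarrow> 'k cplx" where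
  "star v = (- fst v, snd v)"

lemma star_star [simp]: "star (star v) = v"
  by (simp add: star_def)

lemma star_eq_0_iff [simp]: "star v = 0 \<longleftrightarrow> v = 0"
  by (auto simp: star_def prod_eq_iff)

lemma star_cscale: "star (cscale c v) = cscale (cnj c) (star v)"
  by (simp add: star_def cscale_def)

lemma cscale_of_real [simp]: "cscale (of_real a) v = a *\<^sub>R v"
  by (simp add: cscale_def prod_eq_iff)

lemma neg_fun_neg_fun [simp]: "neg_fun (neg_fun \<alpha>) = \<alpha>"
  by (simp add: neg_fun_def)

locale compact_lie_algebra =
  fixes br :: "'k::euclidean_space \<Rightarrow> 'k \<Rightarrow> 'k"
  assumes lie: "lie_bracket br" and compact: "compact_lie br"
begin

lemma bilinear_br: "bilinear br"
  using lie by (simp add: lie_bracket_def)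

lemmas br_simps =
  bilinear_ladd[OF bilinear_br] bilinear_radd[OF bilinear_br]
  bilinear_lsub[OF bilinear_br] bilinear_rsub[OF bilinear_br]
  bilinear_lneg[OF bilinear_br] bilinear_rneg[OF bilinear_br]
  bilinear_lmul[OF bilinear_br] bilinear_rmul[OF bilinear_br]
  bilinear_lzero[OF bilinear_br] bilinear_rzero[OF bilinear_br]

lemma linear_br: "linear (br x)"
  using bilinear_br by (simp add: bilinear_def)

lemma br_self: "br x x = 0"
  using lie by (simp add: lie_bracket_def)

lemma br_anticomm: "br x y = - br y x"
proof -
  have "br (x + y) (x + y) = br x y + br y x"
    unfolding br_simps by (simp add: br_self)
  then show ?thesis
    using br_self[of "x + y"] by (simp add: eq_neg_iff_add_eq_0)
qed

lemma jacobi: "br (br x y) z = br x (br y z) - br y (br x z)"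
proof -
  have "br x (br y z) + br y (br z x) + br z (br x y) = 0"
    using lie by (simp add: lie_bracket_def)
  moreover have "br y (br z x) = - br y (br x z)"
    by (subst br_anticomm[of z x]) (simp add: br_simps)
  moreover have "br z (br x y) = - br (br x y) z"
    by (rule br_anticomm)
  ultimately show ?thesis
    by (simp add: algebra_simps eq_neg_iff_add_eq_0)
qed

abbreviation K where "K \<equiv> killing_form br"

lemma K_add_left: "K (x + y) z = K x z + K y z"
  by (simp add: killing_form_def br_simps inner_add_left sum.distrib)

lemma K_scale_left: "K (a *\<^sub>R x) z = a * K x z"
  by (simp add: killing_form_def br_simps sum_distrib_left)

lemma K_commute: "K x y = K y x"
  unfolding killing_form_def by (rule trace_mult_commute) (rule linear_br)+

lemma K_add_right: "K z (x + y) = K z x + K z y"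
  by (metis K_commute K_add_left)

lemma K_scale_right: "K z (a *\<^sub>R x) = a * K z x"
  by (metis K_commute K_scale_left)

lemma K_minus_left: "K (- x) z = - K x z"
  using K_scale_left[of "-1"] by simp

lemma K_minus_right: "K z (- x) = - K z x"
  by (metis K_commute K_minus_left)

lemma K_diff_left: "K (x - y) z = K x z - K y z"
  using K_add_left[of x "- y"] by (simp add: K_minus_left)

lemma K_diff_right: "K z (x - y) = K z x - K z y"
  by (metis K_commute K_diff_left)

lemmas K_simps = K_add_left K_add_right K_scale_left K_scale_right K_minus_left K_minus_right
  K_diff_left K_diff_right

lemma K_invariant: "K (br x y) z = K x (br y z)"
proof -
  have "K (br x y) z = (\<Sum>b\<in>Basis. br x (br y (br z b)) \<bullet> b) - (\<Sum>b\<in>Basis. br y (br x (br z b)) \<bullet> b)"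
    by (simp add: killing_form_def jacobi inner_diff_left sum_subtractf)
  also have "(\<Sum>b\<in>Basis. br y (br x (br z b)) \<bullet> b) = (\<Sum>b\<in>Basis. br x (br z (br y b)) \<bullet> b)"
    using trace_mult_commute[of "br y" "br x \<circ> br z"] linear_br
    by (simp add: linear_compose)
  also have "(\<Sum>b\<in>Basis. br x (br y (br z b)) \<bullet> b) - (\<Sum>b\<in>Basis. br x (br z (br y b)) \<bullet> b) = K x (br y z)"
    by (simp add: killing_form_def jacobi br_simps inner_diff_left sum_subtractf)
  finally show ?thesis .
qed

lemma K_neg: "x \<noteq> 0 \<Longrightarrow> K x x < 0"
  using compact by (simp add: compact_lie_def)

text \<open>The real part of the Hermitian form on the complexification for which \<open>\<i>\<close> acts as a
  unitary map and the compact form acts by skew operators.\<close>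

definition ip :: "'k cplx \<Rightarrow> 'k cplx \<Rightarrow> real" where
  "ip v w = - K (fst v) (fst w) - K (snd v) (snd w)"

lemma ip_add_left: "ip (u + v) w = ip u w + ip v w"
  by (simp add: ip_def K_add_left)

lemma ip_commute: "ip v w = ip w v"
  by (simp add: ip_def K_commute)

lemma ip_scale_left: "ip (a *\<^sub>R v) w = a * ip v w"
  by (simp add: ip_def K_scale_left algebra_simps)

lemma ip_scale_right: "ip v (a *\<^sub>R w) = a * ip v w"
  by (metis ip_commute ip_scale_left)

lemma ip_add_right: "ip u (v + w) = ip u v + ip u w"
  by (metis ip_commute ip_add_left)

lemma ip_minus_left: "ip (- v) w = - ip v w"
  using ip_scale_left[of "-1"] by simp

lemma ip_diff_left: "ip (u - v) w = ip u w - ip v w"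
  using ip_add_left[of u "- v"] by (simp add: ip_minus_left)

lemma ip_minus_right: "ip v (- w) = - ip v w"
  by (metis ip_commute ip_minus_left)

lemma ip_diff_right: "ip w (u - v) = ip w u - ip w v"
  by (metis ip_commute ip_diff_left)

lemma ip_zero_left [simp]: "ip 0 w = 0"
  using ip_scale_left[of 0] by simp

lemma ip_zero_right [simp]: "ip w 0 = 0"
  by (metis ip_commute ip_zero_left)

lemmas ip_simps = ip_add_left ip_add_right ip_scale_left ip_scale_right ip_minus_left
  ip_minus_right ip_diff_left ip_diff_right

lemma ip_pos: "v \<noteq> 0 \<Longrightarrow> 0 < ip v v"
proof -
  assume "v \<noteq> 0"
  have nonpos: "K x x \<le> 0" for x
    using K_neg[of x] K_scale_left[of 0 0 0] by (cases "x = 0") auto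
  show ?thesis
    using \<open>v \<noteq> 0\<close> K_neg[of "fst v"] K_neg[of "snd v"] nonpos[of "fst v"] nonpos[of "snd v"]
    by (cases "fst v = 0") (auto simp: ip_def prod_eq_iff)
qed

lemma ip_self_eq_0_iff: "ip v v = 0 \<longleftrightarrow> v = 0"
  using ip_pos[of v] by (cases "v = 0") auto

lemma ip_nonneg: "0 \<le> ip v v"
  using ip_pos[of v] by (cases "v = 0") auto

lemma ip_cscale_left: "ip (cscale c v) w = ip v (cscale (cnj c) w)"
  by (simp add: ip_def cscale_def K_simps)


section \<open>The complexified bracket\<close>

abbreviation cb where "cb \<equiv> cbracket br"

lemma cb_add_left: "cb (u + v) w = cb u w + cb v w"
  and cb_add_right: "cb w (u + v) = cb w u + cb w v"
  and cb_minus_left: "cb (- v) w = - cb v w"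
  and cb_minus_right: "cb w (- v) = - cb w v"
  and cb_diff_left: "cb (u - v) w = cb u w - cb v w"
  and cb_diff_right: "cb w (u - v) = cb w u - cb w v"
  and cb_cscale_left: "cb (cscale c v) w = cscale c (cb v w)"
  and cb_cscale_right: "cb w (cscale c v) = cscale c (cb w v)"
  and cb_zero_left [simp]: "cb 0 w = 0"
  and cb_zero_right [simp]: "cb w 0 = 0"
  by (simp_all add: cbracket_def cscale_def br_simps prod_eq_iff algebra_simps)

lemmas cb_simps = cb_add_left cb_add_right cb_minus_left cb_minus_right cb_diff_left cb_diff_right
  cb_cscale_left cb_cscale_right

lemma cb_anticomm: "cb v w = - cb w v"
  using br_anticomm[of "fst v"] br_anticomm[of "snd v"]
  by (simp add: cbracket_def prod_eq_iff)

lemma cb_jacobi: "cb (cb u v) w = cb u (cb v w) - cb v (cb u w)"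
  by (simp add: cbracket_def br_simps jacobi prod_eq_iff)

text \<open>An element \<open>a + \<i> b\<close> acts as a skew operator plus \<open>\<i>\<close> times a skew operator; its adjoint
  is the action of \<open>-a + \<i> b\<close>.\<close>

lemma ip_cb_adjoint: "ip (cb u v) w = ip v (cb (star u) w)"
proof -
  have K_skew: "K (br a x) y = - K x (br a y)" for a x y
  proof -
    have "K (br a x) y = K y (br a x)"
      by (rule K_commute)
    also have "\<dots> = K (br y a) x"
      by (rule K_invariant[symmetric])
    also have "br y a = - br a y"
      by (rule br_anticomm)
    finally show ?thesis
      by (simp add: K_minus_left K_minus_right K_commute)
  qed
  show ?thesis
    by (simp add: ip_def cbracket_def star_def K_simps K_skew br_simps)
qed

lemma star_cb: "star (cb u v) = - cb (star u) (star v)"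
  by (simp add: star_def cbracket_def br_simps)

end

section \<open>Root spaces and coroots of a compact simple Lie algebra\<close>

locale compact_root_spaces =
  fixes G :: "('k::euclidean_space) lie_data"
  assumes setting: "lie_setting G"

sublocale compact_root_spaces \<subseteq> compact_lie_algebra "lbr G"
  using setting by unfold_locales (auto simp: lie_setting_def simple_lie_def)

context compact_root_spaces
begin

lemma abelian_torus: "abelian_subalgebra (lbr G) (torus G)"
  using setting by (simp add: lie_setting_def maximal_abelian_def)

lemma subspace_torus: "subspace (torus G)"
  using abelian_torus by (simp add: abelian_subalgebra_def)

text \<open>Together with an element that commutes with the torus, the torus would span a larger abelian
  subalgebra.\<close>

lemma torus_self_centralizing:
  assumes "\<And>t. t \<in> torus G \<Longrightarrow> lbr G t x = 0"
  shows "x \<in> torus G"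
proof -
  let ?s = "span (insert x (torus G))"
  have rep: "\<exists>k t. y = k *\<^sub>R x + t \<and> t \<in> torus G" if y: "y \<in> ?s" for y
  proof -
    obtain k where "y - k *\<^sub>R x \<in> span (torus G)"
      using y unfolding span_insert by blast
    then have "y - k *\<^sub>R x \<in> torus G"
      using subspace_torus by (simp only: span_eq_iff[THEN iffD2])
    then show ?thesis
      by (intro exI[of _ k] exI[of _ "y - k *\<^sub>R x"]) simp
  qed
  have "abelian_subalgebra (lbr G) ?s"
    unfolding abelian_subalgebra_def
  proof (intro conjI ballI)
    fix y z assume "y \<in> ?s" "z \<in> ?s"
    then obtain k t l u where "y = k *\<^sub>R x + t" "t \<in> torus G" "z = l *\<^sub>R x + u" "u \<in> torus G"
      using rep by metis
    moreover have "lbr G t u = 0"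
      using abelian_torus calculation by (simp add: abelian_subalgebra_def)
    moreover have "lbr G x u = 0"
      using assms[of u] calculation br_anticomm[of x u] by simp
    ultimately show "lbr G y z = 0"
      using assms[of t] by (simp add: br_simps br_self)
  qed simp
  moreover have "torus G \<subseteq> ?s"
    by (auto intro: span_base)
  ultimately have "?s = torus G"
    using setting by (simp add: lie_setting_def maximal_abelian_def)
  then show ?thesis
    using span_base[of x "insert x (torus G)"] by simp
qed

lemma cartan_iff: "x \<in> cartan G \<longleftrightarrow> fst x \<in> torus G \<and> snd x \<in> torus G"
  by (cases x) (simp add: cartan_def)

lemma cartan_cscale: "x \<in> cartan G \<Longrightarrow> cscale c x \<in> cartan G"
  and cartan_zero: "0 \<in> cartan G"
  using subspace_torus
  by (auto simp: cartan_iff cscale_def subspace_add subspace_mul subspace_diff subspace_0)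

lemma cartan_star: "x \<in> cartan G \<Longrightarrow> star x \<in> cartan G"
  using subspace_torus by (simp add: cartan_iff star_def subspace_neg)

lemma cartan_scaleR: "x \<in> cartan G \<Longrightarrow> a *\<^sub>R x \<in> cartan G"
  using cartan_cscale[of x "of_real a"] by simp

lemma cartan_self_centralizing:
  assumes "\<And>h. h \<in> cartan G \<Longrightarrow> cb h v = 0"
  shows "v \<in> cartan G"
proof -
  have "lbr G t (fst v) = 0 \<and> lbr G t (snd v) = 0" if "t \<in> torus G" for t
    using assms[of "(t, 0)"] that subspace_torus
    by (simp add: cartan_iff cbracket_def br_simps subspace_0 zero_prod_def)
  then show ?thesis
    by (simp add: cartan_iff torus_self_centralizing)
qed

text \<open>The real form of the Cartan subalgebra on which the roots turn out to be real; coroots will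
  be found in it.\<close>

definition itorus :: "'k cplx set" where
  "itorus = {0} \<times> torus G"

lemma itorus_iff: "z \<in> itorus \<longleftrightarrow> fst z = 0 \<and> snd z \<in> torus G"
  by (cases z) (auto simp: itorus_def)

lemma subspace_itorus: "subspace itorus"
  using subspace_torus by (auto simp: subspace_def itorus_iff)

lemma itorus_cartan: "z \<in> itorus \<Longrightarrow> z \<in> cartan G"
  using subspace_torus by (simp add: itorus_iff cartan_iff subspace_0)

lemma itorus_star: "z \<in> itorus \<Longrightarrow> star z = z"
  by (simp add: itorus_iff star_def prod_eq_iff)

lemma itorus_eqI:
  assumes "x \<in> itorus" "y \<in> itorus" "\<And>z. z \<in> itorus \<Longrightarrow> ip x z = ip y z"
  shows "x = y"
proof -
  have "x - y \<in> itorus"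
    using assms subspace_itorus by (simp add: subspace_diff)
  then have "ip (x - y) (x - y) = 0"
    using assms(3) by (simp add: ip_diff_left)
  then show ?thesis
    by (simp add: ip_self_eq_0_iff)
qed

lemma cartan_decomp:
  assumes "x \<in> cartan G"
  obtains z u where "z \<in> itorus" "u \<in> itorus" "x = z + cscale \<i> u" "star x = z - cscale \<i> u"
proof
  show "(0, snd x) \<in> itorus" "(0, - fst x) \<in> itorus"
    using assms subspace_torus by (simp_all add: itorus_iff cartan_iff subspace_neg)
qed (simp_all add: cscale_def star_def prod_eq_iff)

lemma dual_add: "\<alpha> \<in> cartan_dual G \<Longrightarrow> x \<in> cartan G \<Longrightarrow> y \<in> cartan G \<Longrightarrow> \<alpha> (x + y) = \<alpha> x + \<alpha> y"
  and dual_cscale: "\<alpha> \<in> cartan_dual G \<Longrightarrow> x \<in> cartan G \<Longrightarrow> \<alpha> (cscale c x) = c * \<alpha> x"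
  and dual_outside: "\<alpha> \<in> cartan_dual G \<Longrightarrow> x \<notin> cartan G \<Longrightarrow> \<alpha> x = 0"
  by (simp_all add: cartan_dual_def del: split_paired_All)

lemma dual_scaleR: "\<alpha> \<in> cartan_dual G \<Longrightarrow> x \<in> cartan G \<Longrightarrow> \<alpha> (a *\<^sub>R x) = of_real a * \<alpha> x"
  using dual_cscale[of \<alpha> x "of_real a"] by simp

lemma dual_diff:
  assumes "\<alpha> \<in> cartan_dual G" "x \<in> cartan G" "y \<in> cartan G"
  shows "\<alpha> (x - y) = \<alpha> x - \<alpha> y"
  using dual_add[OF assms(1,2) cartan_scaleR[OF assms(3), of "-1"]]
    dual_scaleR[OF assms(1,3), of "-1"] by simp

lemma dual_eqI:
  assumes "\<alpha> \<in> cartan_dual G" "\<beta> \<in> cartan_dual G" "\<And>z. z \<in> itorus \<Longrightarrow> \<alpha> z = \<beta> z"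
  shows "\<alpha> = \<beta>"
proof
  fix x
  show "\<alpha> x = \<beta> x"
  proof (cases "x \<in> cartan G")
    case True
    then obtain z u where "z \<in> itorus" "u \<in> itorus" "x = z + cscale \<i> u"
      by (rule cartan_decomp)
    then show ?thesis
      using assms by (simp add: dual_add dual_cscale itorus_cartan cartan_cscale)
  qed (simp add: dual_outside assms)
qed

lemma dual_sub_multiple:
  assumes "\<beta> \<in> cartan_dual G" "\<alpha> \<in> cartan_dual G"
  shows "(\<lambda>x. \<beta> x - c * \<alpha> x) \<in> cartan_dual G"
  using assms by (auto simp: cartan_dual_def algebra_simps)

lemma dual_neg: "\<alpha> \<in> cartan_dual G \<Longrightarrow> neg_fun \<alpha> \<in> cartan_dual G"
  by (auto simp: cartan_dual_def neg_fun_def)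

lemma dual_zero: "(\<lambda>x. 0) \<in> cartan_dual G"
  by (simp add: cartan_dual_def)

lemma root_spaceD: "v \<in> root_space G \<alpha> \<Longrightarrow> h \<in> cartan G \<Longrightarrow> cb h v = cscale (\<alpha> h) v"
  by (simp add: root_space_def)

lemma root_space_zero: "0 \<in> root_space G \<alpha>"
  by (simp add: root_space_def)

lemma root_space_cscale: "v \<in> root_space G \<alpha> \<Longrightarrow> cscale c v \<in> root_space G \<alpha>"
  by (simp add: root_space_def cb_simps mult.commute)

lemma root_space_diff: "v \<in> root_space G \<alpha> \<Longrightarrow> w \<in> root_space G \<alpha> \<Longrightarrow> v - w \<in> root_space G \<alpha>"
  by (simp add: root_space_def cb_simps cvec.scale_right_diff_distrib)

lemma root_space_cb:
  assumes "v \<in> root_space G \<alpha>" "w \<in> root_space G \<beta>"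
  shows "cb v w \<in> root_space G (\<lambda>x. \<alpha> x + \<beta> x)"
proof -
  have "cb h (cb v w) = cscale (\<alpha> h + \<beta> h) (cb v w)" if "h \<in> cartan G" for h
  proof -
    have "cb h (cb v w) = cb (cb h v) w + cb v (cb h w)"
      by (simp add: cb_jacobi)
    then show ?thesis
      using assms that by (simp add: root_spaceD cb_simps cvec.scale_left_distrib)
  qed
  then show ?thesis
    by (simp add: root_space_def)
qed

lemma root_space_0_cartan: "v \<in> root_space G (\<lambda>x. 0) \<Longrightarrow> v \<in> cartan G"
  by (rule cartan_self_centralizing) (simp add: root_space_def)

lemma roots_dual: "\<alpha> \<in> roots G \<Longrightarrow> \<alpha> \<in> cartan_dual G"
  by (simp add: roots_def)

lemma root_vector:
  assumes "\<alpha> \<in> roots G"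
  obtains v where "v \<in> root_space G \<alpha>" "v \<noteq> 0"
proof (rule ccontr)
  assume "\<not> thesis"
  then have "root_space G \<alpha> = {0}"
    using that root_space_zero[of \<alpha>] by blast
  then show False
    using assms by (simp add: roots_def)
qed

lemma rootI: "\<alpha> \<in> cartan_dual G \<Longrightarrow> \<alpha> x \<noteq> 0 \<Longrightarrow> v \<in> root_space G \<alpha> \<Longrightarrow> v \<noteq> 0 \<Longrightarrow> \<alpha> \<in> roots G"
  by (auto simp: roots_def)

lemma ip_self_cscale: "ip v (cscale c v) = Re c * ip v v"
  by (simp add: ip_def cscale_def K_simps K_commute[of "snd v" "fst v"] algebra_simps)

text \<open>Elements of \<^term>\<open>itorus\<close> act by self-adjoint operators, so their eigenvalues are real.\<close>

lemma root_real:
  assumes "\<alpha> \<in> roots G" "z \<in> itorus"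
  shows "Im (\<alpha> z) = 0"
proof -
  obtain v where v: "v \<in> root_space G \<alpha>" "v \<noteq> 0"
    using assms(1) by (rule root_vector)
  have "ip (cb z v) (cscale \<i> v) = ip v (cb z (cscale \<i> v))"
    using ip_cb_adjoint[of z] by (simp add: itorus_star assms)
  then have "Im (\<alpha> z) * ip v v = - Im (\<alpha> z) * ip v v"
    using v assms by (simp add: root_spaceD itorus_cartan cb_simps ip_cscale_left ip_self_cscale)
  then show ?thesis
    using v ip_self_eq_0_iff[of v] by simp
qed

lemma root_star:
  assumes "\<alpha> \<in> roots G" "x \<in> cartan G"
  shows "\<alpha> (star x) = cnj (\<alpha> x)"
proof -
  obtain z u where "z \<in> itorus" "u \<in> itorus" "x = z + cscale \<i> u" "star x = z - cscale \<i> u"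
    using assms(2) by (rule cartan_decomp)
  then show ?thesis
    using assms root_real[of \<alpha> z] root_real[of \<alpha> u]
    by (auto simp: roots_dual dual_add dual_diff dual_cscale itorus_cartan cartan_cscale complex_eq_iff)
qed

lemma root_space_star:
  assumes "\<alpha> \<in> roots G" "v \<in> root_space G \<alpha>"
  shows "star v \<in> root_space G (neg_fun \<alpha>)"
proof -
  have "cb h (star v) = cscale (- \<alpha> h) (star v)" if "h \<in> cartan G" for h
  proof -
    have "cb h (star v) = - star (cb (star h) v)"
      by (simp add: star_cb)
    also have "\<dots> = - star (cscale (\<alpha> (star h)) v)"
      using assms that by (simp add: root_spaceD cartan_star)
    finally show ?thesis
      using assms that by (simp add: star_cscale root_star)
  qed
  then show ?thesis
    by (simp add: root_space_def neg_fun_def)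
qed

lemma neg_root: "\<alpha> \<in> roots G \<Longrightarrow> neg_fun \<alpha> \<in> roots G"
proof -
  assume \<alpha>: "\<alpha> \<in> roots G"
  obtain v where v: "v \<in> root_space G \<alpha>" "v \<noteq> 0"
    using \<alpha> by (rule root_vector)
  obtain x where "\<alpha> x \<noteq> 0"
    using \<alpha> by (auto simp: roots_def fun_eq_iff)
  then show ?thesis
    using rootI[where x = x, OF dual_neg[OF roots_dual[OF \<alpha>]] _ root_space_star[OF \<alpha> v(1)]] v(2)
    by (simp add: neg_fun_def)
qed

text \<open>Eigenspaces of self-adjoint operators to different eigenvalues are orthogonal, so there is
  room for finitely many roots only.\<close>

lemma root_spaces_orthogonal:
  assumes "\<alpha> \<in> roots G" "\<beta> \<in> roots G" "\<alpha> \<noteq> \<beta>" "v \<in> root_space G \<alpha>" "w \<in> root_space G \<beta>"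
  shows "ip v w = 0"
proof -
  obtain z where z: "z \<in> itorus" "\<alpha> z \<noteq> \<beta> z"
    using assms dual_eqI[of \<alpha> \<beta>] by (auto simp: roots_dual)
  have "\<alpha> z = of_real (Re (\<alpha> z))" "\<beta> z = of_real (Re (\<beta> z))"
    using root_real assms z by (auto simp: complex_eq_iff)
  then have "cb z v = Re (\<alpha> z) *\<^sub>R v" "cb z w = Re (\<beta> z) *\<^sub>R w" "Re (\<alpha> z) \<noteq> Re (\<beta> z)"
    using assms z root_spaceD[of v \<alpha> z] root_spaceD[of w \<beta> z]
    by (metis itorus_cartan cscale_of_real)+
  moreover have "ip (cb z v) w = ip v (cb z w)"
    using ip_cb_adjoint[of z] by (simp add: itorus_star z)
  ultimately show ?thesis
    by (simp add: ip_simps)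
qed

lemma finite_roots: "finite (roots G)"
proof -
  define X where "X \<alpha> = (SOME v. v \<in> root_space G \<alpha> \<and> v \<noteq> 0)" for \<alpha>
  have X: "X \<alpha> \<in> root_space G \<alpha>" "X \<alpha> \<noteq> 0" if "\<alpha> \<in> roots G" for \<alpha>
    unfolding X_def using someI_ex[of "\<lambda>v. v \<in> root_space G \<alpha> \<and> v \<noteq> 0"] root_vector[OF that]
    by metis+
  have orth: "ip (X \<alpha>) (X \<beta>) = 0" if "\<alpha> \<in> roots G" "\<beta> \<in> roots G" "\<alpha> \<noteq> \<beta>" for \<alpha> \<beta>
    using root_spaces_orthogonal[OF that] X that by blast
  have inj: "inj_on X (roots G)"
  proof (rule inj_onI, rule ccontr)
    fix \<alpha> \<beta> assume *: "\<alpha> \<in> roots G" "\<beta> \<in> roots G" "X \<alpha> = X \<beta>" "\<alpha> \<noteq> \<beta>"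
    then show False
      using orth[of \<alpha> \<beta>] X[of \<beta>] by (simp add: ip_self_eq_0_iff)
  qed
  have "independent (X ` roots G)"
    unfolding dependent_def
  proof (rule notI, elim bexE imageE)
    fix x \<alpha> assume "x \<in> span (X ` roots G - {x})" "x = X \<alpha>" "\<alpha> \<in> roots G"
    then have \<alpha>: "\<alpha> \<in> roots G" "X \<alpha> \<in> span (X ` roots G - {X \<alpha>})"
      by simp_all
    have "ip (X \<alpha>) y = 0" if "y \<in> span (X ` roots G - {X \<alpha>})" for y
      using that
    proof (induction rule: span_induct_alt)
      case (step c x y)
      then obtain \<beta> where "\<beta> \<in> roots G" "x = X \<beta>" "\<beta> \<noteq> \<alpha>"
        by auto
      then show ?case
        using step orth[of \<alpha> \<beta>] \<alpha> by (simp add: ip_simps)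
    qed simp
    then have "ip (X \<alpha>) (X \<alpha>) = 0"
      using \<alpha>(2) .
    then show False
      using X[OF \<alpha>(1)] by (simp add: ip_self_eq_0_iff)
  qed
  then show ?thesis
    using independent_bound inj finite_imageD by blast
qed


subsection \<open>Triples\<close>

text \<open>A normalized root vector \<open>e\<close> spans, with its adjoint \<^term>\<open>star e\<close> and the bracket of the
  two, a copy of \<open>sl\<^sub>2\<close>. The bracket will be the coroot.\<close>

definition triple :: "('k cplx \<Rightarrow> complex) \<Rightarrow> 'k cplx \<Rightarrow> bool" where
  "triple \<alpha> e \<longleftrightarrow> \<alpha> \<in> roots G \<and> e \<in> root_space G \<alpha> \<and> \<alpha> (cb e (star e)) = 2"

lemma bracket_star_itorus:
  assumes "\<alpha> \<in> roots G" "e \<in> root_space G \<alpha>"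
  shows "cb e (star e) \<in> itorus"
proof -
  have "cb e (star e) \<in> root_space G (\<lambda>x. 0)"
    using root_space_cb[OF assms(2) root_space_star[OF assms]] by (simp add: neg_fun_def)
  then have "cb e (star e) \<in> cartan G"
    by (rule root_space_0_cartan)
  moreover have "fst (cb e (star e)) = 0"
    by (simp add: cbracket_def star_def br_simps br_self)
  ultimately show ?thesis
    by (simp add: itorus_iff cartan_iff)
qed

lemma ip_bracket_star:
  assumes "\<alpha> \<in> roots G" "e \<in> root_space G \<alpha>" "z \<in> itorus"
  shows "ip (cb e (star e)) z = Re (\<alpha> z) * ip (star e) (star e)"
proof -
  have "ip (cb e (star e)) z = ip (star e) (cb (star e) z)"
    by (rule ip_cb_adjoint)
  also have "cb (star e) z = - cb z (star e)"
    by (rule cb_anticomm)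
  also have "cb z (star e) = cscale (- \<alpha> z) (star e)"
    using root_spaceD[OF root_space_star[OF assms(1,2)] itorus_cartan[OF assms(3)]]
    by (simp add: neg_fun_def)
  finally show ?thesis
    by (simp add: ip_minus_right ip_self_cscale)
qed

lemma triple_exists:
  assumes \<alpha>: "\<alpha> \<in> roots G"
  obtains e where "triple \<alpha> e"
proof -
  obtain v where v: "v \<in> root_space G \<alpha>" "v \<noteq> 0"
    using \<alpha> by (rule root_vector)
  define h where "h = cb v (star v)"
  have h: "h \<in> itorus"
    unfolding h_def using \<alpha> v by (simp add: bracket_star_itorus)
  have star_pos: "0 < ip (star v) (star v)"
    using v by (simp add: ip_pos)
  have ip_h: "ip h z = Re (\<alpha> z) * ip (star v) (star v)" if "z \<in> itorus" for z
    unfolding h_def using \<alpha> v that by (simp add: ip_bracket_star)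
  have "h \<noteq> 0"
  proof
    assume "h = 0"
    then have "\<alpha> z = 0" if "z \<in> itorus" for z
      using ip_h[OF that] star_pos root_real[OF \<alpha> that] by (simp add: complex_eq_iff)
    then have "\<alpha> = (\<lambda>x. 0)"
      by (intro dual_eqI) (simp_all add: roots_dual \<alpha> dual_zero)
    then show False
      using \<alpha> by (simp add: roots_def)
  qed
  then have pos: "0 < Re (\<alpha> h)"
    using ip_h[OF h] ip_pos[of h] star_pos by (simp add: zero_less_mult_iff)
  define a where "a = sqrt (2 / Re (\<alpha> h))"
  have a: "a * a = 2 / Re (\<alpha> h)"
    using pos by (simp add: a_def)
  have "cb (a *\<^sub>R v) (star (a *\<^sub>R v)) = (a * a) *\<^sub>R h"
    using cb_cscale_left[of "of_real a" v] cb_cscale_right[of v "of_real a" "star v"]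
      star_cscale[of "of_real a" v] by (simp add: h_def)
  moreover have "\<alpha> h = of_real (Re (\<alpha> h))"
    using root_real[OF \<alpha> h] by (simp add: complex_eq_iff)
  ultimately have "\<alpha> (cb (a *\<^sub>R v) (star (a *\<^sub>R v))) = of_real (a * a * Re (\<alpha> h))"
    using \<alpha> h by (metis dual_scaleR roots_dual itorus_cartan of_real_mult)
  also have "a * a * Re (\<alpha> h) = 2"
    using pos a by simp
  finally have "triple \<alpha> (a *\<^sub>R v)"
    using \<alpha> v root_space_cscale[of v \<alpha> "of_real a"] by (simp add: triple_def)
  then show ?thesis ..
qed

lemma triple_nonzero: "triple \<alpha> e \<Longrightarrow> e \<noteq> 0"
  using dual_scaleR[of \<alpha> 0 0] cartan_zero by (auto simp: triple_def roots_dual)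

lemma triple_star:
  assumes "triple \<alpha> e"
  shows "triple (neg_fun \<alpha>) (star e)"
proof -
  have "\<alpha> (- cb e (star e)) = - \<alpha> (cb e (star e))"
    using dual_scaleR[of \<alpha> "cb e (star e)" "-1"] assms bracket_star_itorus[of \<alpha> e]
    by (simp add: triple_def roots_dual itorus_cartan)
  then show ?thesis
    using assms by (simp add: triple_def neg_root root_space_star cb_anticomm[of "star e"])
      (simp add: neg_fun_def)
qed

lemma triple_bracket_cartan: "triple \<alpha> e \<Longrightarrow> cb e (star e) \<in> cartan G"
  unfolding triple_def by (intro itorus_cartan bracket_star_itorus[of \<alpha>]) simp_all

lemma triple_star_bracket: "cb (star e) (star (star e)) = - cb e (star e)"
  using cb_anticomm[of "star e" e] by simp

text \<open>The operators \<open>ad e\<close> and \<open>ad (star e)\<close> are adjoint to each other and their commutator is the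
  action of the coroot, so the squared norms of a raised and of a lowered vector differ by the weight.\<close>

lemma norm_raise:
  assumes "triple \<alpha> e" "v \<in> root_space G \<mu>"
  shows "ip (cb e v) (cb e v)
    = ip (cb (star e) v) (cb (star e) v) - Re (\<mu> (cb e (star e))) * ip v v"
proof -
  let ?h = "cb e (star e)"
  have "ip (cb e v) (cb e v) = ip v (cb (star e) (cb e v))"
    by (rule ip_cb_adjoint)
  also have "cb (star e) (cb e v) = cb e (cb (star e) v) - cb ?h v"
    by (simp add: cb_jacobi)
  also have "cb ?h v = cscale (\<mu> ?h) v"
    using assms bracket_star_itorus[of \<alpha> e] by (simp add: triple_def root_spaceD itorus_cartan)
  also have "ip v (cb e (cb (star e) v) - cscale (\<mu> ?h) v)
    = ip v (cb e (cb (star e) v)) - Re (\<mu> ?h) * ip v v"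
    by (simp add: ip_diff_right ip_self_cscale)
  also have "ip v (cb e (cb (star e) v)) = ip (cb (star e) v) (cb (star e) v)"
    using ip_cb_adjoint[of "star e" v] by simp
  finally show ?thesis .
qed

lemma lowest_vector_zero:
  assumes "triple \<alpha> e" "v \<in> root_space G \<mu>" "0 < Re (\<mu> (cb e (star e)))" "cb (star e) v = 0"
  shows "v = 0"
proof (rule ccontr)
  assume "v \<noteq> 0"
  then have "0 < Re (\<mu> (cb e (star e))) * ip v v"
    using assms(3) by (simp add: ip_pos)
  then show False
    using norm_raise[OF assms(1,2)] assms(4) ip_nonneg[of "cb e v"] by simp
qed

text \<open>Subtracting the component along \<open>e\<close> leaves a vector \<open>w\<close> orthogonal to the line of \<open>e\<close>. Its
  lowering lies in the Cartan subalgebra and is orthogonal to itself, hence zero, which is impossible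
  in positive weight unless \<open>w = 0\<close>.\<close>

lemma root_space_line:
  assumes "triple \<alpha> e" "v \<in> root_space G \<alpha>"
  obtains c where "v = cscale c e"
proof -
  have \<alpha>: "\<alpha> \<in> roots G" "e \<in> root_space G \<alpha>" "\<alpha> (cb e (star e)) = 2"
    using assms(1) by (simp_all add: triple_def)
  have pos: "0 < ip e e"
    using triple_nonzero[OF assms(1)] by (rule ip_pos)
  define c where "c = Complex (ip v e / ip e e) (ip v (cscale \<i> e) / ip e e)"
  define w where "w = v - cscale c e"
  have w: "w \<in> root_space G \<alpha>"
    unfolding w_def using assms(2) \<alpha>(2) by (intro root_space_diff root_space_cscale)
  have orth: "ip w (cscale d e) = 0" for d
  proof -
    have "cscale d e = Re d *\<^sub>R e + Im d *\<^sub>R cscale \<i> e"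
      by (simp add: cscale_def prod_eq_iff)
    then have "ip v (cscale d e) = Re d * ip v e + Im d * ip v (cscale \<i> e)"
      by (simp add: ip_simps)
    moreover have "ip (cscale c e) (cscale d e) = (Re c * Re d + Im c * Im d) * ip e e"
      by (simp add: ip_cscale_left ip_self_cscale)
    ultimately show ?thesis
      using pos by (simp add: w_def ip_diff_left) (simp add: c_def field_simps)
  qed
  have "cb (star e) w \<in> root_space G (\<lambda>x. 0)"
    using root_space_cb[OF root_space_star[OF \<alpha>(1,2)] w] by (simp add: neg_fun_def)
  then have z: "cb (star e) w \<in> cartan G"
    by (rule root_space_0_cartan)
  have "ip (cb (star e) w) (cb (star e) w) = ip w (cb e (cb (star e) w))"
    using ip_cb_adjoint[of "star e" w] by simp
  also have "cb e (cb (star e) w) = - cb (cb (star e) w) e"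
    by (rule cb_anticomm)
  also have "cb (cb (star e) w) e = cscale (\<alpha> (cb (star e) w)) e"
    using \<alpha> z by (simp add: root_spaceD)
  finally have "cb (star e) w = 0"
    by (simp add: ip_minus_right orth ip_self_eq_0_iff)
  then have "w = 0"
    using lowest_vector_zero[OF assms(1) w] \<alpha> by simp
  then have "v = cscale c e"
    by (simp add: w_def)
  then show ?thesis
    by (rule that)
qed

text \<open>Lowering a vector of weight \<open>n \<alpha>\<close> gives zero: for \<open>n > 2\<close> by induction, and for \<open>n = 2\<close>
  because it gives a multiple of \<open>e\<close> whose product with \<open>e\<close> involves \<open>[e, e]\<close>.\<close>

lemma multiple_root_space_zero:
  assumes "triple \<alpha> e" "v \<in> root_space G (\<lambda>x. of_nat (n + 2) * \<alpha> x)"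
  shows "v = 0"
  using assms(2)
proof (induction n arbitrary: v)
  case (0 v)
  have \<alpha>: "\<alpha> \<in> roots G" "e \<in> root_space G \<alpha>" "\<alpha> (cb e (star e)) = 2"
    using assms(1) by (simp_all add: triple_def)
  have "cb (star e) v \<in> root_space G \<alpha>"
    using root_space_cb[OF root_space_star[OF \<alpha>(1,2)] 0] by (simp add: neg_fun_def)
  then obtain c where c: "cb (star e) v = cscale c e"
    using assms(1) root_space_line by blast
  have "cb e e = 0"
    using br_anticomm[of "snd e" "fst e"] by (simp add: cbracket_def br_self prod_eq_iff)
  then have "ip (cb (star e) v) (cscale c e) = 0"
    using ip_cb_adjoint[of "star e" v "cscale c e"] by (simp add: cb_simps)
  then have "cb (star e) v = 0"
    using c by (simp add: ip_self_eq_0_iff)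
  then show ?case
    using lowest_vector_zero[OF assms(1) 0] \<alpha> by simp
next
  case (Suc n v)
  have \<alpha>: "\<alpha> \<in> roots G" "e \<in> root_space G \<alpha>" "\<alpha> (cb e (star e)) = 2"
    using assms(1) by (simp_all add: triple_def)
  have "(\<lambda>x. neg_fun \<alpha> x + of_nat (Suc n + 2) * \<alpha> x) = (\<lambda>x. of_nat (n + 2) * \<alpha> x)"
    by (simp add: neg_fun_def algebra_simps)
  then have "cb (star e) v \<in> root_space G (\<lambda>x. of_nat (n + 2) * \<alpha> x)"
    using root_space_cb[OF root_space_star[OF \<alpha>(1,2)] Suc.prems] by simp
  then have "cb (star e) v = 0"
    by (rule Suc.IH)
  then show ?case
    using lowest_vector_zero[OF assms(1) Suc.prems] \<alpha> by simp
qed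

lemma root_multiple:
  assumes "\<alpha> \<in> roots G" "(\<lambda>x. of_nat n * \<alpha> x) \<in> roots G"
  shows "n = 1"
proof (rule ccontr)
  assume "n \<noteq> 1"
  moreover have "n \<noteq> 0"
    using assms(2) by (auto simp: roots_def)
  ultimately obtain k where "n = k + 2"
    by (metis One_nat_def Suc_1 add_2_eq_Suc' not0_implies_Suc)
  moreover obtain e where "triple \<alpha> e"
    using assms(1) by (rule triple_exists)
  moreover obtain v where "v \<in> root_space G (\<lambda>x. of_nat n * \<alpha> x)" "v \<noteq> 0"
    using assms(2) by (rule root_vector)
  ultimately show False
    using multiple_root_space_zero by blast
qed

text \<open>Both root spaces are lines, so their brackets span a line, on which the value 2 of the root
  singles out one vector.\<close>

lemma coroot_triple:
  assumes "triple \<alpha> e"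
  shows "coroot G \<alpha> = cb e (star e)"
proof -
  let ?h = "cb e (star e)"
  let ?B = "{cb x y |x y. x \<in> root_space G \<alpha> \<and> y \<in> root_space G (neg_fun \<alpha>)}"
  have \<alpha>: "\<alpha> \<in> roots G" "e \<in> root_space G \<alpha>" "\<alpha> ?h = 2"
    using assms by (simp_all add: triple_def)
  have "?B \<subseteq> cspan {?h}"
  proof (rule subsetI)
    fix b assume "b \<in> ?B"
    then obtain x y where b: "b = cb x y" and xy: "x \<in> root_space G \<alpha>" "y \<in> root_space G (neg_fun \<alpha>)"
      by blast
    obtain c where "x = cscale c e"
      using assms xy(1) by (rule root_space_line)
    moreover obtain d where "y = cscale d (star e)"
      using triple_star[OF assms] xy(2) by (rule root_space_line)
    ultimately show "b \<in> cspan {?h}"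
      by (simp add: b cb_simps cvec.span_scale cvec.span_base)
  qed
  then have "cspan ?B \<subseteq> cspan {?h}"
    by (rule cvec.span_minimal[OF _ cvec.subspace_span])
  then have "cspan ?B \<subseteq> range (\<lambda>k. cscale k ?h)"
    by (simp only: cvec.span_singleton)
  moreover have "?h \<in> cspan ?B"
    using \<alpha>(2) root_space_star[OF \<alpha>(1,2)]
    by (intro cvec.span_base CollectI exI[of _ e] exI[of _ "star e"]) simp
  moreover have "\<alpha> (cscale k ?h) = 2 \<longleftrightarrow> k = 1" for k
    using \<alpha> bracket_star_itorus[of \<alpha> e] by (simp add: dual_cscale roots_dual itorus_cartan)
  ultimately show ?thesis
    unfolding coroot_def using \<alpha>(3) by (intro the_equality) auto
qed

lemma coroot_itorus: "\<alpha> \<in> roots G \<Longrightarrow> coroot G \<alpha> \<in> itorus"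
  by (metis triple_exists coroot_triple bracket_star_itorus triple_def)

lemma root_coroot: "\<alpha> \<in> roots G \<Longrightarrow> \<alpha> (coroot G \<alpha>) = 2"
  by (metis triple_exists coroot_triple triple_def)

lemma coroot_nonzero: "\<alpha> \<in> roots G \<Longrightarrow> coroot G \<alpha> \<noteq> 0"
  using root_coroot[of \<alpha>] dual_scaleR[of \<alpha> 0 0] cartan_zero by (auto simp: roots_dual)

text \<open>Up to scale, the coroot represents the root by the inner product. This makes a coroot
  computable from its root.\<close>

lemma ip_coroot:
  assumes "\<alpha> \<in> roots G" "z \<in> itorus"
  shows "2 * ip (coroot G \<alpha>) z = Re (\<alpha> z) * ip (coroot G \<alpha>) (coroot G \<alpha>)"
proof -
  obtain e where e: "triple \<alpha> e"
    using assms(1) by (rule triple_exists)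
  then have "ip (coroot G \<alpha>) y = Re (\<alpha> y) * ip (star e) (star e)" if "y \<in> itorus" for y
    using that ip_bracket_star[of \<alpha> e y] by (simp add: coroot_triple[OF e] triple_def)
  then show ?thesis
    using assms(2) root_coroot[OF assms(1)] coroot_itorus[OF assms(1)] by simp
qed


subsection \<open>Root strings\<close>

lemma lowering_weight:
  assumes "triple \<alpha> e" "v \<in> root_space G \<mu>"
  shows "(cb (star e) ^^ n) v \<in> root_space G (\<lambda>x. \<mu> x - of_nat n * \<alpha> x)"
proof (induction n)
  case (Suc n)
  have "cb (star e) ((cb (star e) ^^ n) v)
    \<in> root_space G (\<lambda>x. neg_fun \<alpha> x + (\<mu> x - of_nat n * \<alpha> x))"
    using root_space_cb root_space_star assms Suc by (simp add: triple_def)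
  moreover have "(\<lambda>x. neg_fun \<alpha> x + (\<mu> x - of_nat n * \<alpha> x)) = (\<lambda>x. \<mu> x - of_nat (Suc n) * \<alpha> x)"
    by (simp add: neg_fun_def algebra_simps)
  ultimately show ?case
    by simp
qed (use assms in simp)

text \<open>The weights of the successive vectors are pairwise different, and only finitely many of them
  have a nonzero root space.\<close>

lemma lowering_nilpotent:
  assumes "triple \<alpha> e" "\<mu> \<in> cartan_dual G" "v \<in> root_space G \<mu>"
  shows "\<exists>n. (cb (star e) ^^ n) v = 0"
proof -
  define \<nu> where "\<nu> n = (\<lambda>x. \<mu> x - of_nat n * \<alpha> x)" for n :: nat
  have \<alpha>: "\<alpha> \<in> roots G" "\<alpha> (cb e (star e)) = 2"
    using assms(1) by (simp_all add: triple_def)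
  have "inj \<nu>"
  proof (rule injI)
    fix m n assume "\<nu> m = \<nu> n"
    then have "\<nu> m (cb e (star e)) = \<nu> n (cb e (star e))"
      by simp
    then show "m = n"
      by (simp add: \<nu>_def \<alpha>)
  qed
  then have "infinite (range \<nu>)"
    by (simp add: finite_image_iff)
  moreover have "finite (insert (\<lambda>x. 0) (roots G))"
    using finite_roots by simp
  ultimately obtain n where n: "\<nu> n \<notin> insert (\<lambda>x. 0) (roots G)"
    by (meson finite_subset image_subsetI)
  have "\<nu> n \<in> cartan_dual G"
    unfolding \<nu>_def using assms \<alpha> by (simp add: dual_sub_multiple roots_dual)
  then have "root_space G (\<nu> n) = {0}"
    using n by (auto simp: roots_def)
  moreover have "(cb (star e) ^^ n) v \<in> root_space G (\<nu> n)"
    unfolding \<nu>_def using assms by (intro lowering_weight)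
  ultimately show ?thesis
    by auto
qed

text \<open>In a finite-dimensional module a vector killed by the raising operator has a natural number
  \<open>m\<close> as its weight, and it can be lowered \<open>m\<close> times.\<close>

lemma highest_weight_vector:
  assumes tr: "triple \<alpha> e" and \<mu>: "\<mu> \<in> cartan_dual G" and w: "w \<in> root_space G \<mu>" "w \<noteq> 0"
    and top: "cb e w = 0"
  obtains m :: nat where "\<mu> (cb e (star e)) = of_nat m" "\<And>j. j \<le> m \<Longrightarrow> (cb (star e) ^^ j) w \<noteq> 0"
proof -
  let ?h = "cb e (star e)"
  let ?w = "\<lambda>n. (cb (star e) ^^ n) w"
  have \<alpha>: "\<alpha> \<in> roots G" "\<alpha> ?h = 2" "?h \<in> cartan G"
    using tr triple_bracket_cartan by (auto simp: triple_def)
  have raise: "cb e (?w (Suc n)) = cscale (of_nat (Suc n) * (\<mu> ?h - of_nat n)) (?w n)" for n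
  proof (induction n)
    case 0
    have "cb e (cb (star e) w) = cb ?h w"
      using cb_jacobi[of e "star e" w] by (simp add: top)
    then show ?case
      using w \<alpha> by (simp add: root_spaceD)
  next
    case (Suc n)
    have "cb e (?w (Suc (Suc n))) = cb ?h (?w (Suc n)) + cb (star e) (cb e (?w (Suc n)))"
      using cb_jacobi[of e "star e" "?w (Suc n)"] by simp
    also have "cb ?h (?w (Suc n)) = cscale (\<mu> ?h - of_nat (Suc n) * 2) (?w (Suc n))"
      using root_spaceD[OF lowering_weight[OF tr w(1), of "Suc n"] \<alpha>(3)] \<alpha> by simp
    also have "cb (star e) (cb e (?w (Suc n)))
      = cscale (of_nat (Suc n) * (\<mu> ?h - of_nat n)) (?w (Suc n))"
      unfolding Suc.IH by (simp add: cb_cscale_right)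
    also have "cscale (\<mu> ?h - of_nat (Suc n) * 2) (?w (Suc n))
        + cscale (of_nat (Suc n) * (\<mu> ?h - of_nat n)) (?w (Suc n))
      = cscale (of_nat (Suc (Suc n)) * (\<mu> ?h - of_nat (Suc n))) (?w (Suc n))"
      unfolding cvec.scale_left_distrib[symmetric] by (simp add: algebra_simps)
    finally show ?case .
  qed
  define n where "n = (LEAST n. ?w n = 0)"
  have n: "?w n = 0" "\<And>j. j < n \<Longrightarrow> ?w j \<noteq> 0"
    unfolding n_def using LeastI_ex[OF lowering_nilpotent[OF tr \<mu> w(1)]] not_less_Least by auto
  then obtain m where m: "n = Suc m"
    using w(2) by (cases n) auto
  have "?w m \<noteq> 0" "cb e (?w (Suc m)) = 0"
    using n m by auto
  then have "of_nat (Suc m) * (\<mu> ?h - of_nat m) = 0"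
    unfolding raise by (simp add: cvec.scale_eq_0_iff del: of_nat_Suc)
  then have "\<mu> ?h = of_nat m"
    by (simp del: of_nat_Suc)
  then show ?thesis
    using that n(2) m by simp
qed

text \<open>From the top of the string through \<open>\<beta>\<close>, \<open>p\<close> steps above it, one can descend \<open>m + 2 p\<close> steps,
  and \<open>m + p\<close> steps lead to \<open>\<beta> - m \<alpha>\<close>. The restriction to \<open>m \<ge> 0\<close> ensures that \<open>m + p\<close> is a
  natural number; the other case is the same for \<open>-\<alpha>\<close>.\<close>

lemma root_string:
  assumes "triple \<alpha> e" "\<beta> \<in> roots G"
  obtains m :: int where "\<beta> (cb e (star e)) = of_int m"
    "0 \<le> m \<longrightarrow> (\<lambda>x. \<beta> x - of_int m * \<alpha> x) \<in> roots G"
proof -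
  let ?h = "cb e (star e)"
  have \<alpha>: "\<alpha> \<in> roots G" "\<alpha> ?h = 2" "?h \<in> cartan G"
    using assms(1) triple_bracket_cartan by (auto simp: triple_def)
  obtain v where v: "v \<in> root_space G \<beta>" "v \<noteq> 0"
    using assms(2) by (rule root_vector)
  have tr': "triple (neg_fun \<alpha>) (star e)"
    using assms(1) by (rule triple_star)
  define n where "n = (LEAST n. (cb e ^^ n) v = 0)"
  have "\<exists>n. (cb e ^^ n) v = 0"
    using lowering_nilpotent[OF tr' _ v(1)] assms(2) by (simp add: roots_dual)
  then have n: "(cb e ^^ n) v = 0" "\<And>j. j < n \<Longrightarrow> (cb e ^^ j) v \<noteq> 0"
    unfolding n_def using LeastI_ex not_less_Least by (metis (mono_tags, lifting))+
  then obtain p where p: "n = Suc p"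
    using v(2) by (cases n) auto
  define w where "w = (cb e ^^ p) v"
  define \<mu> where "\<mu> = (\<lambda>x. \<beta> x - of_nat p * neg_fun \<alpha> x)"
  have w: "w \<noteq> 0" "cb e w = 0" "w \<in> root_space G \<mu>"
    using n p lowering_weight[OF tr' v(1), of p] by (auto simp: w_def \<mu>_def)
  have \<mu>: "\<mu> \<in> cartan_dual G"
    unfolding \<mu>_def using assms(2) \<alpha> by (simp add: dual_sub_multiple dual_neg roots_dual)
  obtain q where q: "\<mu> ?h = of_nat q" "\<And>j. j \<le> q \<Longrightarrow> (cb (star e) ^^ j) w \<noteq> 0"
    using highest_weight_vector[OF assms(1) \<mu> w(3,1,2)] by blast
  define m where "m = int q - 2 * int p"
  have \<beta>h: "\<beta> ?h = of_int m"
    using q(1) \<alpha> by (simp add: \<mu>_def m_def neg_fun_def algebra_simps)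
  moreover have "(\<lambda>x. \<beta> x - of_int m * \<alpha> x) \<in> roots G" if "0 \<le> m"
  proof (cases "m = 0")
    case False
    define j where "j = nat (m + int p)"
    have j: "j \<le> q" "int j = m + int p"
      using that by (auto simp: j_def m_def)
    have "(\<lambda>x. \<mu> x - of_nat j * \<alpha> x) = (\<lambda>x. \<beta> x - of_int m * \<alpha> x)"
    proof
      fix x
      have "of_nat j = (of_int m + of_nat p :: complex)"
        using j(2) by (metis of_int_add of_int_of_nat_eq)
      then show "\<mu> x - of_nat j * \<alpha> x = \<beta> x - of_int m * \<alpha> x"
        by (simp add: \<mu>_def neg_fun_def algebra_simps)
    qed
    then have "(cb (star e) ^^ j) w \<in> root_space G (\<lambda>x. \<beta> x - of_int m * \<alpha> x)"
      using lowering_weight[OF assms(1) w(3), of j] by simp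
    then show ?thesis
      using False j q(2) assms(2) \<alpha> \<beta>h
      by (intro rootI[of _ ?h]) (auto simp: dual_sub_multiple roots_dual)
  qed (use assms(2) in simp)
  ultimately show ?thesis
    using that by blast
qed

lemma coroot_neg:
  assumes "\<alpha> \<in> roots G"
  shows "coroot G (neg_fun \<alpha>) = - coroot G \<alpha>"
proof -
  obtain e where "triple \<alpha> e"
    using assms by (rule triple_exists)
  then show ?thesis
    using coroot_triple triple_star triple_star_bracket by metis
qed

lemma root_reflection:
  assumes "\<alpha> \<in> roots G" "\<beta> \<in> roots G"
  obtains m :: int where "\<beta> (coroot G \<alpha>) = of_int m" "(\<lambda>x. \<beta> x - of_int m * \<alpha> x) \<in> roots G"
proof -
  obtain e where e: "triple \<alpha> e"
    using assms(1) by (rule triple_exists)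
  obtain m where m: "\<beta> (cb e (star e)) = of_int m"
    "0 \<le> m \<longrightarrow> (\<lambda>x. \<beta> x - of_int m * \<alpha> x) \<in> roots G"
    using e assms(2) by (rule root_string)
  obtain l where l: "\<beta> (cb (star e) (star (star e))) = of_int l"
    "0 \<le> l \<longrightarrow> (\<lambda>x. \<beta> x - of_int l * neg_fun \<alpha> x) \<in> roots G"
    using triple_star[OF e] assms(2) by (rule root_string)
  have "cb e (star e) \<in> cartan G"
    using e by (rule triple_bracket_cartan)
  then have "\<beta> (- cb e (star e)) = - \<beta> (cb e (star e))"
    using dual_scaleR[of \<beta> "cb e (star e)" "-1"] assms(2) by (simp add: roots_dual)
  then have "(of_int l :: complex) = of_int (- m)"
    using l(1) m(1) by (simp add: cb_anticomm[of "star e"])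
  then have "l = - m"
    by (simp only: of_int_eq_iff)
  then show ?thesis
    using that[of m] m l(2) coroot_triple[OF e] by (cases "0 \<le> m") (auto simp: neg_fun_def)
qed

lemma pairing_symmetric:
  assumes "\<alpha> \<in> roots G" "\<beta> \<in> roots G"
  shows "Re (\<alpha> (coroot G \<beta>)) * ip (coroot G \<alpha>) (coroot G \<alpha>)
    = Re (\<beta> (coroot G \<alpha>)) * ip (coroot G \<beta>) (coroot G \<beta>)"
  using ip_coroot[OF assms(1) coroot_itorus[OF assms(2)]]
    ip_coroot[OF assms(2) coroot_itorus[OF assms(1)]] by (simp add: ip_commute)

lemma pairing_pos:
  assumes "\<alpha> \<in> roots G" "\<beta> \<in> roots G" "0 < Re (\<alpha> (coroot G \<beta>))"
  shows "0 < Re (\<beta> (coroot G \<alpha>))"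
  using pairing_symmetric[OF assms(1,2)] ip_pos[OF coroot_nonzero[OF assms(1)]]
    ip_pos[OF coroot_nonzero[OF assms(2)]] assms(3)
  by (metis zero_less_mult_pos2 mult_pos_pos)

text \<open>Both sides represent the reflected root up to scale, and both have the value 2 under it.\<close>

lemma coroot_reflection:
  assumes "\<alpha> \<in> roots G" "\<beta> \<in> roots G" "(\<lambda>x. \<beta> x - \<beta> (coroot G \<alpha>) * \<alpha> x) \<in> roots G"
  shows "coroot G (\<lambda>x. \<beta> x - \<beta> (coroot G \<alpha>) * \<alpha> x) = coroot G \<beta> - Re (\<alpha> (coroot G \<beta>)) *\<^sub>R coroot G \<alpha>"
proof -
  let ?\<gamma> = "\<lambda>x. \<beta> x - \<beta> (coroot G \<alpha>) * \<alpha> x"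
  let ?a = "coroot G \<alpha>" and ?b = "coroot G \<beta>" and ?c = "coroot G ?\<gamma>"
  define u where "u = ?b - Re (\<alpha> ?b) *\<^sub>R ?a"
  have it: "?a \<in> itorus" "?b \<in> itorus" "?c \<in> itorus"
    using assms by (simp_all add: coroot_itorus)
  then have u: "u \<in> itorus"
    unfolding u_def by (intro subspace_diff subspace_mul subspace_itorus)
  have real: "\<alpha> ?b = of_real (Re (\<alpha> ?b))" "\<beta> ?a = of_real (Re (\<beta> ?a))"
    using root_real assms(1,2) it by (simp_all add: complex_eq_iff)
  have "\<beta> u = 2 - of_real (Re (\<alpha> ?b)) * \<beta> ?a" "\<alpha> u = \<alpha> ?b - of_real (Re (\<alpha> ?b)) * 2"
    using assms it
    by (simp_all add: u_def dual_diff dual_scaleR roots_dual itorus_cartan cartan_scaleR root_coroot)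
  then have "\<beta> u = 2 - \<alpha> ?b * \<beta> ?a" "\<alpha> u = - \<alpha> ?b"
    using real by simp_all
  then have \<gamma>u: "?\<gamma> u = 2"
    by simp
  define t where "t = ip ?b ?b / ip ?c ?c"
  have c_pos: "0 < ip ?c ?c"
    using assms(3) by (simp add: ip_pos coroot_nonzero)
  have "u = t *\<^sub>R ?c"
  proof (rule itorus_eqI)
    show "t *\<^sub>R ?c \<in> itorus"
      using it subspace_itorus by (simp add: subspace_mul)
    fix z assume z: "z \<in> itorus"
    have \<gamma>z: "Re (?\<gamma> z) = Re (\<beta> z) - Re (\<beta> ?a) * Re (\<alpha> z)"
      using root_real assms(1,2) z it by simp
    have "2 * ip u z = 2 * ip ?b z - Re (\<alpha> ?b) * (2 * ip ?a z)"
      by (simp add: u_def ip_simps)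
    also have "\<dots> = Re (\<beta> z) * ip ?b ?b - Re (\<alpha> ?b) * ip ?a ?a * Re (\<alpha> z)"
      using assms z by (simp add: ip_coroot)
    also have "\<dots> = ip ?b ?b * Re (?\<gamma> z)"
      unfolding pairing_symmetric[OF assms(1,2)] \<gamma>z by (simp add: algebra_simps)
    also have "\<dots> = t * (Re (?\<gamma> z) * ip ?c ?c)"
      using c_pos by (simp add: t_def)
    also have "\<dots> = 2 * ip (t *\<^sub>R ?c) z"
      using ip_coroot[OF assms(3) z] by (simp add: ip_simps)
    finally show "ip u z = ip (t *\<^sub>R ?c) z"
      by simp
  qed (rule u)
  moreover have "?\<gamma> (t *\<^sub>R ?c) = of_real t * 2"
    using dual_scaleR[OF roots_dual[OF assms(3)] itorus_cartan[OF it(3)]] root_coroot[OF assms(3)]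
    by simp
  ultimately have "of_real t * 2 = (2 :: complex)"
    using \<gamma>u by metis
  then have "t = 1"
    by (metis mult_cancel_right1 of_real_eq_1_iff zero_neq_numeral)
  then show ?thesis
    using \<open>u = t *\<^sub>R ?c\<close> by (simp add: u_def)
qed

end

section \<open>Words in reflections and their inversions\<close>

definition word_map :: "('i \<Rightarrow> 'a \<Rightarrow> 'a) \<Rightarrow> 'i list \<Rightarrow> 'a \<Rightarrow> 'a" where
  "word_map s u = foldr (\<lambda>i w. s i \<circ> w) u id"

definition word_length :: "('i \<Rightarrow> 'a \<Rightarrow> 'a) \<Rightarrow> 'i set \<Rightarrow> ('a \<Rightarrow> 'a) \<Rightarrow> nat" where
  "word_length s I w = (LEAST n. \<exists>u. set u \<subseteq> I \<and> length u = n \<and> word_map s u = w)"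

definition inverted :: "('a \<Rightarrow> complex) set \<Rightarrow> ('a \<Rightarrow> 'a) \<Rightarrow> ('a \<Rightarrow> complex) set" where
  "inverted P w = {\<beta> \<in> P. \<beta> \<circ> inv w \<notin> P}"

lemma word_map_Nil [simp]: "word_map s [] = id"
  and word_map_Cons [simp]: "word_map s (i # u) = s i \<circ> word_map s u"
  by (simp_all add: word_map_def)

lemma word_map_append: "word_map s (u @ v) = word_map s u \<circ> word_map s v"
  by (induction u) (simp_all add: comp_assoc)

lemma neg_fun_comp: "neg_fun \<beta> \<circ> f = neg_fun (\<beta> \<circ> f)"
  by (simp add: neg_fun_def comp_def)

text \<open>What the theory of reduced words needs of a reflection group acting on functions: each
  generator is the reflection in a positive function, makes that function negative and permutes the
  other positive functions. The map \<open>refl\<close> recovers a reflection from its function; its equivariance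
  is what turns a statement about signs of functions into one about products of generators.\<close>

locale reflection_words =
  fixes I :: "'i set" and s :: "'i \<Rightarrow> 'a \<Rightarrow> 'a" and \<Phi> P :: "('a \<Rightarrow> complex) set"
    and simple :: "'i \<Rightarrow> 'a \<Rightarrow> complex" and refl :: "('a \<Rightarrow> complex) \<Rightarrow> 'a \<Rightarrow> 'a"
  assumes involution: "i \<in> I \<Longrightarrow> s i \<circ> s i = id"
    and pos_subset: "P \<subseteq> \<Phi>"
    and sign: "\<beta> \<in> \<Phi> \<Longrightarrow> neg_fun \<beta> \<in> P \<longleftrightarrow> \<beta> \<notin> P"
    and stable: "i \<in> I \<Longrightarrow> \<beta> \<in> \<Phi> \<Longrightarrow> \<beta> \<circ> s i \<in> \<Phi>"
    and simple_pos: "i \<in> I \<Longrightarrow> simple i \<in> P"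
    and simple_reflected: "i \<in> I \<Longrightarrow> simple i \<circ> s i = neg_fun (simple i)"
    and permutes: "i \<in> I \<Longrightarrow> \<beta> \<in> P \<Longrightarrow> \<beta> \<noteq> simple i \<Longrightarrow> \<beta> \<circ> s i \<in> P"
    and refl_simple: "i \<in> I \<Longrightarrow> refl (simple i) = s i"
    and refl_conj: "i \<in> I \<Longrightarrow> \<beta> \<in> \<Phi> \<Longrightarrow> refl (\<beta> \<circ> s i) = s i \<circ> refl \<beta> \<circ> s i"
begin

lemma word_rev: "set u \<subseteq> I \<Longrightarrow> word_map s u \<circ> word_map s (rev u) = id"
proof (induction u)
  case (Cons i u)
  then have "word_map s u \<circ> word_map s (rev u) = id" "s i \<circ> s i = id"
    by (auto simp: involution fun_eq_iff)
  moreover have "word_map s (i # u) \<circ> word_map s (rev (i # u))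
    = s i \<circ> (word_map s u \<circ> word_map s (rev u)) \<circ> s i"
    by (simp add: word_map_append comp_assoc)
  ultimately show ?case
    by (simp only: comp_id)
qed simp

lemma word_rev': "set u \<subseteq> I \<Longrightarrow> word_map s (rev u) \<circ> word_map s u = id"
  using word_rev[of "rev u"] by simp

lemma inv_word: "set u \<subseteq> I \<Longrightarrow> inv (word_map s u) = word_map s (rev u)"
  by (rule inv_unique_comp) (simp_all add: word_rev word_rev')

lemma bij_word: "set u \<subseteq> I \<Longrightarrow> bij (word_map s u)"
  by (rule o_bij[of "word_map s (rev u)"]) (simp_all add: word_rev word_rev')

lemma word_stable: "set u \<subseteq> I \<Longrightarrow> \<beta> \<in> \<Phi> \<Longrightarrow> \<beta> \<circ> word_map s u \<in> \<Phi>"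
proof (induction u arbitrary: \<beta>)
  case (Cons i u)
  then have "\<beta> \<circ> s i \<circ> word_map s u \<in> \<Phi>"
    by (intro Cons.IH stable) simp_all
  then show ?case
    by (simp only: word_map_Cons comp_assoc)
qed simp

lemma simple_neg: "i \<in> I \<Longrightarrow> neg_fun (simple i) \<notin> P"
  using sign simple_pos pos_subset by blast

lemma pos_after_reflection:
  assumes "i \<in> I" "\<delta> \<in> \<Phi>"
  shows "\<delta> \<circ> s i \<in> P \<longleftrightarrow> \<delta> \<in> P \<and> \<delta> \<noteq> simple i \<or> \<delta> = neg_fun (simple i)"
proof -
  have twice: "\<gamma> \<circ> s i \<circ> s i = \<gamma>" for \<gamma> :: "'a \<Rightarrow> complex"
    using involution[OF assms(1)] by (simp add: comp_assoc)
  have "neg_fun (simple i) \<circ> s i = simple i"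
    using twice[of "simple i"] simple_reflected[OF assms(1)] by simp
  then show ?thesis
    using twice[of \<delta>] permutes[OF assms(1)] simple_pos[OF assms(1)]
      simple_reflected[OF assms(1)] simple_neg[OF assms(1)] by metis
qed

text \<open>Multiplying a word by a generator changes its inversions by a single function.\<close>

lemma
  assumes i: "i \<in> I" and u: "set u \<subseteq> I"
  shows inverted_Cons_pos: "simple i \<circ> word_map s u \<in> P \<Longrightarrow>
      inverted P (word_map s (i # u)) = insert (simple i \<circ> word_map s u) (inverted P (word_map s u))"
    and not_inverted_yet: "simple i \<circ> word_map s u \<notin> inverted P (word_map s u)"
    and inverted_Cons_neg: "simple i \<circ> word_map s u \<notin> P \<Longrightarrow>
      inverted P (word_map s (i # u)) \<subset> inverted P (word_map s u)"
proof -
  let ?w = "word_map s u" and ?v = "word_map s (rev u)"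
  let ?\<gamma> = "simple i \<circ> ?w"
  have inv: "inv ?w = ?v" "inv (s i \<circ> ?w) = ?v \<circ> s i"
    using inv_word[of u] inv_word[of "i # u"] i u by (simp_all add: word_map_append)
  have cancel: "\<beta> \<circ> ?v \<circ> ?w = \<beta>" "\<beta> \<circ> ?w \<circ> ?v = \<beta>" for \<beta> :: "'a \<Rightarrow> complex"
    using word_rev[OF u] word_rev'[OF u] by (simp_all add: comp_assoc)
  have eq_iff: "\<beta> \<circ> ?v = \<delta> \<longleftrightarrow> \<beta> = \<delta> \<circ> ?w" for \<beta> \<delta> :: "'a \<Rightarrow> complex"
  proof
    assume "\<beta> \<circ> ?v = \<delta>"
    then show "\<beta> = \<delta> \<circ> ?w"
      using cancel(1)[of \<beta>] by simp
  next
    assume "\<beta> = \<delta> \<circ> ?w"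
    then show "\<beta> \<circ> ?v = \<delta>"
      using cancel(2)[of \<delta>] by simp
  qed
  have pos: "\<beta> \<circ> inv (s i \<circ> ?w) \<in> P \<longleftrightarrow> \<beta> \<circ> ?v \<in> P \<and> \<beta> \<noteq> ?\<gamma> \<or> \<beta> = neg_fun ?\<gamma>" if "\<beta> \<in> P" for \<beta>
  proof -
    have "\<beta> \<circ> ?v \<in> \<Phi>"
      using that pos_subset word_stable[of "rev u"] u by auto
    then show ?thesis
      using pos_after_reflection[OF i, of "\<beta> \<circ> ?v"]
      unfolding inv eq_iff by (simp add: comp_assoc neg_fun_comp)
  qed
  have \<gamma>: "?\<gamma> \<circ> ?v = simple i" "neg_fun ?\<gamma> \<circ> ?v = neg_fun (simple i)"
    using cancel by (simp_all add: neg_fun_comp)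
  have \<gamma>_sign: "neg_fun ?\<gamma> \<in> P \<longleftrightarrow> ?\<gamma> \<notin> P"
    using sign word_stable[OF u] simple_pos[OF i] pos_subset by blast
  show "?\<gamma> \<notin> inverted P ?w"
    using \<gamma> simple_pos[OF i] by (simp add: inverted_def inv)
  have mem: "\<beta> \<in> inverted P (word_map s (i # u)) \<longleftrightarrow>
      \<beta> \<in> P \<and> (\<beta> \<circ> ?v \<notin> P \<or> \<beta> = ?\<gamma>) \<and> \<beta> \<noteq> neg_fun ?\<gamma>"
    "\<beta> \<in> inverted P ?w \<longleftrightarrow> \<beta> \<in> P \<and> \<beta> \<circ> ?v \<notin> P" for \<beta>
    unfolding inverted_def inv(1) word_map_Cons mem_Collect_eq using pos[of \<beta>] by argo+
  show "inverted P (word_map s (i # u)) = insert ?\<gamma> (inverted P ?w)" if "?\<gamma> \<in> P"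
  proof (rule set_eqI)
    fix \<beta>
    show "\<beta> \<in> inverted P (word_map s (i # u)) \<longleftrightarrow> \<beta> \<in> insert ?\<gamma> (inverted P ?w)"
      unfolding insert_iff mem using that \<gamma>_sign by metis
  qed
  show "inverted P (word_map s (i # u)) \<subset> inverted P ?w" if "?\<gamma> \<notin> P"
  proof (rule psubsetI)
    show "inverted P (word_map s (i # u)) \<subseteq> inverted P ?w"
    proof
      fix \<beta> assume "\<beta> \<in> inverted P (word_map s (i # u))"
      then show "\<beta> \<in> inverted P ?w"
        unfolding mem using that by metis
    qed
    have "neg_fun ?\<gamma> \<in> inverted P ?w"
      unfolding mem \<gamma> using that \<gamma>_sign simple_neg[OF i] by simp
    moreover have "neg_fun ?\<gamma> \<notin> inverted P (word_map s (i # u))"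
      unfolding mem by simp
    ultimately show "inverted P (word_map s (i # u)) \<noteq> inverted P ?w"
      by metis
  qed
qed

lemma
  assumes "set u \<subseteq> I"
  shows finite_inverted: "finite (inverted P (word_map s u))"
    and card_inverted_le: "card (inverted P (word_map s u)) \<le> length u"
proof -
  have "finite (inverted P (word_map s u)) \<and> card (inverted P (word_map s u)) \<le> length u"
    using assms
  proof (induction u)
    case Nil
    have "inverted P (word_map s []) = {}"
      by (simp add: inverted_def)
    then show ?case
      by (simp only: finite.emptyI card.empty list.size le_refl simp_thms)
  next
    case (Cons i u)
    then have i: "i \<in> I" and u: "set u \<subseteq> I"
      by simp_all
    note IH = Cons.IH[OF u]
    show ?case
    proof (cases "simple i \<circ> word_map s u \<in> P")
      case True
      then show ?thesis
        unfolding inverted_Cons_pos[OF i u True] using IH by (simp add: card_insert_if)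
    next
      case False
      then have sub: "inverted P (word_map s (i # u)) \<subset> inverted P (word_map s u)"
        by (rule inverted_Cons_neg[OF i u])
      then have "finite (inverted P (word_map s (i # u)))"
        using IH finite_subset by blast
      moreover have "card (inverted P (word_map s (i # u))) < card (inverted P (word_map s u))"
        using IH sub by (simp add: psubset_card_mono)
      ultimately have "finite (inverted P (word_map s (i # u))) \<and>
          card (inverted P (word_map s (i # u))) \<le> length (i # u)"
        using IH by simp
      then show ?thesis .
    qed
  qed
  then show "finite (inverted P (word_map s u))" "card (inverted P (word_map s u)) \<le> length u"
    by simp_all
qed

text \<open>Reading the word from the left, \<open>\<beta>\<close> is carried to a simple function just before it becomes
  negative. The reflection in \<open>\<beta>\<close> is then conjugate to the generator at that place, and multiplying
  by it deletes this letter.\<close>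

lemma exchange:
  assumes "set u \<subseteq> I" "\<beta> \<in> P" "\<beta> \<circ> word_map s u \<notin> P"
  shows "\<exists>v. set v \<subseteq> I \<and> Suc (length v) = length u \<and> refl \<beta> \<circ> word_map s u = word_map s v"
  using assms
proof (induction u arbitrary: \<beta>)
  case (Cons j u)
  then have j: "j \<in> I" and u: "set u \<subseteq> I"
    by simp_all
  show ?case
  proof (cases "\<beta> = simple j")
    case True
    have "refl \<beta> \<circ> word_map s (j # u) = s j \<circ> s j \<circ> word_map s u"
      using True j by (simp add: refl_simple comp_assoc)
    then have "refl \<beta> \<circ> word_map s (j # u) = word_map s u"
      using involution[OF j] by simp
    then show ?thesis
      by (intro exI[of _ u] conjI u) (simp, assumption)
  next
    case False
    then have "\<beta> \<circ> s j \<in> P"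
      using permutes[OF j] Cons.prems(2) by blast
    moreover have "\<beta> \<circ> word_map s (j # u) \<notin> P"
      by (rule Cons.prems(3))
    then have "\<beta> \<circ> s j \<circ> word_map s u \<notin> P"
      by (simp add: comp_assoc)
    ultimately obtain v where v: "set v \<subseteq> I" "Suc (length v) = length u"
      "refl (\<beta> \<circ> s j) \<circ> word_map s u = word_map s v"
      using Cons.IH[OF u] by blast
    have "refl \<beta> \<circ> word_map s (j # u) = s j \<circ> s j \<circ> refl \<beta> \<circ> s j \<circ> word_map s u"
      using involution[OF j] by (simp add: comp_assoc)
    also have "\<dots> = s j \<circ> (refl (\<beta> \<circ> s j) \<circ> word_map s u)"
      using refl_conj[OF j, of \<beta>] Cons.prems(2) pos_subset by (simp add: comp_assoc subset_iff)
    also have "\<dots> = s j \<circ> word_map s v"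
      by (simp only: v(3))
    finally have "refl \<beta> \<circ> word_map s (j # u) = word_map s (j # v)"
      by simp
    moreover have "set (j # v) \<subseteq> I" "Suc (length (j # v)) = length (j # u)"
      using v(1,2) j by simp_all
    ultimately show ?thesis
      by (intro exI[of _ "j # v"] conjI)
  qed
qed simp

text \<open>Adding a letter to a word with as many inversions as letters either adds an inversion or,
  by the exchange property, cancels a letter.\<close>

lemma shorten:
  assumes "set u \<subseteq> I" "card (inverted P (word_map s u)) < length u"
  shows "\<exists>v. set v \<subseteq> I \<and> length v < length u \<and> word_map s v = word_map s u"
  using assms
proof (induction u)
  case (Cons i u)
  then have i: "i \<in> I" and u: "set u \<subseteq> I"
    by simp_all
  show ?case
  proof (cases "card (inverted P (word_map s u)) < length u")
    case True
    then obtain v where "set v \<subseteq> I" "length v < length u" "word_map s v = word_map s u"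
      using Cons.IH[OF u] by blast
    then show ?thesis
      using i by (intro exI[of _ "i # v"]) simp
  next
    case False
    have "card (inverted P (word_map s (i # u))) < length (i # u)"
      by (rule Cons.prems(2))
    then have "simple i \<circ> word_map s u \<notin> P"
      using False inverted_Cons_pos[OF i u] not_inverted_yet[OF i u]
        finite_inverted[OF u] by auto
    then obtain v where "set v \<subseteq> I" "Suc (length v) = length u"
      "refl (simple i) \<circ> word_map s u = word_map s v"
      using exchange[OF u simple_pos[OF i]] by blast
    then show ?thesis
      using i by (intro exI[of _ v]) (simp add: refl_simple)
  qed
qed simp

theorem word_length_eq_card_inverted:
  assumes "set u \<subseteq> I"
  shows "word_length s I (word_map s u) = card (inverted P (word_map s u))"
proof -
  let ?Q = "\<lambda>n. \<exists>v. set v \<subseteq> I \<and> length v = n \<and> word_map s v = word_map s u"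
  have "?Q (length u)"
    using assms by blast
  then have "?Q (word_length s I (word_map s u))"
    unfolding word_length_def by (rule LeastI)
  then obtain v where v: "set v \<subseteq> I" "length v = word_length s I (word_map s u)"
    "word_map s v = word_map s u"
    by blast
  have "\<not> card (inverted P (word_map s v)) < length v"
  proof
    assume "card (inverted P (word_map s v)) < length v"
    then obtain v' where "set v' \<subseteq> I" "length v' < length v" "word_map s v' = word_map s v"
      using shorten[OF v(1)] by blast
    moreover from this have "word_length s I (word_map s u) \<le> length v'"
      unfolding word_length_def using v(3) by (intro Least_le) auto
    ultimately show False
      using v(2) by simp
  qed
  then show ?thesis
    using card_inverted_le[OF v(1)] v by simp
qed

definition reduced :: "'i list \<Rightarrow> bool" where
  "reduced u \<longleftrightarrow> set u \<subseteq> I \<and> card (inverted P (word_map s u)) = length u"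

lemma reduced_letters: "reduced u \<Longrightarrow> set u \<subseteq> I"
  and reduced_card: "reduced u \<Longrightarrow> card (inverted P (word_map s u)) = length u"
  by (simp_all add: reduced_def)

lemma reduced_iff: "reduced u \<longleftrightarrow> set u \<subseteq> I \<and> length u = word_length s I (word_map s u)"
  using word_length_eq_card_inverted[of u] by (auto simp: reduced_def)

lemma reduced_word_exists:
  assumes "set u \<subseteq> I"
  obtains v where "reduced v" "word_map s v = word_map s u"
proof -
  let ?Q = "\<lambda>n. \<exists>v. set v \<subseteq> I \<and> length v = n \<and> word_map s v = word_map s u"
  have "?Q (word_length s I (word_map s u))"
    unfolding word_length_def by (rule LeastI[of ?Q "length u"]) (use assms in blast)
  then show ?thesis
    using that by (auto simp: reduced_iff)
qed

lemma
  assumes "reduced (i # u)"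
  shows reduced_tl: "reduced u"
    and inverted_reduced_Cons: "inverted P (word_map s (i # u))
      = insert (simple i \<circ> word_map s u) (inverted P (word_map s u))"
proof -
  have i: "i \<in> I" and u: "set u \<subseteq> I" and
    card: "card (inverted P (word_map s (i # u))) = Suc (length u)"
    using assms by (simp_all add: reduced_def)
  have pos: "simple i \<circ> word_map s u \<in> P"
  proof (rule ccontr)
    assume "simple i \<circ> word_map s u \<notin> P"
    then have "card (inverted P (word_map s (i # u))) < card (inverted P (word_map s u))"
      using inverted_Cons_neg[OF i u] finite_inverted[OF u] by (simp add: psubset_card_mono)
    then show False
      using card card_inverted_le[OF u] by simp
  qed
  show eq: "inverted P (word_map s (i # u))
      = insert (simple i \<circ> word_map s u) (inverted P (word_map s u))"
    using pos by (rule inverted_Cons_pos[OF i u])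
  then show "reduced u"
    using card u finite_inverted[OF u] not_inverted_yet[OF i u] by (simp add: reduced_def)
qed

lemma reduced_Cons:
  assumes "i \<in> I" "reduced u" "simple i \<circ> word_map s u \<in> P"
  shows "reduced (i # u)"
  using assms inverted_Cons_pos[of i u] not_inverted_yet[of i u] finite_inverted[of u]
  by (simp add: reduced_def)

lemma reduced_append_right: "reduced (v @ u) \<Longrightarrow> reduced u"
  by (induction v) (auto intro: reduced_tl)

lemma inverted_append_mono:
  "reduced (v @ u) \<Longrightarrow> inverted P (word_map s u) \<subseteq> inverted P (word_map s (v @ u))"
proof (induction v)
  case (Cons i v)
  have red: "reduced (i # (v @ u))"
    using Cons.prems by simp
  have "inverted P (word_map s u) \<subseteq> inverted P (word_map s (v @ u))"
    by (rule Cons.IH[OF reduced_tl[OF red]])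
  also have "\<dots> \<subseteq> inverted P (word_map s (i # v @ u))"
    unfolding inverted_reduced_Cons[OF red] by (rule subset_insertI)
  finally show ?case
    by (simp only: append_Cons)
qed simp

end

section \<open>Root data with a highest root\<close>

text \<open>The roots are complex functions that extend beyond \<^term>\<open>cartan_real G\<close>; only their values
  there matter, and they are determined by these values.\<close>

locale root_datum =
  fixes G :: "('k::real_vector) lie_data"
  assumes finite_roots: "finite (roots G)"
    and simple_system: "is_simple_system G"
    and highest: "is_highest_root G (highest_root G)"
    and root_add: "\<alpha> \<in> roots G \<Longrightarrow> x \<in> cartan_real G \<Longrightarrow> y \<in> cartan_real G \<Longrightarrow> \<alpha> (x + y) = \<alpha> x + \<alpha> y"
    and root_scaleR: "\<alpha> \<in> roots G \<Longrightarrow> x \<in> cartan_real G \<Longrightarrow> \<alpha> (a *\<^sub>R x) = of_real a * \<alpha> x"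
    and root_real: "\<alpha> \<in> roots G \<Longrightarrow> x \<in> cartan_real G \<Longrightarrow> Im (\<alpha> x) = 0"
    and root_eqI: "\<alpha> \<in> roots G \<Longrightarrow> \<beta> \<in> roots G \<Longrightarrow> (\<And>x. x \<in> cartan_real G \<Longrightarrow> \<alpha> x = \<beta> x) \<Longrightarrow> \<alpha> = \<beta>"
    and root_multiple: "\<alpha> \<in> roots G \<Longrightarrow> (\<lambda>x. of_nat n * \<alpha> x) \<in> roots G \<Longrightarrow> n = 1"
    and coroot_cartan: "\<alpha> \<in> roots G \<Longrightarrow> coroot G \<alpha> \<in> cartan_real G"
    and root_coroot: "\<alpha> \<in> roots G \<Longrightarrow> \<alpha> (coroot G \<alpha>) = 2"
    and pairing_int: "\<alpha> \<in> roots G \<Longrightarrow> \<beta> \<in> roots G \<Longrightarrow> \<beta> (coroot G \<alpha>) \<in> \<int>"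
    and reflected_root: "\<alpha> \<in> roots G \<Longrightarrow> \<beta> \<in> roots G \<Longrightarrow> (\<lambda>x. \<beta> x - \<beta> (coroot G \<alpha>) * \<alpha> x) \<in> roots G"
    and reflected_coroot: "\<alpha> \<in> roots G \<Longrightarrow> \<beta> \<in> roots G \<Longrightarrow>
      coroot G (\<lambda>x. \<beta> x - \<beta> (coroot G \<alpha>) * \<alpha> x) = coroot G \<beta> - Re (\<alpha> (coroot G \<beta>)) *\<^sub>R coroot G \<alpha>"
    and pairing_pos: "\<alpha> \<in> roots G \<Longrightarrow> \<beta> \<in> roots G \<Longrightarrow> 0 < Re (\<alpha> (coroot G \<beta>)) \<Longrightarrow> 0 < Re (\<beta> (coroot G \<alpha>))"
begin

abbreviation V where "V \<equiv> cartan_real G"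
abbreviation co where "co \<equiv> coroot G"
abbreviation R where "R \<equiv> roots G"
abbreviation Pos where "Pos \<equiv> positive_roots G"

definition pairing :: "('k cplx \<Rightarrow> complex) \<Rightarrow> ('k cplx \<Rightarrow> complex) \<Rightarrow> int" where
  "pairing \<beta> \<alpha> = \<lfloor>Re (\<beta> (co \<alpha>))\<rfloor>"

definition reflect :: "('k cplx \<Rightarrow> complex) \<Rightarrow> ('k cplx \<Rightarrow> complex) \<Rightarrow> 'k cplx \<Rightarrow> complex" where
  "reflect \<alpha> \<beta> = (\<lambda>x. \<beta> x - of_int (pairing \<beta> \<alpha>) * \<alpha> x)"

lemma subspace_V: "subspace V"
  by (simp add: cartan_real_def)

lemma V_add: "x \<in> V \<Longrightarrow> y \<in> V \<Longrightarrow> x + y \<in> V"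
  and V_scaleR: "x \<in> V \<Longrightarrow> a *\<^sub>R x \<in> V"
  and V_diff: "x \<in> V \<Longrightarrow> y \<in> V \<Longrightarrow> x - y \<in> V"
  and V_uminus: "x \<in> V \<Longrightarrow> - x \<in> V"
  and V_zero: "0 \<in> V"
  using subspace_V by (simp_all add: subspace_add subspace_mul subspace_diff subspace_neg subspace_0)

lemma pairing_eq: "\<alpha> \<in> R \<Longrightarrow> \<beta> \<in> R \<Longrightarrow> \<beta> (co \<alpha>) = of_int (pairing \<beta> \<alpha>)"
  using pairing_int[of \<alpha> \<beta>] by (auto simp: pairing_def elim: Ints_cases)

lemma pairing_Re: "\<alpha> \<in> R \<Longrightarrow> \<beta> \<in> R \<Longrightarrow> Re (\<beta> (co \<alpha>)) = of_int (pairing \<beta> \<alpha>)"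
  by (simp add: pairing_eq)

lemma pairing_self: "\<alpha> \<in> R \<Longrightarrow> pairing \<alpha> \<alpha> = 2"
  by (simp add: pairing_def root_coroot)

lemma pairing_sym_pos: "\<alpha> \<in> R \<Longrightarrow> \<beta> \<in> R \<Longrightarrow> 0 < pairing \<alpha> \<beta> \<Longrightarrow> 0 < pairing \<beta> \<alpha>"
  using pairing_pos[of \<alpha> \<beta>] pairing_Re[of \<alpha> \<beta>] pairing_Re[of \<beta> \<alpha>] by simp

lemma reflect_root: "\<alpha> \<in> R \<Longrightarrow> \<beta> \<in> R \<Longrightarrow> reflect \<alpha> \<beta> \<in> R"
  using reflected_root[of \<alpha> \<beta>] by (simp add: reflect_def pairing_eq)

lemma coroot_reflect:
  "\<alpha> \<in> R \<Longrightarrow> \<beta> \<in> R \<Longrightarrow> co (reflect \<alpha> \<beta>) = co \<beta> - of_int (pairing \<alpha> \<beta>) *\<^sub>R co \<alpha>"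
  using reflected_coroot[of \<alpha> \<beta>] by (simp add: reflect_def pairing_eq)

lemma reflect_self: "\<alpha> \<in> R \<Longrightarrow> reflect \<alpha> \<alpha> = neg_fun \<alpha>"
  by (simp add: reflect_def pairing_self neg_fun_def)

lemma neg_root: "\<alpha> \<in> R \<Longrightarrow> neg_fun \<alpha> \<in> R"
  using reflect_root[of \<alpha> \<alpha>] by (simp add: reflect_self)

lemma coroot_neg: "\<alpha> \<in> R \<Longrightarrow> co (neg_fun \<alpha>) = - co \<alpha>"
  using coroot_reflect[of \<alpha> \<alpha>] by (simp add: reflect_self pairing_self scaleR_2)

lemma root_minus: "\<alpha> \<in> R \<Longrightarrow> x \<in> V \<Longrightarrow> \<alpha> (- x) = - \<alpha> x"
  using root_scaleR[of \<alpha> x "-1"] by simp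

lemma root_diff: "\<alpha> \<in> R \<Longrightarrow> x \<in> V \<Longrightarrow> y \<in> V \<Longrightarrow> \<alpha> (x - y) = \<alpha> x - \<alpha> y"
  using root_add[of \<alpha> x "- y"] by (simp add: root_minus V_uminus)

lemma root_0: "\<alpha> \<in> R \<Longrightarrow> \<alpha> 0 = 0"
  using root_scaleR[of \<alpha> 0 0] V_zero by simp

lemma root_sum: "\<alpha> \<in> R \<Longrightarrow> (\<And>i. i \<in> A \<Longrightarrow> f i \<in> V) \<Longrightarrow> \<alpha> (sum f A) = (\<Sum>i\<in>A. \<alpha> (f i))"
proof (induction A rule: infinite_finite_induct)
  case (insert i A)
  then show ?case
    using subspace_sum[OF subspace_V, of A f] by (simp add: root_add)
qed (simp_all add: root_0)

lemma root_of_real: "\<alpha> \<in> R \<Longrightarrow> x \<in> V \<Longrightarrow> of_real (Re (\<alpha> x)) = \<alpha> x"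
  using root_real[of \<alpha> x] by (simp add: complex_eq_iff)

lemma pairing_reflect:
  assumes "\<alpha> \<in> R" "\<beta> \<in> R"
  shows "pairing (reflect \<alpha> \<beta>) \<alpha> = - pairing \<beta> \<alpha>"
proof -
  have "reflect \<alpha> \<beta> (co \<alpha>) = of_int (- pairing \<beta> \<alpha>)"
    using assms by (simp add: reflect_def pairing_eq pairing_self)
  then show ?thesis
    by (simp add: pairing_def)
qed

lemma reflect_reflect: "\<alpha> \<in> R \<Longrightarrow> \<beta> \<in> R \<Longrightarrow> reflect \<alpha> (reflect \<alpha> \<beta>) = \<beta>"
  by (subst reflect_def) (simp add: pairing_reflect, simp add: reflect_def)

lemma pairing_reflect_left:
  assumes "\<alpha> \<in> R" "\<beta> \<in> R"
  shows "pairing \<alpha> (reflect \<alpha> \<beta>) = - pairing \<alpha> \<beta>"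
proof -
  have "\<alpha> (co (reflect \<alpha> \<beta>)) = of_int (- pairing \<alpha> \<beta>)"
    using assms by (simp add: coroot_reflect root_diff root_scaleR V_scaleR coroot_cartan pairing_eq pairing_self)
  then show ?thesis
    by (simp add: pairing_def)
qed


subsection \<open>Positive and simple roots\<close>

abbreviation \<theta> where "\<theta> \<equiv> highest_root G"
abbreviation S where "S \<equiv> nonneg_combs G"

lemma simple_root: "i \<in> {1..rk G} \<Longrightarrow> simple_root G i \<in> R"
  and simple_independent: "simple_comb G c = (\<lambda>x. 0) \<Longrightarrow> i \<in> {1..rk G} \<Longrightarrow> c i = 0"
  and root_signed: "\<alpha> \<in> R \<Longrightarrow> \<alpha> \<in> S \<or> neg_fun \<alpha> \<in> S"
  using simple_system by (simp_all add: is_simple_system_def)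

lemma highest_root: "\<theta> \<in> R"
  and highest_diff: "\<beta> \<in> R \<Longrightarrow> (\<lambda>x. \<theta> x - \<beta> x) \<in> S"
  using highest by (simp_all add: is_highest_root_def)

lemma root_nonzero: "\<alpha> \<in> R \<Longrightarrow> \<alpha> \<noteq> (\<lambda>x. 0)"
  by (simp add: roots_def)

lemma combE:
  assumes "f \<in> S"
  obtains n :: "nat \<Rightarrow> nat" where "f = simple_comb G (\<lambda>i. of_nat (n i))"
  using assms by (auto simp: nonneg_combs_def)

lemma comb_add: "f \<in> S \<Longrightarrow> g \<in> S \<Longrightarrow> (\<lambda>x. f x + g x) \<in> S"
proof -
  assume "f \<in> S" "g \<in> S"
  then obtain m n :: "nat \<Rightarrow> nat" where "f = simple_comb G (\<lambda>i. of_nat (m i))" "g = simple_comb G (\<lambda>i. of_nat (n i))"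
    by (metis combE)
  then have "(\<lambda>x. f x + g x) = simple_comb G (\<lambda>i. of_nat (m i + n i))"
    by (simp add: simple_comb_def sum.distrib ring_distribs)
  then show ?thesis
    unfolding nonneg_combs_def by (intro CollectI exI[of _ "\<lambda>i. m i + n i"]) simp
qed

lemma comb_antisym:
  assumes "f \<in> S" "neg_fun f \<in> S"
  shows "f = (\<lambda>x. 0)"
proof -
  obtain m n :: "nat \<Rightarrow> nat" where mn: "f = simple_comb G (\<lambda>i. of_nat (m i))"
    "neg_fun f = simple_comb G (\<lambda>i. of_nat (n i))"
    using assms by (metis combE)
  have "f x + neg_fun f x = simple_comb G (\<lambda>i. of_nat (m i + n i)) x" for x
    by (subst mn(1), subst mn(2)) (simp add: simple_comb_def sum.distrib ring_distribs)
  then have "simple_comb G (\<lambda>i. of_nat (m i + n i)) = (\<lambda>x. 0)"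
    by (simp add: neg_fun_def fun_eq_iff)
  then have "m i + n i = 0" if "i \<in> {1..rk G}" for i
    using simple_independent[OF _ that, of "\<lambda>i. of_nat (m i + n i)"] by (simp only: of_nat_eq_0_iff)
  then show ?thesis
    unfolding mn(1) simple_comb_def by (simp add: fun_eq_iff)
qed

lemma Pos_iff: "\<alpha> \<in> Pos \<longleftrightarrow> \<alpha> \<in> R \<and> \<alpha> \<in> S"
  by (simp add: positive_roots_def)

lemma neg_Pos_iff: "\<alpha> \<in> R \<Longrightarrow> neg_fun \<alpha> \<in> Pos \<longleftrightarrow> \<alpha> \<notin> Pos"
  using root_signed[of \<alpha>] comb_antisym[of \<alpha>] root_nonzero[of \<alpha>] neg_root[of \<alpha>] by (auto simp: Pos_iff)

lemma simple_Pos: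
  assumes "i \<in> {1..rk G}"
  shows "simple_root G i \<in> Pos"
proof -
  have "simple_root G i = simple_comb G (\<lambda>j. of_nat (if j = i then 1 else 0))"
    using assms by (simp add: simple_comb_def if_distrib[of "\<lambda>c. c * _"] if_distrib[of of_nat] sum.delta cong: if_cong)
  then have "simple_root G i \<in> S"
    unfolding nonneg_combs_def by (intro CollectI exI[of _ "\<lambda>j. if j = i then 1 else 0"]) simp
  then show ?thesis
    using assms simple_root by (simp add: Pos_iff)
qed

lemma highest_Pos: "\<theta> \<in> Pos"
proof (rule ccontr)
  assume "\<theta> \<notin> Pos"
  then have neg: "neg_fun \<theta> \<in> S"
    using highest_root neg_Pos_iff Pos_iff by blast
  have "(\<lambda>x. \<theta> x - neg_fun \<theta> x) \<in> S"
    by (rule highest_diff[OF neg_root[OF highest_root]])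
  then have "(\<lambda>x. (\<theta> x - neg_fun \<theta> x) + neg_fun \<theta> x) \<in> S"
    using neg by (rule comb_add)
  then have "\<theta> \<in> S"
    by simp
  then show False
    using \<open>\<theta> \<notin> Pos\<close> highest_root by (simp add: Pos_iff)
qed

text \<open>Reducedness enters here: a positive root other than \<open>\<alpha>\<^sub>j\<close> has a positive coefficient at another
  simple root, which the reflection does not change.\<close>

lemma simple_reflect_Pos:
  assumes j: "j \<in> {1..rk G}" and \<alpha>: "\<alpha> \<in> Pos" "\<alpha> \<noteq> simple_root G j"
  shows "reflect (simple_root G j) \<alpha> \<in> Pos"
proof (rule ccontr)
  let ?\<gamma> = "reflect (simple_root G j) \<alpha>"
  assume "?\<gamma> \<notin> Pos"
  moreover have "?\<gamma> \<in> R"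
    using \<alpha> j simple_root by (simp add: reflect_root Pos_iff)
  ultimately have "neg_fun ?\<gamma> \<in> S"
    using neg_Pos_iff Pos_iff by blast
  then obtain n where n: "neg_fun ?\<gamma> = simple_comb G (\<lambda>i. of_nat (n i))"
    by (rule combE)
  obtain m where m: "\<alpha> = simple_comb G (\<lambda>i. of_nat (m i))"
    using \<alpha> Pos_iff by (metis combE)
  define p where "p = pairing \<alpha> (simple_root G j)"
  let ?c = "\<lambda>i. of_nat (m i + n i) - (if i = j then of_int p else 0) :: complex"
  have "simple_comb G ?c x = \<alpha> x + neg_fun ?\<gamma> x - of_int p * simple_root G j x" for x
  proof -
    have "simple_comb G ?c x = simple_comb G (\<lambda>i. of_nat (m i)) x + simple_comb G (\<lambda>i. of_nat (n i)) x
      - (\<Sum>i = 1..rk G. (if i = j then of_int p * simple_root G i x else 0))"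
      unfolding simple_comb_def sum.distrib[symmetric] sum_subtractf[symmetric]
      by (rule sum.cong) (auto simp: algebra_simps)
    also have "(\<Sum>i = 1..rk G. (if i = j then of_int p * simple_root G i x else 0)) = of_int p * simple_root G j x"
      using j by (simp add: sum.delta)
    finally show ?thesis
      using m n by metis
  qed
  then have "simple_comb G ?c = (\<lambda>x. 0)"
    by (simp add: fun_eq_iff reflect_def neg_fun_def p_def)
  then have "?c i = 0" if "i \<in> {1..rk G}" for i
    using simple_independent that by blast
  then have zero: "m i = 0" if "i \<in> {1..rk G}" "i \<noteq> j" for i
    using that by (metis add_is_0 diff_zero of_nat_eq_0_iff)
  have "\<alpha> x = of_nat (m j) * simple_root G j x" for x
  proof -
    have "\<alpha> x = (\<Sum>i\<in>{1..rk G}. of_nat (m i) * simple_root G i x)"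
      by (subst m) (simp add: simple_comb_def)
    also have "\<dots> = (\<Sum>i\<in>{1..rk G}. if i = j then of_nat (m i) * simple_root G i x else 0)"
      using zero by (intro sum.cong) auto
    finally show ?thesis
      using j by (simp add: sum.delta)
  qed
  then have "\<alpha> = (\<lambda>x. of_nat (m j) * simple_root G j x)"
    by (rule ext)
  moreover from this have "m j = 1"
    using root_multiple[OF simple_root[OF j], of "m j"] \<alpha> by (simp add: Pos_iff)
  ultimately show False
    using \<alpha> by simp
qed

text \<open>The sum of the positive roots of the dual root system. All simple roots have the value 2 at it, so
  that it measures heights of roots and lies in the chamber.\<close>

definition height_point :: "'k cplx" where
  "height_point = (\<Sum>\<alpha>\<in>Pos. co \<alpha>)"

lemma finite_Pos: "finite Pos"
  using finite_roots by (simp add: positive_roots_def)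

lemma height_point_V: "height_point \<in> V"
  unfolding height_point_def
  by (intro subspace_sum subspace_V) (simp add: coroot_cartan Pos_iff)

text \<open>The simple reflection permutes the positive roots other than \<open>\<alpha>\<^sub>j\<close> and changes the sign of the
  value of \<open>\<alpha>\<^sub>j\<close> at their coroots, so these values add up to 0 and the coroot of \<open>\<alpha>\<^sub>j\<close> itself
  contributes 2.\<close>

lemma simple_height:
  assumes j: "j \<in> {1..rk G}"
  shows "simple_root G j height_point = 2"
proof -
  let ?a = "simple_root G j"
  let ?D = "Pos - {?a}"
  have a: "?a \<in> R"
    using j by (rule simple_root)
  have refl_D: "reflect ?a \<alpha> \<in> ?D" if "\<alpha> \<in> ?D" for \<alpha>
  proof -
    have "reflect ?a \<alpha> \<noteq> ?a"
    proof
      assume "reflect ?a \<alpha> = ?a"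
      then have "\<alpha> = neg_fun ?a"
        using reflect_reflect[OF a, of \<alpha>] that by (simp add: reflect_self a Pos_iff)
      then show False
        using that neg_Pos_iff[OF a] simple_Pos[OF j] by blast
    qed
    then show ?thesis
      using that simple_reflect_Pos[OF j] by blast
  qed
  have "(\<Sum>\<alpha>\<in>?D. pairing ?a \<alpha>) = (\<Sum>\<alpha>\<in>?D. pairing ?a (reflect ?a \<alpha>))"
    using refl_D reflect_reflect[OF a]
    by (intro sum.reindex_bij_witness[of _ "reflect ?a" "reflect ?a"]) (auto simp: Pos_iff)
  also have "\<dots> = - (\<Sum>\<alpha>\<in>?D. pairing ?a \<alpha>)"
    unfolding sum_negf[symmetric] using pairing_reflect_left[OF a] by (intro sum.cong) (auto simp: Pos_iff)
  finally have zero: "(\<Sum>\<alpha>\<in>?D. pairing ?a \<alpha>) = 0"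
    by simp
  have "?a height_point = (\<Sum>\<alpha>\<in>Pos. ?a (co \<alpha>))"
    unfolding height_point_def using a by (intro root_sum) (simp_all add: Pos_iff coroot_cartan)
  also have "\<dots> = ?a (co ?a) + (\<Sum>\<alpha>\<in>?D. ?a (co \<alpha>))"
    using finite_Pos simple_Pos[OF j] by (rule sum.remove)
  also have "(\<Sum>\<alpha>\<in>?D. ?a (co \<alpha>)) = of_int (\<Sum>\<alpha>\<in>?D. pairing ?a \<alpha>)"
    unfolding of_int_sum using a by (intro sum.cong) (auto simp: Pos_iff pairing_eq)
  finally show ?thesis
    using zero a by (simp add: root_coroot)
qed

text \<open>Twice the usual height, as an integer without reference to coefficients.\<close>

definition height :: "('k cplx \<Rightarrow> complex) \<Rightarrow> int" where
  "height \<alpha> = (\<Sum>\<beta>\<in>Pos. pairing \<alpha> \<beta>)"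

lemma height_eq: "\<alpha> \<in> R \<Longrightarrow> of_int (height \<alpha>) = \<alpha> height_point"
  unfolding height_def height_point_def
  by (subst root_sum) (auto simp: Pos_iff coroot_cartan pairing_eq)

lemma height_simple: "j \<in> {1..rk G} \<Longrightarrow> height (simple_root G j) = 2"
  using height_eq[OF simple_root, of j] simple_height[of j] by (metis of_int_eq_iff of_int_numeral)

lemma height_neg:
  assumes "\<alpha> \<in> R"
  shows "height (neg_fun \<alpha>) = - height \<alpha>"
proof -
  have "(of_int (height (neg_fun \<alpha>)) :: complex) = of_int (- height \<alpha>)"
    using height_eq[OF assms] height_eq[OF neg_root[OF assms]] by (simp add: neg_fun_def)
  then show ?thesis
    by (simp only: of_int_eq_iff)
qed

lemma height_reflect:
  assumes "\<alpha> \<in> R" "\<beta> \<in> R"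
  shows "height (reflect \<alpha> \<beta>) = height \<beta> - pairing \<beta> \<alpha> * height \<alpha>"
proof -
  have "(of_int (height (reflect \<alpha> \<beta>)) :: complex) = of_int (height \<beta> - pairing \<beta> \<alpha> * height \<alpha>)"
    using height_eq[OF assms(1)] height_eq[OF assms(2)] height_eq[OF reflect_root[OF assms]]
    by (simp add: reflect_def)
  then show ?thesis
    by (simp only: of_int_eq_iff)
qed

lemma comb_height:
  assumes "f \<in> S"
  obtains N :: nat where "f height_point = of_nat N" "N = 0 \<Longrightarrow> f = (\<lambda>x. 0)"
proof -
  obtain n where n: "f = simple_comb G (\<lambda>i. of_nat (n i))"
    using assms by (rule combE)
  have "f height_point = (\<Sum>i=1..rk G. of_nat (n i) * simple_root G i height_point)"
    by (subst n) (simp add: simple_comb_def)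
  also have "\<dots> = (\<Sum>i=1..rk G. of_nat (n i) * 2)"
    by (intro sum.cong) (simp_all add: simple_height)
  also have "\<dots> = of_nat (\<Sum>i=1..rk G. n i * 2)"
    by simp
  finally have "f height_point = of_nat (\<Sum>i=1..rk G. n i * 2)" .
  moreover have "f = (\<lambda>x. 0)" if "(\<Sum>i=1..rk G. n i * 2) = 0"
    using that by (subst n) (simp add: simple_comb_def fun_eq_iff)
  ultimately show ?thesis
    by (rule that)
qed

lemma Pos_height:
  assumes "\<alpha> \<in> Pos"
  shows "0 < height \<alpha>"
proof -
  have \<alpha>: "\<alpha> \<in> R" "\<alpha> \<in> S"
    using assms by (simp_all add: Pos_iff)
  obtain N :: nat where N: "\<alpha> height_point = of_nat N" "N = 0 \<Longrightarrow> \<alpha> = (\<lambda>x. 0)"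
    using comb_height[OF \<alpha>(2)] by metis
  have "(of_int (height \<alpha>) :: complex) = of_int (int N)"
    using height_eq[OF \<alpha>(1)] N(1) by simp
  then show ?thesis
    using N(2) root_nonzero[OF \<alpha>(1)] by (simp only: of_int_eq_iff) auto
qed

text \<open>The difference to the highest root is a nonnegative combination of simple roots.\<close>

lemma height_le_highest:
  assumes "\<beta> \<in> R"
  shows "height \<beta> \<le> height \<theta>" and "height \<beta> = height \<theta> \<Longrightarrow> \<beta> = \<theta>"
proof -
  obtain N :: nat where N: "\<theta> height_point - \<beta> height_point = of_nat N"
    "N = 0 \<Longrightarrow> (\<lambda>x. \<theta> x - \<beta> x) = (\<lambda>x. 0)"
    using comb_height[OF highest_diff[OF assms]] by metis
  have "(of_int (height \<theta> - height \<beta>) :: complex) = of_int (int N)"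
    using height_eq[OF highest_root] height_eq[OF assms] N(1) by simp
  then have eq: "height \<theta> - height \<beta> = int N"
    by (simp only: of_int_eq_iff)
  then show "height \<beta> \<le> height \<theta>"
    by simp
  show "\<beta> = \<theta>" if "height \<beta> = height \<theta>"
    using that eq N(2) by (simp add: fun_eq_iff)
qed

lemma Pos_iff_height: "\<alpha> \<in> R \<Longrightarrow> \<alpha> \<in> Pos \<longleftrightarrow> 0 < height \<alpha>"
  using Pos_height[of \<alpha>] Pos_height[of "neg_fun \<alpha>"] neg_Pos_iff[of \<alpha>] height_neg[of \<alpha>] by fastforce

end

section \<open>Affine reflections\<close>

context root_datum
begin

definition affine_reflection :: "int \<Rightarrow> ('k cplx \<Rightarrow> complex) \<Rightarrow> 'k cplx \<Rightarrow> 'k cplx" where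
  "affine_reflection k \<alpha> = (\<lambda>x. if x \<in> V then x - (of_int k + Re (\<alpha> x)) *\<^sub>R co \<alpha> else x)"

lemma Re_root_shift:
  assumes "\<alpha> \<in> R" "\<beta> \<in> R" "x \<in> V"
  shows "Re (\<alpha> (x - a *\<^sub>R co \<beta>)) = Re (\<alpha> x) - a * of_int (pairing \<alpha> \<beta>)"
  using assms by (simp add: root_diff root_scaleR V_scaleR coroot_cartan pairing_eq)

lemma affine_reflection_involution:
  assumes "\<alpha> \<in> R"
  shows "affine_reflection k \<alpha> \<circ> affine_reflection k \<alpha> = id"
proof
  fix x
  show "(affine_reflection k \<alpha> \<circ> affine_reflection k \<alpha>) x = id x"
  proof (cases "x \<in> V")
    case True
    define A where "A = of_int k + Re (\<alpha> x)"
    define y where "y = x - A *\<^sub>R co \<alpha>"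
    have "y \<in> V" "of_int k + Re (\<alpha> y) = - A"
      using True assms by (simp_all add: y_def V_diff V_scaleR coroot_cartan Re_root_shift pairing_self A_def)
    moreover have "affine_reflection k \<alpha> x = y"
      using True by (simp add: affine_reflection_def y_def A_def)
    ultimately have "affine_reflection k \<alpha> (affine_reflection k \<alpha> x) = y - (- A) *\<^sub>R co \<alpha>"
      by (simp only: affine_reflection_def if_True)
    then show ?thesis
      by (simp add: y_def)
  qed (simp add: affine_reflection_def)
qed

text \<open>The affine root on the left is the image of \<open>k d\<^sup>* + \<beta>\<close> under the reflection in \<open>l d\<^sup>* + \<alpha>\<close> (see
  \<open>aff_reflection\<close>), so this is the equivariance of reflections that words need.\<close>

lemma affine_reflection_conj:
  assumes "\<alpha> \<in> R" "\<beta> \<in> R"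
  shows "affine_reflection (k - pairing \<beta> \<alpha> * l) (reflect \<alpha> \<beta>)
    = affine_reflection l \<alpha> \<circ> affine_reflection k \<beta> \<circ> affine_reflection l \<alpha>"
proof
  fix x
  let ?m = "of_int (pairing \<beta> \<alpha>) :: real" and ?n = "of_int (pairing \<alpha> \<beta>) :: real"
  show "affine_reflection (k - pairing \<beta> \<alpha> * l) (reflect \<alpha> \<beta>) x
    = (affine_reflection l \<alpha> \<circ> affine_reflection k \<beta> \<circ> affine_reflection l \<alpha>) x"
  proof (cases "x \<in> V")
    case True
    define A where "A = of_int l + Re (\<alpha> x)"
    define B where "B = of_int k + Re (\<beta> x) - A * ?m"
    define y where "y = x - A *\<^sub>R co \<alpha>"
    define z where "z = y - B *\<^sub>R co \<beta>"
    have V: "y \<in> V" "z \<in> V"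
      using True assms by (simp_all add: y_def z_def V_diff V_scaleR coroot_cartan)
    have "of_int k + Re (\<beta> y) = B"
      using assms True by (simp add: y_def B_def Re_root_shift)
    moreover have "of_int l + Re (\<alpha> z) = - A - B * ?n"
      using assms True V by (simp add: z_def y_def A_def Re_root_shift pairing_self)
    ultimately have "(affine_reflection l \<alpha> \<circ> affine_reflection k \<beta> \<circ> affine_reflection l \<alpha>) x
      = z - (- A - B * ?n) *\<^sub>R co \<alpha>"
      using True V by (simp add: affine_reflection_def A_def[symmetric] y_def[symmetric] z_def[symmetric])
    also have "\<dots> = x - B *\<^sub>R (co \<beta> - ?n *\<^sub>R co \<alpha>)"
      by (simp add: z_def y_def algebra_simps)
    also have "B = of_int (k - pairing \<beta> \<alpha> * l) + Re (reflect \<alpha> \<beta> x)"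
      by (simp add: B_def A_def reflect_def algebra_simps)
    also have "x - (of_int (k - pairing \<beta> \<alpha> * l) + Re (reflect \<alpha> \<beta> x)) *\<^sub>R (co \<beta> - ?n *\<^sub>R co \<alpha>)
        = affine_reflection (k - pairing \<beta> \<alpha> * l) (reflect \<alpha> \<beta>) x"
      using True assms by (simp only: affine_reflection_def coroot_reflect if_True)
    finally show ?thesis
      by (rule sym)
  qed (simp add: affine_reflection_def)
qed

lemma aff_inj:
  assumes "\<alpha> \<in> R" "\<beta> \<in> R" "aff G k \<alpha> = aff G l \<beta>"
  shows "k = l \<and> \<alpha> = \<beta>"
proof -
  have eq: "of_int k + \<alpha> x = of_int l + \<beta> x" if "x \<in> V" for x
    using fun_cong[OF assms(3), of x] that by (simp add: aff_def)
  have "k = l"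
    using eq[OF V_zero] assms by (simp add: root_0)
  then show ?thesis
    using eq root_eqI[OF assms(1,2)] by simp
qed

lemma aff_reflection:
  assumes "\<alpha> \<in> R" "\<beta> \<in> R"
  shows "aff G k \<beta> \<circ> affine_reflection l \<alpha> = aff G (k - pairing \<beta> \<alpha> * l) (reflect \<alpha> \<beta>)"
proof
  fix x
  show "(aff G k \<beta> \<circ> affine_reflection l \<alpha>) x = aff G (k - pairing \<beta> \<alpha> * l) (reflect \<alpha> \<beta>) x"
  proof (cases "x \<in> V")
    case True
    let ?c = "of_int l + Re (\<alpha> x)"
    have "\<beta> (x - ?c *\<^sub>R co \<alpha>) = \<beta> x - of_real ?c * of_int (pairing \<beta> \<alpha>)"
      using True assms by (simp add: root_diff root_scaleR V_scaleR coroot_cartan pairing_eq)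
    also have "of_real ?c = of_int l + \<alpha> x"
      using root_of_real[OF assms(1) True] by simp
    finally have "\<beta> (x - ?c *\<^sub>R co \<alpha>) = \<beta> x - (of_int l + \<alpha> x) * of_int (pairing \<beta> \<alpha>)" .
    moreover have "x - ?c *\<^sub>R co \<alpha> \<in> V"
      using True assms by (simp add: V_diff V_scaleR coroot_cartan)
    ultimately show ?thesis
      using True by (simp add: aff_def affine_reflection_def reflect_def algebra_simps)
  qed (simp add: aff_def affine_reflection_def)
qed

lemma aff_neg: "neg_fun (aff G k \<alpha>) = aff G (- k) (neg_fun \<alpha>)"
  by (simp add: neg_fun_def aff_def fun_eq_iff)

definition apos :: "int \<Rightarrow> ('k cplx \<Rightarrow> complex) \<Rightarrow> bool" where
  "apos k \<alpha> \<longleftrightarrow> 0 < k \<or> k = 0 \<and> \<alpha> \<in> Pos"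

lemma aff_pos_iff: "\<alpha> \<in> R \<Longrightarrow> aff G k \<alpha> \<in> positive_affine_roots G \<longleftrightarrow> apos k \<alpha>"
  unfolding positive_affine_roots_def apos_def using aff_inj by blast

lemma positive_affine_roots_eq: "positive_affine_roots G = {aff G k \<alpha> |k \<alpha>. \<alpha> \<in> R \<and> apos k \<alpha>}"
  by (simp add: positive_affine_roots_def apos_def)

lemma apos_neg: "\<alpha> \<in> R \<Longrightarrow> apos (- k) (neg_fun \<alpha>) \<longleftrightarrow> \<not> apos k \<alpha>"
  using neg_Pos_iff[of \<alpha>] by (auto simp: apos_def)


subsection \<open>The simple affine reflections\<close>

text \<open>The simple affine root with index \<open>j\<close> is \<open>level j d\<^sup>* + dir j\<close>. Treating the index 0 like the others
  avoids most distinctions between finite and affine simple roots.\<close>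

definition level :: "nat \<Rightarrow> int" where
  "level j = (if j = 0 then 1 else 0)"

definition dir :: "nat \<Rightarrow> 'k cplx \<Rightarrow> complex" where
  "dir j = (if j = 0 then neg_fun \<theta> else simple_root G j)"

lemma dir_root: "j \<le> rk G \<Longrightarrow> dir j \<in> R"
  using simple_root[of j] neg_root[OF highest_root] by (auto simp: dir_def)

lemma simple_affine_root_eq: "simple_affine_root G j = aff G (level j) (dir j)"
  by (simp add: simple_affine_root_def level_def dir_def)

lemma reflection_eq: "\<alpha> \<in> R \<Longrightarrow> reflection G \<alpha> = affine_reflection 0 \<alpha>"
proof
  fix x
  assume \<alpha>: "\<alpha> \<in> R"
  show "reflection G \<alpha> x = affine_reflection 0 \<alpha> x"
  proof (cases "x \<in> V")
    case True
    have "cscale (of_real (Re (\<alpha> x))) (co \<alpha>) = Re (\<alpha> x) *\<^sub>R co \<alpha>"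
      by (rule cscale_of_real)
    then show ?thesis
      using True root_of_real[OF \<alpha> True] by (simp add: reflection_def affine_reflection_def)
  qed (simp add: reflection_def affine_reflection_def)
qed

lemma translation_coroot:
  assumes "\<alpha> \<in> R"
  shows "affine_reflection 1 (neg_fun \<alpha>) = translation G (co \<alpha>) \<circ> affine_reflection 0 \<alpha>"
  using assms
  by (simp add: fun_eq_iff affine_reflection_def translation_def coroot_neg V_diff V_scaleR coroot_cartan)
    (simp add: neg_fun_def algebra_simps)

lemma simple_reflection_eq: "j \<le> rk G \<Longrightarrow> simple_reflection G j = affine_reflection (level j) (dir j)"
  using simple_root[of j]
  by (auto simp: simple_reflection_def level_def dir_def reflection_eq highest_root translation_coroot)

lemma height_nonzero: "\<alpha> \<in> R \<Longrightarrow> height \<alpha> \<noteq> 0"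
  using Pos_iff_height[of \<alpha>] Pos_iff_height[of "neg_fun \<alpha>"] neg_Pos_iff[of \<alpha>] neg_root[of \<alpha>]
    height_neg[of \<alpha>] by auto

lemma height_ge_highest:
  assumes "\<beta> \<in> R"
  shows "- height \<theta> \<le> height \<beta>" and "height \<beta> = - height \<theta> \<Longrightarrow> \<beta> = neg_fun \<theta>"
proof -
  show "- height \<theta> \<le> height \<beta>"
    using height_le_highest(1)[OF neg_root[OF assms]] height_neg[OF assms] by simp
  show "\<beta> = neg_fun \<theta>" if "height \<beta> = - height \<theta>"
  proof -
    have "neg_fun \<beta> = \<theta>"
      using that height_le_highest(2)[OF neg_root[OF assms]] height_neg[OF assms] by simp
    then show ?thesis
      by (metis neg_fun_neg_fun)
  qed
qed

text \<open>For the affine simple root \<open>d\<^sup>* - \<theta>\<close> the number \<open>m = \<alpha>(h\<^sub>\<theta>)\<close> is added to the level. When this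
  could spoil positivity, \<open>m\<close> is negative, and then \<open>\<alpha> - m \<theta>\<close> is a root whose height must not exceed
  that of \<open>\<theta>\<close>; this leaves \<open>m = -1\<close>, and \<open>m = -2\<close> for \<open>\<alpha> = -\<theta>\<close>.\<close>

lemma simple_permutes:
  assumes j: "j \<le> rk G" and \<alpha>: "\<alpha> \<in> R" "apos k \<alpha>" and ne: "\<not> (k = level j \<and> \<alpha> = dir j)"
  shows "apos (k - pairing \<alpha> (dir j) * level j) (reflect (dir j) \<alpha>)"
proof (cases "j = 0")
  case False
  then show ?thesis
    using assms simple_reflect_Pos[of j \<alpha>] by (auto simp: apos_def level_def dir_def)
next
  case True
  define m where "m = pairing \<alpha> \<theta>"
  define \<gamma> where "\<gamma> = reflect \<theta> \<alpha>"
  define h where "h = height \<theta>"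
  have \<gamma>: "\<gamma> \<in> R"
    using \<alpha> highest_root by (simp add: \<gamma>_def reflect_root)
  have "\<alpha> (co (neg_fun \<theta>)) = of_int (- m)"
    using \<alpha> highest_root by (simp add: coroot_neg root_minus coroot_cartan pairing_eq m_def)
  then have p: "pairing \<alpha> (neg_fun \<theta>) = - m"
    by (simp add: pairing_def)
  have r: "reflect (neg_fun \<theta>) \<alpha> = \<gamma>"
    unfolding reflect_def p \<gamma>_def m_def by (simp add: neg_fun_def)
  have h: "0 < h"
    using highest_Pos by (simp add: h_def Pos_height)
  have h\<gamma>: "height \<gamma> = height \<alpha> - m * h"
    using \<alpha> highest_root by (simp add: \<gamma>_def h_def m_def height_reflect)
  have bounds: "height \<gamma> \<le> h" "- h \<le> height \<alpha>" "height \<gamma> \<noteq> 0"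
    using \<alpha> \<gamma> height_le_highest height_ge_highest height_nonzero by (simp_all add: h_def)
  have k: "0 \<le> k" "k = 0 \<longleftrightarrow> k = 0 \<and> 0 < height \<alpha>"
    using \<alpha> Pos_iff_height by (auto simp: apos_def)
  have goal: "0 < k + m \<or> k + m = 0 \<and> 0 < height \<gamma>"
  proof -
    consider "0 < m" | "m = 0" | "m = -1" | "m = -2" | "m \<le> -3"
      by linarith
    then show ?thesis
    proof cases
      case 2
      then show ?thesis
        using k h\<gamma> by auto
    next
      case 3
      then show ?thesis
        using k h\<gamma> bounds by auto
    next
      case 4
      then have "height \<alpha> = - h"
        using h\<gamma> bounds by simp
      then have "\<alpha> = neg_fun \<theta>"
        using height_ge_highest(2)[OF \<alpha>(1)] by (simp add: h_def)
      then have "k \<noteq> 1"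
        using ne True by (auto simp: level_def dir_def)
      then show ?thesis
        using 4 k h\<gamma> h \<open>height \<alpha> = - h\<close> by auto
    next
      case 5
      then have "3 * h \<le> - m * h"
        using h by (intro mult_right_mono) auto
      then show ?thesis
        using h\<gamma> bounds h by simp
    qed (use k in simp)
  qed
  then show ?thesis
    using True p r \<gamma> by (auto simp: apos_def level_def dir_def Pos_iff_height)
qed

text \<open>The representation of an affine root by level and direction is unique, so the choice is forced.\<close>

definition refl_of :: "('k cplx \<Rightarrow> complex) \<Rightarrow> 'k cplx \<Rightarrow> 'k cplx" where
  "refl_of \<beta> = (SOME f. \<exists>k \<alpha>. \<alpha> \<in> R \<and> \<beta> = aff G k \<alpha> \<and> f = affine_reflection k \<alpha>)"

lemma refl_of_aff:
  assumes "\<alpha> \<in> R"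
  shows "refl_of (aff G k \<alpha>) = affine_reflection k \<alpha>"
  unfolding refl_of_def
proof (rule some_equality)
  show "\<exists>k' \<alpha>'. \<alpha>' \<in> R \<and> aff G k \<alpha> = aff G k' \<alpha>' \<and> affine_reflection k \<alpha> = affine_reflection k' \<alpha>'"
    using assms by (intro exI[of _ k] exI[of _ \<alpha>]) simp
  show "f = affine_reflection k \<alpha>"
    if f: "\<exists>k' \<alpha>'. \<alpha>' \<in> R \<and> aff G k \<alpha> = aff G k' \<alpha>' \<and> f = affine_reflection k' \<alpha>'" for f
  proof -
    obtain k' \<alpha>' where "\<alpha>' \<in> R" "aff G k \<alpha> = aff G k' \<alpha>'" "f = affine_reflection k' \<alpha>'"
      using f by blast
    then show ?thesis
      using aff_inj[OF assms, of \<alpha>' k k'] by simp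
  qed
qed

lemma word_prod_eq_word_map: "word_map (simple_reflection G) = word_prod G"
  by (simp add: fun_eq_iff word_map_def word_prod_def)

lemma weyl_length_eq_word_length: "weyl_length G I w = word_length (simple_reflection G) I w"
  by (simp add: weyl_length_def word_length_def word_prod_eq_word_map)

lemma affine_rootsE:
  assumes "\<beta> \<in> affine_roots G"
  obtains k \<alpha> where "\<alpha> \<in> R" "\<beta> = aff G k \<alpha>"
  using assms by (auto simp: affine_roots_def)

lemma aff_affine_root: "\<alpha> \<in> R \<Longrightarrow> aff G k \<alpha> \<in> affine_roots G"
  unfolding affine_roots_def by (intro CollectI exI[of _ k] exI[of _ \<alpha>]) simp

lemma aff_simple_reflection: "j \<le> rk G \<Longrightarrow> \<alpha> \<in> R \<Longrightarrow> aff G k \<alpha> \<circ> simple_reflection G j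
    = aff G (k - pairing \<alpha> (dir j) * level j) (reflect (dir j) \<alpha>)"
  by (simp add: simple_reflection_eq aff_reflection dir_root)

lemma simple_affine_root_pos: "j \<le> rk G \<Longrightarrow> simple_affine_root G j \<in> positive_affine_roots G"
  using simple_Pos[of j] by (auto simp: simple_affine_root_eq aff_pos_iff dir_root)
    (auto simp: apos_def level_def dir_def)

lemma reflection_words_affine:
  assumes "I \<subseteq> {0..rk G}"
  shows "reflection_words I (simple_reflection G) (affine_roots G) (positive_affine_roots G)
    (simple_affine_root G) refl_of"
proof
  fix i \<beta>
  show "positive_affine_roots G \<subseteq> affine_roots G"
    unfolding positive_affine_roots_def affine_roots_def by blast
  show "neg_fun \<beta> \<in> positive_affine_roots G \<longleftrightarrow> \<beta> \<notin> positive_affine_roots G"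
    if "\<beta> \<in> affine_roots G"
    using that by (elim affine_rootsE) (simp add: aff_neg aff_pos_iff neg_root apos_neg)
  assume "i \<in> I"
  then have i: "i \<le> rk G"
    using assms by auto
  note dir = dir_root[OF i]
  show "simple_reflection G i \<circ> simple_reflection G i = id"
    using i dir by (simp add: simple_reflection_eq affine_reflection_involution)
  show "\<beta> \<circ> simple_reflection G i \<in> affine_roots G" if "\<beta> \<in> affine_roots G"
    using that i dir by (elim affine_rootsE) (simp add: aff_simple_reflection aff_affine_root reflect_root)
  show "simple_affine_root G i \<in> positive_affine_roots G"
    using i by (rule simple_affine_root_pos)
  show "simple_affine_root G i \<circ> simple_reflection G i = neg_fun (simple_affine_root G i)"
    using i dir by (simp add: simple_affine_root_eq aff_simple_reflection aff_neg pairing_self reflect_self)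
  show "\<beta> \<circ> simple_reflection G i \<in> positive_affine_roots G"
    if \<beta>: "\<beta> \<in> positive_affine_roots G" "\<beta> \<noteq> simple_affine_root G i"
  proof -
    obtain k \<alpha> where \<alpha>: "\<alpha> \<in> R" "\<beta> = aff G k \<alpha>" "apos k \<alpha>"
      using \<beta>(1) by (auto simp: positive_affine_roots_eq)
    then have "\<not> (k = level i \<and> \<alpha> = dir i)"
      using \<beta>(2) by (auto simp: simple_affine_root_eq)
    then show ?thesis
      using simple_permutes[OF i \<alpha>(1,3)] \<alpha> i dir
      by (simp add: aff_simple_reflection aff_pos_iff reflect_root)
  qed
  show "refl_of (simple_affine_root G i) = simple_reflection G i"
    using i dir by (simp add: simple_affine_root_eq refl_of_aff simple_reflection_eq)
  show "refl_of (\<beta> \<circ> simple_reflection G i) = simple_reflection G i \<circ> refl_of \<beta> \<circ> simple_reflection G i"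
    if "\<beta> \<in> affine_roots G"
    using that i dir
    by (elim affine_rootsE)
      (simp only: aff_simple_reflection refl_of_aff reflect_root affine_reflection_conj, simp only: simple_reflection_eq)
qed

end

sublocale root_datum \<subseteq> affine: reflection_words "{0..rk G}" "simple_reflection G" "affine_roots G"
  "positive_affine_roots G" "simple_affine_root G" refl_of
  rewrites "word_map (simple_reflection G) = word_prod G"
  by (rule reflection_words_affine) (simp_all add: word_prod_eq_word_map)

sublocale root_datum \<subseteq> spherical: reflection_words "{1..rk G}" "simple_reflection G" "affine_roots G"
  "positive_affine_roots G" "simple_affine_root G" refl_of
  rewrites "word_map (simple_reflection G) = word_prod G"
  by (rule reflection_words_affine) (simp_all add: word_prod_eq_word_map)

context root_datum
begin

lemma word_prod_Nil [simp]: "word_prod G [] = id"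
  and word_prod_Cons: "word_prod G (i # u) = simple_reflection G i \<circ> word_prod G u"
  by (simp_all add: word_prod_def)

lemma word_prod_append: "word_prod G (u @ v) = word_prod G u \<circ> word_prod G v"
  using word_map_append[of "simple_reflection G"] by (simp add: word_prod_eq_word_map)

lemma reduced_expression_affine: "reduced_expression G {0..rk G} u \<longleftrightarrow> affine.reduced u"
  unfolding reduced_expression_def affine.reduced_iff weyl_length_eq_word_length ..

lemma reduced_expression_finite: "reduced_expression G {1..rk G} u \<longleftrightarrow> spherical.reduced u"
  unfolding reduced_expression_def spherical.reduced_iff weyl_length_eq_word_length ..

lemma inversions_eq_inverted:
  assumes "set u \<subseteq> {0..rk G}"
  shows "inversions G (word_prod G u) = inverted (positive_affine_roots G) (word_prod G u)"
proof -
  have "\<beta> \<circ> inv (word_prod G u) \<in> affine_roots G" if "\<beta> \<in> positive_affine_roots G" for \<beta>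
    using that assms affine.pos_subset affine.word_stable[of "rev u" \<beta>] affine.inv_word[of u] by auto
  then show ?thesis
    by (auto simp: inversions_def inverted_def weyl_act_def negative_affine_roots_def)
qed


subsection \<open>Descent to the simple roots\<close>

lemma comb_multiple: "f \<in> S \<Longrightarrow> (\<lambda>x. of_nat k * f x) \<in> S"
proof (induction k)
  case 0
  have "(\<lambda>x. 0) = simple_comb G (\<lambda>i. of_nat 0)"
    by (simp add: simple_comb_def fun_eq_iff)
  then have "(\<lambda>x. 0) \<in> S"
    unfolding nonneg_combs_def by (intro CollectI exI[of _ "\<lambda>i. 0"]) simp
  then show ?case
    by simp
next
  case (Suc k)
  then have "(\<lambda>x. f x + of_nat k * f x) \<in> S"
    by (intro comb_add) simp_all
  then show ?case
    by (simp add: algebra_simps)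
qed

text \<open>The left-hand side is the part of \<open>k d\<^sup>* + \<alpha> = k (d\<^sup>* - \<theta>) + (k \<theta> + \<alpha>)\<close> in the finite simple roots:
  positive affine roots are nonnegative combinations of simple affine roots.\<close>

lemma apos_comb:
  assumes "\<alpha> \<in> R" "apos k \<alpha>"
  shows "(\<lambda>x. of_int k * \<theta> x + \<alpha> x) \<in> S"
proof (cases "k = 0")
  case True
  then show ?thesis
    using assms by (simp add: apos_def Pos_iff)
next
  case False
  then obtain l where l: "k = 1 + int l"
    using assms(2) zle_iff_zadd[of 1 k] by (auto simp: apos_def)
  have "\<theta> \<in> S"
    using highest_Pos by (simp add: Pos_iff)
  then have "(\<lambda>x. (\<theta> x - neg_fun \<alpha> x) + of_nat l * \<theta> x) \<in> S"
    using assms by (intro comb_add comb_multiple highest_diff neg_root)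
  then show ?thesis
    by (simp add: l neg_fun_def algebra_simps)
qed

text \<open>A positive affine root is a nonnegative combination of simple ones and its linear part has the
  value 2 at its own coroot, so some simple one has a positive value there.\<close>

lemma descent:
  assumes \<alpha>: "\<alpha> \<in> R" "apos k \<alpha>"
  shows "\<exists>j\<le>rk G. (k = 0 \<longrightarrow> j \<noteq> 0) \<and> 0 < pairing \<alpha> (dir j)"
proof (rule ccontr)
  assume "\<not> ?thesis"
  then have nonpos: "pairing (dir j) \<alpha> \<le> 0" if "j \<le> rk G" "k = 0 \<longrightarrow> j \<noteq> 0" for j
    using that pairing_sym_pos[OF dir_root[OF that(1)] \<alpha>(1)] by (meson not_le)
  obtain n :: "nat \<Rightarrow> nat" where n: "(\<lambda>x. of_int k * \<theta> x + \<alpha> x) = simple_comb G (\<lambda>i. of_nat (n i))"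
    using apos_comb[OF \<alpha>] by (rule combE)
  have "(of_int (k * pairing \<theta> \<alpha> + 2) :: complex) = of_int k * \<theta> (co \<alpha>) + \<alpha> (co \<alpha>)"
    using \<alpha> highest_root by (simp add: pairing_eq pairing_self)
  also have "\<dots> = simple_comb G (\<lambda>i. of_nat (n i)) (co \<alpha>)"
    using n by (rule fun_cong)
  also have "\<dots> = (\<Sum>i=1..rk G. of_nat (n i) * of_int (pairing (dir i) \<alpha>))"
    unfolding simple_comb_def using \<alpha> simple_root by (intro sum.cong) (simp_all add: dir_def pairing_eq)
  also have "\<dots> = of_int (\<Sum>i=1..rk G. int (n i) * pairing (dir i) \<alpha>)"
    by simp
  finally have "k * pairing \<theta> \<alpha> + 2 = (\<Sum>i=1..rk G. int (n i) * pairing (dir i) \<alpha>)"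
    by (simp only: of_int_eq_iff)
  also have "\<dots> \<le> 0"
    by (intro sum_nonpos mult_nonneg_nonpos) (auto intro: nonpos)
  finally have le: "k * pairing \<theta> \<alpha> + 2 \<le> 0" .
  have "0 \<le> k * pairing \<theta> \<alpha>"
  proof (cases "k = 0")
    case False
    have "neg_fun \<theta> (co \<alpha>) = of_int (- pairing \<theta> \<alpha>)"
      using \<alpha> highest_root by (simp add: neg_fun_def pairing_eq)
    then have "pairing (dir 0) \<alpha> = - pairing \<theta> \<alpha>"
      by (simp add: pairing_def dir_def)
    then have "0 \<le> pairing \<theta> \<alpha>"
      using nonpos[of 0] False by simp
    then show ?thesis
      using \<alpha>(2) by (auto simp: apos_def)
  qed simp
  then show False
    using le by simp
qed

text \<open>Every positive affine root arises from a simple one by simple reflections. With \<open>I = {1..r}\<close> and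
  \<open>k = 0\<close> the statement is about the finite root system.\<close>

lemma affine_root_induct [consumes 3, case_names simple reflect]:
  assumes "\<alpha> \<in> R" "apos k \<alpha>" "I = {0..rk G} \<or> I = {1..rk G} \<and> k = 0"
    and simple: "\<And>j. j \<in> I \<Longrightarrow> Q (level j) (dir j)"
    and reflect: "\<And>j l \<beta>. j \<in> I \<Longrightarrow> \<beta> \<in> R \<Longrightarrow> Q l \<beta> \<Longrightarrow>
      Q (l - pairing \<beta> (dir j) * level j) (reflect (dir j) \<beta>)"
  shows "Q k \<alpha>"
proof -
  \<comment> \<open>the factor of \<open>k\<close> makes the measure equal to 2 at all simple affine roots\<close>
  define \<mu> where "\<mu> k \<alpha> = nat (k * (height \<theta> + 2) + height \<alpha>)" for k \<alpha>
  show ?thesis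
    using assms(1-3)
  proof (induction "\<mu> k \<alpha>" arbitrary: k \<alpha> rule: less_induct)
    case less
    obtain j where j: "j \<le> rk G" "k = 0 \<longrightarrow> j \<noteq> 0" "0 < pairing \<alpha> (dir j)"
      using descent[OF less.prems(1,2)] by blast
    have jI: "j \<in> I"
      using j less.prems(3) by (cases "j = 0") auto
    show ?case
    proof (cases "k = level j \<and> \<alpha> = dir j")
      case True
      then show ?thesis
        using simple[OF jI] by simp
    next
      case False
      note dir = dir_root[OF j(1)]
      define m where "m = pairing \<alpha> (dir j)"
      define \<beta> where "\<beta> = reflect (dir j) \<alpha>"
      define l where "l = k - m * level j"
      have \<beta>: "\<beta> \<in> R" "apos l \<beta>"
        using simple_permutes[OF j(1) less.prems(1,2) False] less.prems dir
        by (simp_all add: \<beta>_def l_def m_def reflect_root)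
      have "level j * (height \<theta> + 2) + height (dir j) = 2"
        using j(1) height_simple[of j] height_neg[OF highest_root] by (auto simp: level_def dir_def)
      then have "m * (level j * (height \<theta> + 2) + height (dir j)) = m * 2"
        by simp
      moreover have "height \<beta> = height \<alpha> - m * height (dir j)"
        using less.prems dir by (simp add: \<beta>_def m_def height_reflect)
      ultimately have drop: "l * (height \<theta> + 2) + height \<beta> = k * (height \<theta> + 2) + height \<alpha> - m * 2"
        by (simp add: l_def algebra_simps)
      have pos: "0 < k * (height \<theta> + 2) + height \<alpha>"
      proof (cases "k = 0")
        case True
        then show ?thesis
          using less.prems by (simp add: apos_def Pos_height)
      next
        case False
        then have "1 * (height \<theta> + 2) \<le> k * (height \<theta> + 2)"
          using less.prems(2) Pos_height[OF highest_Pos] by (intro mult_right_mono) (auto simp: apos_def)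
        then show ?thesis
          using height_ge_highest(1)[OF less.prems(1)] by simp
      qed
      have "\<mu> l \<beta> < \<mu> k \<alpha>"
        unfolding \<mu>_def drop using pos j(3) by (simp add: m_def)
      moreover have "I = {0..rk G} \<or> I = {1..rk G} \<and> l = 0"
        using less.prems(3) jI by (auto simp: l_def level_def)
      ultimately have "Q l \<beta>"
        using less.hyps \<beta> by blast
      then have "Q (l - pairing \<beta> (dir j) * level j) (reflect (dir j) \<beta>)"
        using reflect[OF jI \<beta>(1)] by blast
      then show ?thesis
        using less.prems dir by (simp add: \<beta>_def l_def m_def pairing_reflect reflect_reflect)
    qed
  qed
qed

lemma affine_reflection_word:
  assumes "\<alpha> \<in> R" "apos k \<alpha>" "I = {0..rk G} \<or> I = {1..rk G} \<and> k = 0"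
  shows "\<exists>u. set u \<subseteq> I \<and> word_prod G u = affine_reflection k \<alpha>"
  using assms
proof (induction rule: affine_root_induct)
  case (simple j)
  then have "j \<le> rk G"
    using assms(3) by auto
  then show ?case
    using simple by (intro exI[of _ "[j]"]) (simp add: word_prod_Cons simple_reflection_eq)
next
  case (reflect j l \<beta>)
  then have j: "j \<le> rk G"
    using assms(3) by auto
  obtain u where u: "set u \<subseteq> I" "word_prod G u = affine_reflection l \<beta>"
    using reflect by blast
  have "word_prod G ([j] @ u @ [j])
    = affine_reflection (l - pairing \<beta> (dir j) * level j) (reflect (dir j) \<beta>)"
    unfolding affine_reflection_conj[OF dir_root[OF j] reflect(2)] word_prod_append u(2)
    by (simp add: word_prod_Cons simple_reflection_eq j comp_assoc)
  moreover have "set ([j] @ u @ [j]) \<subseteq> I"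
    using u reflect by simp
  ultimately show ?case
    by blast
qed

lemma word_finite_weyl: "set u \<subseteq> {1..rk G} \<Longrightarrow> word_prod G u \<in> finite_weyl_group G"
proof (induction u)
  case Nil
  show ?case
    unfolding word_prod_Nil by (rule weyl_id)
next
  case (Cons i u)
  then have "reflection G (simple_root G i) \<circ> word_prod G u \<in> finite_weyl_group G"
    by (intro weyl_refl) (simp_all add: simple_root)
  moreover have "simple_reflection G i = reflection G (simple_root G i)"
    using Cons.prems by (simp add: simple_reflection_def)
  ultimately show ?case
    by (simp only: word_prod_Cons)
qed


subsection \<open>The coroot lattice and its translations\<close>

abbreviation Q where "Q \<equiv> coroot_lattice G"

lemma latticeE:
  assumes "h \<in> Q"
  obtains c :: "nat \<Rightarrow> int" where "h = (\<Sum>i=1..rk G. of_int (c i) *\<^sub>R co (simple_root G i))"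
  using assms by (auto simp: coroot_lattice_def)

lemma latticeI: "(\<Sum>i=1..rk G. of_int (c i) *\<^sub>R co (simple_root G i)) \<in> Q"
  unfolding coroot_lattice_def by (intro CollectI exI[of _ c]) simp

lemma lattice_V: "h \<in> Q \<Longrightarrow> h \<in> V"
  by (elim latticeE) (auto intro!: subspace_sum[OF subspace_V] V_scaleR coroot_cartan simple_root)

lemma lattice_add_multiple:
  assumes "g \<in> Q" "h \<in> Q"
  shows "g + of_int m *\<^sub>R h \<in> Q"
proof -
  obtain c where "g = (\<Sum>i=1..rk G. of_int (c i) *\<^sub>R co (simple_root G i))"
    using assms(1) by (rule latticeE)
  moreover obtain d where "h = (\<Sum>i=1..rk G. of_int (d i) *\<^sub>R co (simple_root G i))"
    using assms(2) by (rule latticeE)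
  ultimately have "g + of_int m *\<^sub>R h = (\<Sum>i=1..rk G. of_int (c i + m * d i) *\<^sub>R co (simple_root G i))"
    by (simp add: scaleR_sum_right sum.distrib[symmetric] scaleR_add_left)
  then show ?thesis
    by (simp only: latticeI)
qed

lemma lattice_zero: "0 \<in> Q"
  using latticeI[of "\<lambda>i. 0"] by simp

lemma lattice_sum: "(\<And>i. i \<in> A \<Longrightarrow> f i \<in> Q) \<Longrightarrow> sum f A \<in> Q"
proof (induction A rule: infinite_finite_induct)
  case (insert i A)
  then show ?case
    using lattice_add_multiple[of "f i" "sum f A" 1] by simp
qed (simp_all add: lattice_zero)

lemma simple_coroot_lattice:
  assumes "i \<in> {1..rk G}"
  shows "co (simple_root G i) \<in> Q"
proof -
  have "(\<Sum>j=1..rk G. of_int (if j = i then 1 else 0) *\<^sub>R co (simple_root G j))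
    = (\<Sum>j=1..rk G. if j = i then co (simple_root G j) else 0)"
    by (intro sum.cong) auto
  also have "\<dots> = co (simple_root G i)"
    using assms by (simp add: sum.delta)
  finally show ?thesis
    using latticeI[of "\<lambda>j. if j = i then 1 else 0"] by simp
qed

lemma coroot_Pos_lattice:
  assumes "\<alpha> \<in> Pos"
  shows "co \<alpha> \<in> Q"
proof -
  have "\<alpha> \<in> R" "apos 0 \<alpha>" "{1..rk G} = {0..rk G} \<or> {1..rk G} = {1..rk G} \<and> (0::int) = 0"
    using assms by (simp_all add: Pos_iff apos_def)
  then show ?thesis
  proof (induction rule: affine_root_induct)
    case (simple j)
    then show ?case
      using simple_coroot_lattice by (simp add: dir_def)
  next
    case (reflect j l \<beta>)
    then show ?case
      using lattice_add_multiple[of "co \<beta>" "co (dir j)" "- pairing (dir j) \<beta>"]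
        simple_coroot_lattice[of j] dir_root[of j] by (auto simp: coroot_reflect dir_def)
  qed
qed

lemma height_point_lattice: "height_point \<in> Q"
  unfolding height_point_def by (intro lattice_sum coroot_Pos_lattice)

lemma height_point_chamber: "height_point \<in> chamber G"
  by (simp add: chamber_def height_point_V simple_height)

lemma root_lattice_int:
  assumes "\<alpha> \<in> R" "h \<in> Q"
  shows "\<alpha> h \<in> \<int>"
proof -
  obtain c :: "nat \<Rightarrow> int" where "h = (\<Sum>i=1..rk G. of_int (c i) *\<^sub>R co (simple_root G i))"
    using assms(2) by (rule latticeE)
  then have "\<alpha> h = (\<Sum>i=1..rk G. \<alpha> (of_int (c i) *\<^sub>R co (simple_root G i)))"
    using assms(1) simple_root by (simp only: root_sum V_scaleR coroot_cartan)
  also have "\<dots> = (\<Sum>i=1..rk G. of_int (c i) * of_int (pairing \<alpha> (simple_root G i)))"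
    using assms(1) simple_root by (intro sum.cong) (simp_all add: root_scaleR coroot_cartan pairing_eq)
  finally have "\<alpha> h = (\<Sum>i=1..rk G. of_int (c i) * of_int (pairing \<alpha> (simple_root G i)))" .
  then show ?thesis
    by (simp only:) (intro Ints_sum Ints_mult Ints_of_int)
qed

lemma translation_add: "h \<in> V \<Longrightarrow> translation G (g + h) = translation G g \<circ> translation G h"
  by (auto simp: translation_def fun_eq_iff V_add algebra_simps)

lemma translation_zero: "translation G 0 = id"
  by (auto simp: translation_def fun_eq_iff)

lemma translation_inverse:
  assumes "h \<in> V"
  shows "translation G (- h) \<circ> translation G h = id" "translation G h \<circ> translation G (- h) = id"
  using translation_add[of h "- h"] translation_add[of "- h" h] assms by (simp_all add: V_uminus translation_zero)

lemma inv_translation: "h \<in> V \<Longrightarrow> inv (translation G (- h)) = translation G h"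
  by (rule inv_unique_comp) (simp_all add: translation_inverse)

text \<open>The translation by a coroot is the product of the reflections in \<open>d\<^sup>* - \<alpha>\<close> and \<open>\<alpha>\<close>, both of
  which are given by words.\<close>

lemma translation_word:
  assumes "h \<in> Q"
  shows "\<exists>u. set u \<subseteq> {0..rk G} \<and> word_prod G u = translation G h"
proof -
  define T where "T = {h \<in> V. \<exists>u. set u \<subseteq> {0..rk G} \<and> word_prod G u = translation G h}"
  have T_add: "g + h \<in> T" if gh: "g \<in> T" "h \<in> T" for g h
  proof -
    obtain u v where "set u \<subseteq> {0..rk G}" "word_prod G u = translation G g"
      "set v \<subseteq> {0..rk G}" "word_prod G v = translation G h"
      using gh by (auto simp: T_def)
    then show ?thesis
      using gh unfolding T_def
      by (intro CollectI conjI exI[of _ "u @ v"]) (auto simp: V_add translation_add word_prod_append)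
  qed
  have T_uminus: "- h \<in> T" if h: "h \<in> T" for h
  proof -
    obtain u where u: "set u \<subseteq> {0..rk G}" "word_prod G u = translation G h"
      using h by (auto simp: T_def)
    have "word_prod G (rev u) = translation G (- h)"
      using affine.inv_word[OF u(1)] inv_translation[of "- h"] that u(2)
      by (simp add: T_def V_uminus)
    then show ?thesis
      using that u unfolding T_def by (intro CollectI conjI exI[of _ "rev u"]) (auto simp: V_uminus)
  qed
  have T_zero: "0 \<in> T"
    unfolding T_def by (intro CollectI conjI exI[of _ "[]"]) (simp_all add: V_zero translation_zero)
  have T_multiple: "of_int m *\<^sub>R h \<in> T" if "h \<in> T" for h m
  proof -
    have nat: "of_nat n *\<^sub>R h \<in> T" for n :: nat
    proof (induction n)
      case (Suc n)
      then show ?case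
        using T_add[OF that Suc] by (simp add: algebra_simps)
    qed (simp add: T_zero)
    show ?thesis
      using nat[of "nat m"] T_uminus[OF nat[of "nat (- m)"]] by (cases "0 \<le> m") simp_all
  qed
  have T_simple: "co (simple_root G i) \<in> T" if "i \<in> {1..rk G}" for i
  proof -
    let ?a = "simple_root G i"
    have a: "?a \<in> R"
      using that by (rule simple_root)
    obtain u where "set u \<subseteq> {0..rk G}" "word_prod G u = affine_reflection 1 (neg_fun ?a)"
      using affine_reflection_word[of "neg_fun ?a" 1 "{0..rk G}"] a by (auto simp: neg_root apos_def)
    moreover have "word_prod G [i] = affine_reflection 0 ?a"
      using that a by (simp add: word_prod_Cons simple_reflection_def reflection_eq)
    ultimately have "set (u @ [i]) \<subseteq> {0..rk G}" "word_prod G (u @ [i]) = translation G (co ?a)"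
      using that a translation_coroot[OF a] affine_reflection_involution[OF a, of 0]
      by (simp_all add: word_prod_append comp_assoc)
    then show ?thesis
      unfolding T_def using coroot_cartan[OF a] by blast
  qed
  have T_sum: "sum f A \<in> T" if "\<And>i. i \<in> A \<Longrightarrow> f i \<in> T" for f and A :: "nat set"
    using that by (induction A rule: infinite_finite_induct) (simp_all add: T_zero T_add)
  obtain c :: "nat \<Rightarrow> int" where "h = (\<Sum>i=1..rk G. of_int (c i) *\<^sub>R co (simple_root G i))"
    using assms by (rule latticeE)
  then have "h \<in> T"
    using T_sum[of "{1..rk G}"] T_multiple T_simple by simp
  then show ?thesis
    by (simp add: T_def)
qed

end

section \<open>Periodic sequences from dominant translations\<close>

lemma seq_word_append:
  assumes "s \<le> m + 1" "m \<le> n"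
  shows "seq_word \<rho> s n = seq_word \<rho> (m + 1) n @ seq_word \<rho> s m"
proof -
  have "[s..n] = [s..m] @ [m + 1..n]"
    using assms upto_split1[of s "m + 1" n] by (cases "m = n") simp_all
  then show ?thesis
    by (simp add: seq_word_def)
qed

lemma length_seq_word: "length (seq_word \<rho> s n) = nat (n - s + 1)"
  by (simp add: seq_word_def)

lemma seq_word_empty: "n < s \<Longrightarrow> seq_word \<rho> s n = []"
  by (simp add: seq_word_def)

lemma seq_word_Cons: "s \<le> n \<Longrightarrow> seq_word \<rho> s n = \<rho> n # seq_word \<rho> s (n - 1)"
  by (simp add: seq_word_def upto_rec2)

lemma seq_word_shift:
  assumes "\<And>j. s \<le> j \<Longrightarrow> j \<le> n \<Longrightarrow> \<rho> (j + l) = \<rho> j"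
  shows "seq_word \<rho> (s + l) (n + l) = seq_word \<rho> s n"
proof -
  have "map \<rho> [s + l..n + l] = map \<rho> [s..n]"
    by (rule nth_equalityI) (auto simp: assms[symmetric] algebra_simps)
  then show ?thesis
    by (simp add: seq_word_def rev_map[symmetric])
qed

context root_datum
begin

definition eval_int :: "('k cplx \<Rightarrow> complex) \<Rightarrow> 'k cplx \<Rightarrow> int" where
  "eval_int \<alpha> h = \<lfloor>Re (\<alpha> h)\<rfloor>"

lemma eval_int: "\<alpha> \<in> R \<Longrightarrow> h \<in> Q \<Longrightarrow> \<alpha> h = of_int (eval_int \<alpha> h)"
  using root_lattice_int[of \<alpha> h] by (auto simp: eval_int_def elim: Ints_cases)

lemma eval_int_multiple:
  assumes "\<alpha> \<in> R" "h \<in> Q"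
  shows "eval_int \<alpha> (of_nat n *\<^sub>R h) = int n * eval_int \<alpha> h"
proof -
  have "Re (\<alpha> (of_nat n *\<^sub>R h)) = of_int (int n * eval_int \<alpha> h)"
    using root_scaleR[OF assms(1) lattice_V[OF assms(2)], of "of_nat n"] eval_int[OF assms] by simp
  then show ?thesis
    unfolding eval_int_def[of _ "of_nat n *\<^sub>R h"] by (simp only: floor_of_int)
qed

lemma eval_int_pos:
  assumes \<beta>: "\<beta> \<in> Pos" and h: "h \<in> chamber G" "h \<in> Q"
  shows "0 < eval_int \<beta> h"
proof -
  obtain n :: "nat \<Rightarrow> nat" where n: "\<beta> = simple_comb G (\<lambda>i. of_nat (n i))"
    using \<beta> Pos_iff by (metis combE)
  have simple: "0 < eval_int (simple_root G i) h" if "i \<in> {1..rk G}" for i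
  proof -
    have "0 < Re (simple_root G i h)"
      using that h(1) unfolding chamber_def by blast
    then show ?thesis
      using eval_int[OF simple_root[OF that] h(2)] by simp
  qed
  have "(of_int (eval_int \<beta> h) :: complex) = \<beta> h"
    using \<beta> h by (simp add: eval_int Pos_iff)
  also have "\<dots> = (\<Sum>i=1..rk G. of_nat (n i) * of_int (eval_int (simple_root G i) h))"
    by (subst n) (use h simple_root in \<open>auto simp: simple_comb_def eval_int intro!: sum.cong\<close>)
  also have "\<dots> = of_int (\<Sum>i=1..rk G. int (n i) * eval_int (simple_root G i) h)"
    by simp
  finally have eq: "eval_int \<beta> h = (\<Sum>i=1..rk G. int (n i) * eval_int (simple_root G i) h)"
    by (simp only: of_int_eq_iff)
  have "\<exists>i\<in>{1..rk G}. n i \<noteq> 0"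
  proof (rule ccontr)
    assume "\<not> ?thesis"
    then have "\<beta> = (\<lambda>x. 0)"
      by (subst n) (simp add: simple_comb_def fun_eq_iff)
    then show False
      using \<beta> root_nonzero[of \<beta>] unfolding Pos_iff by blast
  qed
  then obtain i where i: "i \<in> {1..rk G}" "n i \<noteq> 0"
    by blast
  have "0 < int (n i) * eval_int (simple_root G i) h"
    using i simple by simp
  also have "\<dots> \<le> eval_int \<beta> h"
    unfolding eq using i(1)
    by (intro member_le_sum mult_nonneg_nonneg less_imp_le[OF simple]) auto
  finally show ?thesis .
qed

lemma aff_translation:
  assumes "\<alpha> \<in> R" "h \<in> Q"
  shows "aff G k \<alpha> \<circ> translation G h = aff G (k + eval_int \<alpha> h) \<alpha>"
  using assms lattice_V[OF assms(2)]
  by (simp add: fun_eq_iff aff_def translation_def V_add root_add eval_int)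

text \<open>Composition with the translation adds \<open>\<alpha>(h)\<close> to the level of \<open>k d\<^sup>* + \<alpha>\<close>, so only roots with
  negative \<open>\<alpha>\<close> can become negative.\<close>

lemma inverted_translation:
  assumes h: "h \<in> chamber G" "h \<in> Q"
  shows "inverted (positive_affine_roots G) (translation G (- h))
    = (\<lambda>(\<beta>, k). aff G k (neg_fun \<beta>)) ` (SIGMA \<beta>:Pos. {1..eval_int \<beta> h})" (is "?L = ?f ` ?B")
proof -
  have inv: "inv (translation G (- h)) = translation G h"
    using lattice_V[OF h(2)] by (rule inv_translation)
  have mem: "aff G k \<alpha> \<in> ?L \<longleftrightarrow> apos k \<alpha> \<and> \<not> apos (k + eval_int \<alpha> h) \<alpha>" if "\<alpha> \<in> R" for k \<alpha>
    using that h by (simp add: inverted_def inv aff_translation aff_pos_iff)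
  have eval_neg: "eval_int (neg_fun \<beta>) h = - eval_int \<beta> h" if "\<beta> \<in> R" for \<beta>
  proof -
    have "neg_fun \<beta> h = of_int (- eval_int \<beta> h)"
      using eval_int[OF that h(2)] by (simp add: neg_fun_def)
    then show ?thesis
      by (simp add: eval_int_def)
  qed
  have mem_neg: "aff G k (neg_fun \<beta>) \<in> ?L \<longleftrightarrow> 1 \<le> k \<and> k \<le> eval_int \<beta> h" if \<beta>: "\<beta> \<in> Pos" for k \<beta>
  proof -
    have "\<beta> \<in> R" "neg_fun \<beta> \<notin> Pos"
      using \<beta> neg_Pos_iff Pos_iff by blast+
    then show ?thesis
      using mem[OF neg_root] by (auto simp: eval_neg apos_def)
  qed
  show ?thesis
  proof
    show "?L \<subseteq> ?f ` ?B"
    proof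
      fix \<gamma> assume \<gamma>: "\<gamma> \<in> ?L"
      then obtain k \<alpha> where \<alpha>: "\<alpha> \<in> R" "\<gamma> = aff G k \<alpha>" "apos k \<alpha>"
        by (auto simp: inverted_def positive_affine_roots_eq)
      have "\<alpha> \<notin> Pos"
      proof
        assume "\<alpha> \<in> Pos"
        then have "apos (k + eval_int \<alpha> h) \<alpha>"
          using eval_int_pos[OF _ h] \<alpha>(3) by (force simp: apos_def)
        then show False
          using \<gamma> mem \<alpha> by simp
      qed
      then have neg: "neg_fun \<alpha> \<in> Pos"
        using neg_Pos_iff \<alpha>(1) by blast
      then have "1 \<le> k \<and> k \<le> eval_int (neg_fun \<alpha>) h"
        using mem_neg[OF neg, of k] \<gamma> \<alpha>(2) by simp
      then show "\<gamma> \<in> ?f ` ?B"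
        using neg \<alpha>(2) by (intro image_eqI[of _ _ "(neg_fun \<alpha>, k)"]) auto
    qed
    show "?f ` ?B \<subseteq> ?L"
    proof (rule image_subsetI)
      fix x assume "x \<in> ?B"
      then obtain \<beta> k where "x = (\<beta>, k)" "\<beta> \<in> Pos" "1 \<le> k" "k \<le> eval_int \<beta> h"
        by (cases x) simp
      then show "?f x \<in> ?L"
        using mem_neg by simp
    qed
  qed
qed

lemma card_inverted_translation:
  assumes h: "h \<in> chamber G" "h \<in> Q"
  shows "card (inverted (positive_affine_roots G) (translation G (- h))) = (\<Sum>\<beta>\<in>Pos. nat (eval_int \<beta> h))"
proof -
  have "inj_on (\<lambda>(\<beta>, k). aff G k (neg_fun \<beta>)) (SIGMA \<beta>:Pos. {1..eval_int \<beta> h})"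
  proof (rule inj_onI, clarify)
    fix \<beta> \<gamma> k l
    assume *: "\<beta> \<in> Pos" "\<gamma> \<in> Pos" "aff G k (neg_fun \<beta>) = aff G l (neg_fun \<gamma>)"
    then have "k = l \<and> neg_fun \<beta> = neg_fun \<gamma>"
      by (intro aff_inj) (simp_all add: neg_root Pos_iff)
    then show "\<beta> = \<gamma> \<and> k = l"
      by (metis neg_fun_neg_fun)
  qed
  then show ?thesis
    unfolding inverted_translation[OF h] by (simp add: card_image card_SigmaI finite_Pos)
qed

lemma chamber_multiple:
  assumes "h \<in> chamber G" "0 < n"
  shows "of_nat n *\<^sub>R h \<in> chamber G"
proof -
  have V: "h \<in> V"
    using assms(1) by (simp add: chamber_def)
  have "simple_root G i (of_nat n *\<^sub>R h) = of_nat n * simple_root G i h" if "i \<in> {1..rk G}" for i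
    using root_scaleR[OF simple_root[OF that] V, of "of_nat n"] by simp
  then show ?thesis
    using assms by (simp add: chamber_def V_scaleR)
qed

lemma lattice_multiple: "h \<in> Q \<Longrightarrow> of_int m *\<^sub>R h \<in> Q"
  using lattice_add_multiple[OF lattice_zero, of h m] by simp


subsection \<open>Sequences and their associated roots\<close>

lemma reduced_seq: "reduced_sequence G \<rho> s \<Longrightarrow> affine.reduced (seq_word \<rho> s n)"
  using reduced_expression_affine by (cases "s \<le> n")
    (simp_all add: reduced_sequence_def seq_word_empty affine.reduced_def inverted_def)

lemma tau_eq:
  assumes "reduced_sequence G \<rho> 1"
  shows "tau G \<rho> j = simple_affine_root G (\<rho> j) \<circ> wseq G \<rho> 1 (j - 1)"
proof -
  have "set (seq_word \<rho> 1 (j - 1)) \<subseteq> {0..rk G}"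
    using reduced_seq[OF assms, of "j - 1"] by (simp add: affine.reduced_def)
  then have "bij (wseq G \<rho> 1 (j - 1))"
    unfolding wseq_def by (rule affine.bij_word)
  then show ?thesis
    by (simp add: tau_def weyl_act_def inv_inv_eq)
qed

lemma inverted_wseq:
  assumes "reduced_sequence G \<rho> 1"
  shows "inverted (positive_affine_roots G) (wseq G \<rho> 1 (int n)) = {tau G \<rho> j |j. 1 \<le> j \<and> j \<le> int n}"
proof (induction n)
  case 0
  have "inverted (positive_affine_roots G) (wseq G \<rho> 1 0) = {}"
    by (simp add: inverted_def wseq_def seq_word_empty)
  then show ?case
    by auto
next
  case (Suc n)
  have word: "seq_word \<rho> 1 (int (Suc n)) = \<rho> (int (Suc n)) # seq_word \<rho> 1 (int n)"
    by (subst seq_word_Cons) auto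
  have "inverted (positive_affine_roots G) (wseq G \<rho> 1 (int (Suc n)))
    = insert (simple_affine_root G (\<rho> (int (Suc n))) \<circ> wseq G \<rho> 1 (int n))
      (inverted (positive_affine_roots G) (wseq G \<rho> 1 (int n)))"
    unfolding wseq_def word
    by (rule affine.inverted_reduced_Cons) (use reduced_seq[OF assms, of "int (Suc n)"] word in simp)
  also have "simple_affine_root G (\<rho> (int (Suc n))) \<circ> wseq G \<rho> 1 (int n) = tau G \<rho> (int (Suc n))"
    unfolding tau_eq[OF assms] by simp
  finally have "inverted (positive_affine_roots G) (wseq G \<rho> 1 (int (Suc n)))
    = insert (tau G \<rho> (int (Suc n))) {tau G \<rho> j |j. 1 \<le> j \<and> j \<le> int n}"
    unfolding Suc.IH .
  also have "\<dots> = {tau G \<rho> j |j. 1 \<le> j \<and> j \<le> int (Suc n)}"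
  proof -
    have "1 \<le> j \<and> j \<le> int (Suc n) \<longleftrightarrow> j = int (Suc n) \<or> 1 \<le> j \<and> j \<le> int n" for j
      by auto
    then show ?thesis
      by auto
  qed
  finally show ?case .
qed

text \<open>The repetition of a reduced word for the translation. Its \<open>n\<close>-fold repetition has the translation
  by \<open>n h\<close> as its product, which has \<open>n\<close> times as many inversions, and initial parts of reduced words are
  reduced.\<close>

theorem periodic_sequence_exists:
  assumes h: "h \<in> chamber G" "h \<in> Q"
  shows "\<exists>\<rho>. lower_sequence G \<rho> \<and> has_period G \<rho> h"
proof -
  let ?P = "positive_affine_roots G"
  have "- h \<in> Q"
    using lattice_multiple[OF h(2), of "-1"] by simp
  then obtain v where "set v \<subseteq> {0..rk G}" "word_prod G v = translation G (- h)"
    using translation_word by blast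
  then obtain u where u: "affine.reduced u" "word_prod G u = translation G (- h)"
    using affine.reduced_word_exists[of v] by metis
  define l where "l = length u"
  have card_u: "(\<Sum>\<beta>\<in>Pos. nat (eval_int \<beta> h)) = l"
    using u card_inverted_translation[OF h] by (simp add: affine.reduced_def l_def)
  have l: "0 < l"
  proof -
    have "nat (eval_int \<theta> h) \<le> l"
      unfolding card_u[symmetric] using highest_Pos finite_Pos by (intro member_le_sum) auto
    then show ?thesis
      using eval_int_pos[OF highest_Pos h] by simp
  qed
  define \<rho> where "\<rho> j = rev u ! nat ((j - 1) mod int l)" for j :: int
  have period: "\<rho> (j + int l) = \<rho> j" for j
  proof -
    have "j + int l - 1 = (j - 1) + int l"
      by simp
    then show ?thesis
      unfolding \<rho>_def by (simp only: mod_add_self2)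
  qed
  have word_l: "seq_word \<rho> 1 (int l) = u"
  proof -
    have "map \<rho> [1..int l] = rev u"
      by (rule nth_equalityI) (auto simp: \<rho>_def l_def nat_mod_distrib)
    then show ?thesis
      by (simp add: seq_word_def rev_map[symmetric])
  qed
  have word_add: "seq_word \<rho> 1 (s + int l) = seq_word \<rho> 1 s @ u" if "0 \<le> s" for s
  proof -
    have "seq_word \<rho> 1 (s + int l) = seq_word \<rho> (1 + int l) (s + int l) @ seq_word \<rho> 1 (int l)"
      using that by (subst seq_word_append[of 1 "int l"]) (simp_all add: add.commute)
    then show ?thesis
      using seq_word_shift[of 1 s \<rho> "int l"] period word_l by simp
  qed
  have w_add: "wseq G \<rho> 1 (s + int l) = wseq G \<rho> 1 s \<circ> wseq G \<rho> 1 (int l)" if "0 \<le> s" for s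
    by (simp only: wseq_def word_add[OF that] word_l word_prod_append)
  have w_multiple: "wseq G \<rho> 1 (int n * int l) = translation G (- (of_nat n *\<^sub>R h))" for n
  proof (induction n)
    case 0
    then show ?case
      by (simp add: wseq_def seq_word_empty translation_zero)
  next
    case (Suc n)
    have eq: "int (Suc n) * int l = int n * int l + int l"
      by (simp add: algebra_simps)
    have "wseq G \<rho> 1 (int (Suc n) * int l) = wseq G \<rho> 1 (int n * int l) \<circ> wseq G \<rho> 1 (int l)"
      unfolding eq by (rule w_add) simp
    also have "\<dots> = translation G (- (of_nat n *\<^sub>R h)) \<circ> translation G (- h)"
      unfolding Suc.IH by (simp only: wseq_def word_l u(2))
    also have "\<dots> = translation G (- (of_nat n *\<^sub>R h) + - h)"
      using lattice_V[OF h(2)] by (intro translation_add[symmetric] V_uminus)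
    also have "- (of_nat n *\<^sub>R h) + - h = - (of_nat (Suc n) *\<^sub>R h)"
      by (simp add: algebra_simps)
    finally show ?case .
  qed
  have multiple: "of_nat n *\<^sub>R h \<in> chamber G" "of_nat n *\<^sub>R h \<in> Q" if "0 < n" for n
    using chamber_multiple[OF h(1) that] lattice_multiple[OF h(2), of "int n"] by simp_all
  have "set u \<subseteq> {0..rk G}"
    using u by (simp add: affine.reduced_def)
  then have letters: "\<rho> j \<in> {0..rk G}" for j
    using l nth_mem[of "nat ((j - 1) mod int l)" "rev u"] unfolding \<rho>_def by (auto simp: l_def nat_less_iff)
  have reduced_multiple: "affine.reduced (seq_word \<rho> 1 (int n * int l))" if "0 < n" for n
  proof -
    have "card (inverted ?P (wseq G \<rho> 1 (int n * int l))) = (\<Sum>\<beta>\<in>Pos. nat (eval_int \<beta> (of_nat n *\<^sub>R h)))"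
      unfolding w_multiple using multiple[OF that] by (rule card_inverted_translation)
    also have "\<dots> = (\<Sum>\<beta>\<in>Pos. n * nat (eval_int \<beta> h))"
      using h by (intro sum.cong) (auto simp: Pos_iff eval_int_multiple nat_mult_distrib)
    also have "\<dots> = n * l"
      by (simp add: sum_distrib_left[symmetric] card_u)
    also have "\<dots> = length (seq_word \<rho> 1 (int n * int l))"
      by (simp add: length_seq_word nat_mult_distrib)
    finally show ?thesis
      using letters by (auto simp: affine.reduced_def wseq_def seq_word_def)
  qed
  have below: "\<exists>v. seq_word \<rho> 1 (int n * int l) = v @ seq_word \<rho> 1 (int n)" for n
  proof -
    have "int n * 1 \<le> int n * int l"
      using l by (intro mult_left_mono) auto
    then show ?thesis
      by (subst seq_word_append[of 1 "int n"]) auto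
  qed
  have red: "reduced_sequence G \<rho> 1"
    unfolding reduced_sequence_def reduced_expression_affine
  proof (intro allI impI)
    fix n :: int assume "1 \<le> n"
    then obtain m where m: "n = int m" "0 < m"
      by (metis nonneg_int_cases of_nat_0_less_iff zero_less_one order_less_le_trans order_less_imp_le)
    then show "affine.reduced (seq_word \<rho> 1 n)"
      using below[of m] reduced_multiple[of m] affine.reduced_append_right by metis
  qed
  have inv_l: "inv (wseq G \<rho> 1 (int l)) = translation G h"
    using inv_translation[OF lattice_V[OF h(2)]] by (simp add: wseq_def word_l u(2))
  have has: "has_period G \<rho> h"
    unfolding has_period_def using h(2) l inv_l w_add by (intro conjI exI[of _ "int l"]) auto
  have "{tau G \<rho> j |j. 1 \<le> j} = {aff G k (neg_fun \<alpha>) |k \<alpha>. \<alpha> \<in> Pos \<and> 1 \<le> k}" (is "?T = ?A")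
  proof
    show "?T \<subseteq> ?A"
    proof
      fix \<beta> assume "\<beta> \<in> ?T"
      then obtain j where j: "\<beta> = tau G \<rho> j" "1 \<le> j"
        by blast
      then obtain n where n: "j = int n" "0 < n"
        by (metis nonneg_int_cases of_nat_0_less_iff zero_less_one order_less_le_trans order_less_imp_le)
      have "\<beta> \<in> inverted ?P (wseq G \<rho> 1 (int n))"
        unfolding inverted_wseq[OF red] using j n by blast
      also have "inverted ?P (wseq G \<rho> 1 (int n)) \<subseteq> inverted ?P (wseq G \<rho> 1 (int n * int l))"
        using below[of n] reduced_multiple[OF n(2)] affine.inverted_append_mono unfolding wseq_def by metis
      also have "\<dots> = (\<lambda>(\<beta>, k). aff G k (neg_fun \<beta>)) ` (SIGMA \<beta>:Pos. {1..eval_int \<beta> (of_nat n *\<^sub>R h)})"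
        unfolding w_multiple using multiple[OF n(2)] by (rule inverted_translation)
      finally obtain k \<alpha> where "\<beta> = aff G k (neg_fun \<alpha>)" "\<alpha> \<in> Pos" "1 \<le> k"
        by auto
      then show "\<beta> \<in> ?A"
        by blast
    qed
    show "?A \<subseteq> ?T"
    proof
      fix \<beta> assume "\<beta> \<in> ?A"
      then obtain k \<alpha> where \<alpha>: "\<beta> = aff G k (neg_fun \<alpha>)" "\<alpha> \<in> Pos" "1 \<le> k"
        by blast
      then obtain n where n: "k = int n" "0 < n"
        by (metis nonneg_int_cases of_nat_0_less_iff zero_less_one order_less_le_trans order_less_imp_le)
      have "int n * 1 \<le> int n * eval_int \<alpha> h"
        using eval_int_pos[OF \<alpha>(2) h] by (intro mult_left_mono) auto
      then have "k \<le> eval_int \<alpha> (of_nat n *\<^sub>R h)"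
        using \<alpha> h n by (simp add: eval_int_multiple Pos_iff)
      then have "\<beta> \<in> inverted ?P (translation G (- (of_nat n *\<^sub>R h)))"
        unfolding inverted_translation[OF multiple[OF n(2)]] using \<alpha>
        by (intro image_eqI[of _ _ "(\<alpha>, k)"]) auto
      then have "\<beta> \<in> inverted ?P (wseq G \<rho> 1 (int (n * l)))"
        using w_multiple[of n] by simp
      then show "\<beta> \<in> ?T"
        unfolding inverted_wseq[OF red] by blast
    qed
  qed
  then have "lower_sequence G \<rho>"
    unfolding lower_sequence_def affine_periodic_def using red has by blast
  then show ?thesis
    using has by blast
qed


section \<open>Prepending the longest element\<close>

text \<open>The finite simple roots have level 0, so reflecting in them does not change the level \<open>k\<close>.\<close>

lemma aff_finite_word:
  assumes "set u \<subseteq> {1..rk G}" "\<alpha> \<in> R"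
  shows "\<exists>\<gamma>\<in>R. \<forall>k. aff G k \<alpha> \<circ> word_prod G u = aff G k \<gamma>"
  using assms
proof (induction u arbitrary: \<alpha>)
  case Nil
  then show ?case
    by (intro bexI[of _ \<alpha>]) simp_all
next
  case (Cons i u)
  then have i: "i \<le> rk G" "level i = 0"
    by (auto simp: level_def)
  have "\<exists>\<gamma>\<in>R. \<forall>k. aff G k (reflect (dir i) \<alpha>) \<circ> word_prod G u = aff G k \<gamma>"
    using Cons.prems reflect_root[OF dir_root[OF i(1)], of \<alpha>] by (intro Cons.IH) simp_all
  then obtain \<gamma> where \<gamma>: "\<gamma> \<in> R" "\<And>k. aff G k (reflect (dir i) \<alpha>) \<circ> word_prod G u = aff G k \<gamma>"
    by blast
  have "aff G k \<alpha> \<circ> word_prod G (i # u) = aff G k \<gamma>" for k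
    using \<gamma>(2)[of k] aff_simple_reflection[OF i(1) Cons.prems(2), of k] i(2)
    by (simp add: word_prod_Cons comp_assoc[symmetric])
  then show ?case
    using \<gamma>(1) by blast
qed

text \<open>No simple reflection lengthens the longest element, so its inverse makes every simple root
  negative; by additivity it does so with every positive root.\<close>

lemma longest_negates:
  assumes u: "spherical.reduced u" and longest: "is_longest_element G (word_prod G u)" and \<alpha>: "\<alpha> \<in> Pos"
  shows "aff G 0 \<alpha> \<circ> word_prod G u \<notin> positive_affine_roots G"
proof -
  have letters: "set u \<subseteq> {1..rk G}"
    using u by (rule spherical.reduced_letters)
  have simple: "aff G 0 (simple_root G j) \<circ> word_prod G u \<notin> positive_affine_roots G"
    if j: "j \<in> {1..rk G}" for j
  proof
    assume "aff G 0 (simple_root G j) \<circ> word_prod G u \<in> positive_affine_roots G"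
    moreover have "simple_affine_root G j = aff G 0 (simple_root G j)"
      using j by (simp add: simple_affine_root_def)
    ultimately have ju: "spherical.reduced (j # u)"
      using spherical.reduced_Cons[OF j u] by simp
    then have "word_prod G (j # u) \<in> finite_weyl_group G"
      by (intro word_finite_weyl spherical.reduced_letters)
    then have "weyl_length G {1..rk G} (word_prod G (j # u)) \<le> weyl_length G {1..rk G} (word_prod G u)"
      using longest by (simp only: is_longest_element_def)
    then show False
      using ju u unfolding weyl_length_eq_word_length spherical.reduced_iff by simp
  qed
  have "\<exists>\<gamma>\<in>R. aff G 0 (simple_root G i) \<circ> word_prod G u = aff G 0 \<gamma> \<and> height \<gamma> \<le> 0"
    if i: "i \<in> {1..rk G}" for i
  proof -
    obtain \<gamma> where \<gamma>: "\<gamma> \<in> R" "\<And>k. aff G k (simple_root G i) \<circ> word_prod G u = aff G k \<gamma>"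
      using aff_finite_word[OF letters simple_root[OF i]] by blast
    then have "\<gamma> \<notin> Pos"
      using simple[OF i] by (simp add: aff_pos_iff apos_def)
    then show ?thesis
      using \<gamma> Pos_iff_height by (intro bexI[of _ \<gamma>]) auto
  qed
  then obtain g where g: "\<And>i. i \<in> {1..rk G} \<Longrightarrow> g i \<in> R"
    "\<And>i. i \<in> {1..rk G} \<Longrightarrow> aff G 0 (simple_root G i) \<circ> word_prod G u = aff G 0 (g i)"
    "\<And>i. i \<in> {1..rk G} \<Longrightarrow> height (g i) \<le> 0"
    by metis
  obtain \<gamma> where \<gamma>: "\<gamma> \<in> R" "\<And>k. aff G k \<alpha> \<circ> word_prod G u = aff G k \<gamma>"
    using aff_finite_word[OF letters, of \<alpha>] \<alpha> unfolding Pos_iff by blast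
  obtain n :: "nat \<Rightarrow> nat" where n: "\<alpha> = simple_comb G (\<lambda>i. of_nat (n i))"
    using \<alpha> Pos_iff by (metis combE)
  have add: "aff G 0 \<alpha> y = (\<Sum>i=1..rk G. of_nat (n i) * aff G 0 (simple_root G i) y)" for y
    by (subst n) (simp add: aff_def simple_comb_def)
  have at: "aff G 0 \<beta> height_point = of_int (height \<beta>)" if "\<beta> \<in> R" for \<beta>
    using that by (simp add: aff_def height_point_V height_eq)
  have "(of_int (height \<gamma>) :: complex) = (aff G 0 \<alpha> \<circ> word_prod G u) height_point"
    using \<gamma> at by simp
  also have "\<dots> = (\<Sum>i=1..rk G. of_nat (n i) * (aff G 0 (simple_root G i) \<circ> word_prod G u) height_point)"
    by (simp add: add)
  also have "\<dots> = (\<Sum>i=1..rk G. of_nat (n i) * of_int (height (g i)))"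
    using g at by (intro sum.cong) simp_all
  also have "\<dots> = of_int (\<Sum>i=1..rk G. int (n i) * height (g i))"
    by simp
  finally have "height \<gamma> = (\<Sum>i=1..rk G. int (n i) * height (g i))"
    by (simp only: of_int_eq_iff)
  also have "\<dots> \<le> 0"
    using g by (intro sum_nonpos mult_nonneg_nonpos) auto
  finally have "\<gamma> \<notin> Pos"
    using Pos_height by fastforce
  then show ?thesis
    using \<gamma> by (simp add: aff_pos_iff apos_def)
qed

text \<open>The inversions of \<open>w\<^sub>n w\<^sub>0\<^sup>-\<^sup>1\<close> are found by exhibiting as many of them as the word has letters: the set
  \<open>A\<close> of positive roots of level 0 and the set \<open>B n\<close> of the images under \<open>w\<^sub>0\<close> of the inversions of \<open>w\<^sub>n\<close>.
  The set \<open>A\<close> has as many elements as \<open>w\<^sub>0\<close> has letters, since it consists of the roots inverted by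
  \<open>w\<^sub>0\<close> and also of those inverted by its inverse.\<close>

lemma longest_prefix:
  assumes lower: "lower_sequence G \<rho>"
    and u0: "spherical.reduced (map \<rho> [- int N..0])"
    and longest: "is_longest_element G (word_prod G (map \<rho> [- int N..0]))"
  shows "reduced_sequence G \<rho> (- int N)"
    and "(\<Union>n\<in>{- int N..}. inversions G (wseq G \<rho> (- int N) n)) = {aff G k \<alpha> |k \<alpha>. \<alpha> \<in> Pos \<and> 0 \<le> k}"
proof -
  let ?P = "positive_affine_roots G"
  define u where "u = map \<rho> [- int N..0]"
  define w where "w = word_prod G u"
  define v where "v = word_prod G (rev u)"
  define A where "A = (\<lambda>\<alpha>. aff G 0 \<alpha>) ` Pos"
  have red_u: "spherical.reduced u"
    using u0 by (simp only: u_def)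
  then have letters: "set u \<subseteq> {1..rk G}"
    by (rule spherical.reduced_letters)
  have red: "reduced_sequence G \<rho> 1"
    and taus: "{tau G \<rho> j |j. 1 \<le> j} = {aff G k (neg_fun \<alpha>) |k \<alpha>. \<alpha> \<in> Pos \<and> 1 \<le> k}"
    using lower by (simp_all add: lower_sequence_def)
  have len: "length u = Suc N"
    by (simp add: u_def)
  have wv: "w \<circ> v = id" "v \<circ> w = id"
    using spherical.word_rev[OF letters] spherical.word_rev'[OF letters] by (simp_all add: w_def v_def)
  have inv: "inv w = v" "inv v = w"
    using inv_unique_comp wv by metis+
  have cancel: "\<beta> \<circ> w \<circ> v = \<beta>" "\<beta> \<circ> v \<circ> w = \<beta>" for \<beta> :: "'k cplx \<Rightarrow> complex"
    using wv by (simp_all add: comp_assoc)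
  have w_neg: "aff G 0 \<alpha> \<circ> w \<notin> ?P" if "\<alpha> \<in> Pos" for \<alpha>
    unfolding w_def using red_u longest that by (intro longest_negates) (simp_all add: u_def)
  have w_aff: "\<exists>\<gamma>\<in>R. \<forall>k. aff G k \<alpha> \<circ> w = aff G k \<gamma>" if "\<alpha> \<in> R" for \<alpha>
    unfolding w_def using letters that by (rule aff_finite_word)
  have v_aff: "\<exists>\<gamma>\<in>R. \<forall>k. aff G k \<alpha> \<circ> v = aff G k \<gamma>" if "\<alpha> \<in> R" for \<alpha>
    unfolding v_def using letters that by (intro aff_finite_word) simp_all
  have v_lower: "\<exists>\<gamma>\<in>Pos. \<forall>k. aff G k (neg_fun \<alpha>) \<circ> v = aff G k \<gamma>" if \<alpha>: "\<alpha> \<in> Pos" for \<alpha>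
  proof -
    have \<alpha>R: "\<alpha> \<in> R"
      using \<alpha> by (simp add: Pos_iff)
    obtain \<gamma> where \<gamma>: "\<gamma> \<in> R" "\<And>k. aff G k (neg_fun \<alpha>) \<circ> v = aff G k \<gamma>"
      using v_aff[OF neg_root[OF \<alpha>R]] by blast
    have "\<gamma> \<in> Pos"
    proof (rule ccontr)
      assume "\<gamma> \<notin> Pos"
      then have "aff G 0 (neg_fun \<gamma>) \<circ> w \<notin> ?P"
        using w_neg neg_Pos_iff \<gamma>(1) by blast
      moreover have "aff G 0 (neg_fun \<gamma>) \<circ> w = neg_fun (aff G 0 \<gamma> \<circ> w)"
        using aff_neg[of 0 \<gamma>] by (simp add: neg_fun_comp[symmetric])
      moreover have "aff G 0 \<gamma> \<circ> w = aff G 0 (neg_fun \<alpha>)"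
        using \<gamma>(2)[of 0, symmetric] cancel by simp
      ultimately show False
        using \<alpha> \<alpha>R by (simp add: aff_neg aff_pos_iff apos_def)
    qed
    then show ?thesis
      using \<gamma>(2) by blast
  qed
  have v_upper: "\<exists>\<gamma>\<in>Pos. \<forall>k. aff G k \<alpha> = aff G k (neg_fun \<gamma>) \<circ> v" if \<alpha>: "\<alpha> \<in> Pos" for \<alpha>
  proof -
    have \<alpha>R: "\<alpha> \<in> R"
      using \<alpha> by (simp add: Pos_iff)
    obtain \<gamma> where \<gamma>: "\<gamma> \<in> R" "\<And>k. aff G k \<alpha> \<circ> w = aff G k \<gamma>"
      using w_aff[OF \<alpha>R] by blast
    have "\<gamma> \<notin> Pos"
      using w_neg[OF \<alpha>] \<gamma> by (simp add: aff_pos_iff apos_def)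
    then have "neg_fun \<gamma> \<in> Pos"
      using neg_Pos_iff \<gamma>(1) by blast
    moreover have "aff G k \<alpha> = aff G k (neg_fun (neg_fun \<gamma>)) \<circ> v" for k
      using \<gamma>(2)[of k, symmetric] cancel by simp
    ultimately show ?thesis
      by blast
  qed
  have finite_A: "finite A"
    using finite_Pos by (simp add: A_def)
  have card_A: "card A = Suc N"
  proof (rule antisym)
    have "A \<subseteq> inverted ?P v"
      using w_neg by (auto simp: A_def inverted_def inv aff_pos_iff Pos_iff apos_def)
    then have "card A \<le> card (inverted ?P v)"
      unfolding v_def using spherical.finite_inverted[of "rev u"] letters by (intro card_mono) auto
    also have "\<dots> \<le> Suc N"
      unfolding v_def using spherical.card_inverted_le[of "rev u"] letters len by simp
    finally show "card A \<le> Suc N" .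
    have "inverted ?P w \<subseteq> A"
    proof
      fix \<beta> assume "\<beta> \<in> inverted ?P w"
      then obtain k \<alpha> where \<alpha>: "\<beta> = aff G k \<alpha>" "\<alpha> \<in> R" "apos k \<alpha>" "aff G k \<alpha> \<circ> v \<notin> ?P"
        by (auto simp: inverted_def inv positive_affine_roots_eq)
      obtain \<gamma> where "\<gamma> \<in> R" "aff G k \<alpha> \<circ> v = aff G k \<gamma>"
        using v_aff[OF \<alpha>(2)] by blast
      then have "k = 0"
        using \<alpha> by (auto simp: aff_pos_iff apos_def)
      then show "\<beta> \<in> A"
        using \<alpha> by (auto simp: A_def apos_def)
    qed
    then have "card (inverted ?P w) \<le> card A"
      using finite_A by (intro card_mono)
    then show "Suc N \<le> card A"
      using spherical.reduced_card[OF red_u] len by (simp add: w_def)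
  qed
  define B where "B n = (\<lambda>\<beta>. \<beta> \<circ> v) ` inverted ?P (wseq G \<rho> 1 (int n))" for n
  have main: "affine.reduced (seq_word \<rho> (- int N) (int n)) \<and>
      inverted ?P (wseq G \<rho> (- int N) (int n)) = A \<union> B n" for n
  proof -
    define t where "t = seq_word \<rho> 1 (int n)"
    have t: "affine.reduced t" "set t \<subseteq> {0..rk G}"
      using reduced_seq[OF red, of "int n"] by (simp_all add: t_def affine.reduced_def)
    have inverted_t: "inverted ?P (word_prod G t) = {tau G \<rho> j |j. 1 \<le> j \<and> j \<le> int n}"
      using inverted_wseq[OF red, of n] by (simp add: t_def wseq_def)
    have lower_form: "\<exists>k \<alpha>. \<beta> = aff G k (neg_fun \<alpha>) \<and> \<alpha> \<in> Pos \<and> 1 \<le> k"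
      if "\<beta> \<in> inverted ?P (word_prod G t)" for \<beta>
    proof -
      have "\<beta> \<in> {tau G \<rho> j |j. 1 \<le> j}"
        using that unfolding inverted_t by blast
      then show ?thesis
        unfolding taus by blast
    qed
    have word: "seq_word \<rho> (- int N) (int n) = t @ rev u"
      using seq_word_append[of "- int N" 0 "int n" \<rho>] by (simp add: t_def u_def seq_word_def rev_map)
    have set_word: "set (t @ rev u) \<subseteq> {0..rk G}"
      using t(2) letters by auto
    have inv_word: "inv (word_prod G (t @ rev u)) = w \<circ> inv (word_prod G t)"
      using affine.inv_word[OF set_word] affine.inv_word[OF t(2)] by (simp add: word_prod_append w_def)
    have sub_A: "A \<subseteq> inverted ?P (word_prod G (t @ rev u))"
    proof
      fix \<beta> assume "\<beta> \<in> A"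
      then obtain \<alpha> where \<alpha>: "\<beta> = aff G 0 \<alpha>" "\<alpha> \<in> Pos"
        by (auto simp: A_def)
      obtain \<gamma> where \<gamma>: "\<gamma> \<in> R" "\<And>k. aff G k \<alpha> \<circ> w = aff G k \<gamma>"
        using w_aff[of \<alpha>] \<alpha> by (auto simp: Pos_iff)
      have "neg_fun \<gamma> \<in> Pos"
        using w_neg[OF \<alpha>(2)] \<gamma> neg_Pos_iff by (simp add: aff_pos_iff apos_def)
      then have pos: "aff G 0 (neg_fun \<gamma>) \<in> ?P"
        by (simp add: aff_pos_iff apos_def Pos_iff)
      have "aff G 0 (neg_fun \<gamma>) \<notin> inverted ?P (word_prod G t)"
      proof
        assume "aff G 0 (neg_fun \<gamma>) \<in> inverted ?P (word_prod G t)"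
        then obtain k \<delta> where "aff G 0 (neg_fun \<gamma>) = aff G k (neg_fun \<delta>)" "\<delta> \<in> Pos" "1 \<le> k"
          using lower_form by blast
        then show False
          using aff_inj[of "neg_fun \<gamma>" "neg_fun \<delta>" 0 k] \<gamma>(1) neg_root by (simp add: Pos_iff)
      qed
      then have "neg_fun (aff G 0 \<gamma> \<circ> inv (word_prod G t)) \<in> ?P"
        using pos by (simp add: inverted_def neg_fun_comp[symmetric] aff_neg)
      moreover have "aff G 0 \<gamma> \<circ> inv (word_prod G t) \<in> affine_roots G"
        using affine.word_stable[of "rev t"] affine.inv_word[OF t(2)] t(2) aff_affine_root[OF \<gamma>(1)] by simp
      ultimately have "aff G 0 \<gamma> \<circ> inv (word_prod G t) \<notin> ?P"
        using affine.sign by blast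
      then show "\<beta> \<in> inverted ?P (word_prod G (t @ rev u))"
        using \<alpha> \<gamma>(2)[of 0] by (simp add: inverted_def inv_word comp_assoc[symmetric] aff_pos_iff Pos_iff apos_def)
    qed
    have B_n: "B n = (\<lambda>\<beta>. \<beta> \<circ> v) ` inverted ?P (word_prod G t)"
      by (simp add: B_def wseq_def t_def)
    have sub_B: "B n \<subseteq> inverted ?P (word_prod G (t @ rev u))" and disjoint: "A \<inter> B n = {}"
    proof -
      have "\<beta> \<circ> v \<in> inverted ?P (word_prod G (t @ rev u)) \<and> \<beta> \<circ> v \<notin> A"
        if \<beta>: "\<beta> \<in> inverted ?P (word_prod G t)" for \<beta>
      proof -
        obtain k \<alpha> where \<alpha>: "\<beta> = aff G k (neg_fun \<alpha>)" "\<alpha> \<in> Pos" "1 \<le> k"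
          using lower_form[OF \<beta>] by blast
        obtain \<gamma> where \<gamma>: "\<gamma> \<in> Pos" "\<beta> \<circ> v = aff G k \<gamma>"
          using v_lower[OF \<alpha>(2)] \<alpha>(1) by blast
        have "\<beta> \<circ> v \<in> ?P"
          using \<gamma> \<alpha>(3) by (simp add: aff_pos_iff Pos_iff apos_def)
        moreover have "\<beta> \<circ> v \<circ> (w \<circ> inv (word_prod G t)) \<notin> ?P"
          using \<beta> cancel(2)[of \<beta>] by (simp add: inverted_def comp_assoc[symmetric])
        moreover have "\<beta> \<circ> v \<notin> A"
        proof
          assume "\<beta> \<circ> v \<in> A"
          then obtain \<delta> where "aff G k \<gamma> = aff G 0 \<delta>" "\<delta> \<in> Pos"
            using \<gamma>(2) by (auto simp: A_def)
          then show False
            using aff_inj[of \<gamma> \<delta> k 0] \<gamma>(1) \<alpha>(3) by (simp add: Pos_iff)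
        qed
        ultimately show ?thesis
          by (simp add: inverted_def inv_word)
      qed
      then show "B n \<subseteq> inverted ?P (word_prod G (t @ rev u))" "A \<inter> B n = {}"
        unfolding B_n by blast+
    qed
    have fin_t: "finite (inverted ?P (word_prod G t))"
      using t(2) by (rule affine.finite_inverted)
    have "inj_on (\<lambda>\<beta>. \<beta> \<circ> v) (inverted ?P (word_prod G t))"
      by (rule inj_on_inverseI[of _ "\<lambda>\<beta>. \<beta> \<circ> w"]) (rule cancel)
    then have "card (B n) = length t"
      unfolding B_n using t(1) by (simp add: card_image affine.reduced_def)
    moreover have "finite (B n)"
      unfolding B_n using fin_t by simp
    ultimately have card: "card (A \<union> B n) = length (t @ rev u)"
      using card_A finite_A disjoint len by (simp add: card_Un_disjoint)
    have fin: "finite (inverted ?P (word_prod G (t @ rev u)))"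
      using set_word by (rule affine.finite_inverted)
    have le: "card (inverted ?P (word_prod G (t @ rev u))) \<le> length (t @ rev u)"
      using set_word by (rule affine.card_inverted_le)
    have sub: "A \<union> B n \<subseteq> inverted ?P (word_prod G (t @ rev u))"
      using sub_A sub_B by blast
    have eq: "A \<union> B n = inverted ?P (word_prod G (t @ rev u))"
      using fin sub card_mono[OF fin sub] card le by (intro card_subset_eq) simp_all
    then show ?thesis
      using card set_word unfolding wseq_def word affine.reduced_def by simp
  qed
  have prefix: "\<exists>x. seq_word \<rho> (- int N) 0 = x @ seq_word \<rho> (- int N) n" if "- int N \<le> n" "n < 0" for n
    using that by (subst seq_word_append[of _ n]) auto
  have reduced: "affine.reduced (seq_word \<rho> (- int N) n)" if "- int N \<le> n" for n
  proof (cases "0 \<le> n")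
    case True
    then show ?thesis
      using main[of "nat n"] by simp
  next
    case False
    then show ?thesis
      using prefix[OF that] main[of 0] affine.reduced_append_right by (metis of_nat_0 not_le)
  qed
  then show "reduced_sequence G \<rho> (- int N)"
    by (simp add: reduced_sequence_def reduced_expression_affine)
  have inversions: "inversions G (wseq G \<rho> (- int N) n) = inverted ?P (wseq G \<rho> (- int N) n)"
    if "- int N \<le> n" for n
    unfolding wseq_def using reduced[OF that] by (intro inversions_eq_inverted) (simp add: affine.reduced_def)
  have "(\<Union>n\<in>{- int N..}. inversions G (wseq G \<rho> (- int N) n)) = (\<Union>n. A \<union> B n)"
  proof
    show "(\<Union>n\<in>{- int N..}. inversions G (wseq G \<rho> (- int N) n)) \<subseteq> (\<Union>n. A \<union> B n)"
    proof (rule UN_least)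
      fix n assume n: "n \<in> {- int N..}"
      have "inverted ?P (wseq G \<rho> (- int N) n) \<subseteq> A \<union> B (nat n)"
      proof (cases "0 \<le> n")
        case True
        then show ?thesis
          using main[of "nat n"] by simp
      next
        case False
        then have "inverted ?P (wseq G \<rho> (- int N) n) \<subseteq> inverted ?P (wseq G \<rho> (- int N) 0)"
          using prefix[of n] n main[of 0] affine.inverted_append_mono unfolding wseq_def
          by (metis atLeast_iff of_nat_0 not_le)
        then show ?thesis
          using main[of 0] False by simp
      qed
      then show "inversions G (wseq G \<rho> (- int N) n) \<subseteq> (\<Union>n. A \<union> B n)"
        using inversions n by (simp only: atLeast_iff) blast
    qed
    show "(\<Union>n. A \<union> B n) \<subseteq> (\<Union>n\<in>{- int N..}. inversions G (wseq G \<rho> (- int N) n))"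
    proof (rule UN_least)
      fix n
      have "A \<union> B n = inversions G (wseq G \<rho> (- int N) (int n))"
        using main[of n] inversions[of "int n"] by simp
      then show "A \<union> B n \<subseteq> (\<Union>n\<in>{- int N..}. inversions G (wseq G \<rho> (- int N) n))"
        by (simp only:) (rule UN_upper, simp)
    qed
  qed
  also have "(\<Union>n. A \<union> B n) = A \<union> (\<lambda>\<beta>. \<beta> \<circ> v) ` {tau G \<rho> j |j. 1 \<le> j}"
  proof -
    have "(\<Union>n. {tau G \<rho> j |j. 1 \<le> j \<and> j \<le> int n}) = {tau G \<rho> j |j. 1 \<le> j}"
    proof
      show "{tau G \<rho> j |j. 1 \<le> j} \<subseteq> (\<Union>n. {tau G \<rho> j |j. 1 \<le> j \<and> j \<le> int n})"
      proof
        fix \<beta> assume "\<beta> \<in> {tau G \<rho> j |j. 1 \<le> j}"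
        then obtain j where "\<beta> = tau G \<rho> j" "1 \<le> j" "j \<le> int (nat j)"
          by auto
        then show "\<beta> \<in> (\<Union>n. {tau G \<rho> j |j. 1 \<le> j \<and> j \<le> int n})"
          by blast
      qed
    qed blast
    then show ?thesis
      unfolding B_def inverted_wseq[OF red] by (simp add: image_UN[symmetric])
  qed
  also have "(\<lambda>\<beta>. \<beta> \<circ> v) ` {tau G \<rho> j |j. 1 \<le> j} = {aff G k \<alpha> |k \<alpha>. \<alpha> \<in> Pos \<and> 1 \<le> k}"
    unfolding taus
  proof
    show "(\<lambda>\<beta>. \<beta> \<circ> v) ` {aff G k (neg_fun \<alpha>) |k \<alpha>. \<alpha> \<in> Pos \<and> 1 \<le> k} \<subseteq> {aff G k \<alpha> |k \<alpha>. \<alpha> \<in> Pos \<and> 1 \<le> k}"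
    proof (rule image_subsetI)
      fix \<beta> assume "\<beta> \<in> {aff G k (neg_fun \<alpha>) |k \<alpha>. \<alpha> \<in> Pos \<and> 1 \<le> k}"
      then obtain k \<alpha> where "\<beta> = aff G k (neg_fun \<alpha>)" "\<alpha> \<in> Pos" "1 \<le> k"
        by blast
      moreover from this obtain \<gamma> where "\<gamma> \<in> Pos" "\<beta> \<circ> v = aff G k \<gamma>"
        using v_lower by blast
      ultimately show "\<beta> \<circ> v \<in> {aff G k \<alpha> |k \<alpha>. \<alpha> \<in> Pos \<and> 1 \<le> k}"
        by blast
    qed
    show "{aff G k \<alpha> |k \<alpha>. \<alpha> \<in> Pos \<and> 1 \<le> k} \<subseteq> (\<lambda>\<beta>. \<beta> \<circ> v) ` {aff G k (neg_fun \<alpha>) |k \<alpha>. \<alpha> \<in> Pos \<and> 1 \<le> k}"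
    proof
      fix \<beta> assume "\<beta> \<in> {aff G k \<alpha> |k \<alpha>. \<alpha> \<in> Pos \<and> 1 \<le> k}"
      then obtain k \<alpha> where "\<beta> = aff G k \<alpha>" "\<alpha> \<in> Pos" "1 \<le> k"
        by blast
      moreover from this obtain \<gamma> where "\<gamma> \<in> Pos" "\<beta> = aff G k (neg_fun \<gamma>) \<circ> v"
        using v_upper by blast
      ultimately show "\<beta> \<in> (\<lambda>\<beta>. \<beta> \<circ> v) ` {aff G k (neg_fun \<alpha>) |k \<alpha>. \<alpha> \<in> Pos \<and> 1 \<le> k}"
        by (intro image_eqI) blast+
    qed
  qed
  also have "A \<union> {aff G k \<alpha> |k \<alpha>. \<alpha> \<in> Pos \<and> 1 \<le> k} = {aff G k \<alpha> |k \<alpha>. \<alpha> \<in> Pos \<and> 0 \<le> k}"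
  proof
    show "A \<union> {aff G k \<alpha> |k \<alpha>. \<alpha> \<in> Pos \<and> 1 \<le> k} \<subseteq> {aff G k \<alpha> |k \<alpha>. \<alpha> \<in> Pos \<and> 0 \<le> k}"
      unfolding A_def by fastforce
    show "{aff G k \<alpha> |k \<alpha>. \<alpha> \<in> Pos \<and> 0 \<le> k} \<subseteq> A \<union> {aff G k \<alpha> |k \<alpha>. \<alpha> \<in> Pos \<and> 1 \<le> k}"
    proof
      fix \<beta> assume "\<beta> \<in> {aff G k \<alpha> |k \<alpha>. \<alpha> \<in> Pos \<and> 0 \<le> k}"
      then obtain k \<alpha> where "\<beta> = aff G k \<alpha>" "\<alpha> \<in> Pos" "k = 0 \<or> 1 \<le> k"
        by fastforce
      then show "\<beta> \<in> A \<union> {aff G k \<alpha> |k \<alpha>. \<alpha> \<in> Pos \<and> 1 \<le> k}"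
        unfolding A_def by blast
    qed
  qed
  finally show "(\<Union>n\<in>{- int N..}. inversions G (wseq G \<rho> (- int N) n)) = {aff G k \<alpha> |k \<alpha>. \<alpha> \<in> Pos \<and> 0 \<le> k}" .
qed

end

section \<open>Spans in the loop algebra\<close>

lemma loop_span_monomials:
  "loop_span {Poly_Mapping.single k x |k x. m \<le> k \<and> x \<in> B} = loops_from m (cspan B)" (is "loop_span ?M = _")
proof
  have "lvec.subspace (loops_from m (cspan B))"
    unfolding lvec.subspace_def loops_from_def
    by (auto simp: lookup_add cvec.span_zero cvec.span_add cvec.span_scale)
  moreover have "?M \<subseteq> loops_from m (cspan B)"
    by (auto simp: loops_from_def lookup_single when_def cvec.span_base cvec.span_zero)
  ultimately show "loop_span ?M \<subseteq> loops_from m (cspan B)"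
    by (rule lvec.span_minimal[rotated])
  show "loops_from m (cspan B) \<subseteq> loop_span ?M"
  proof
    fix f assume f: "f \<in> loops_from m (cspan B)"
    have monomial: "Poly_Mapping.single k x \<in> loop_span ?M" if "m \<le> k" "x \<in> cspan B" for k x
      using that(2)
    proof (induction rule: cvec.span_induct)
      case base
      have add: "Poly_Mapping.single k (x + y) = Poly_Mapping.single k x + Poly_Mapping.single k y" for x y :: "'a cplx"
        by (simp add: single_add)
      have scale: "Poly_Mapping.single k (cscale c x) = loop_scale c (Poly_Mapping.single k x)" for c and x :: "'a cplx"
        by (rule poly_mapping_eqI) (simp add: lookup_single when_def)
      show ?case
        unfolding cvec.subspace_def by (auto simp: add scale lvec.span_zero lvec.span_add lvec.span_scale)
    next
      case (step x)
      then show ?case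
        using that(1) by (intro lvec.span_base) blast
    qed
    have "f = (\<Sum>k\<in>Poly_Mapping.keys f. Poly_Mapping.single k (Poly_Mapping.lookup f k))"
    proof (rule poly_mapping_eqI)
      fix j
      have "Poly_Mapping.lookup (\<Sum>k\<in>Poly_Mapping.keys f. Poly_Mapping.single k (Poly_Mapping.lookup f k)) j
        = (\<Sum>k\<in>Poly_Mapping.keys f. if k = j then Poly_Mapping.lookup f k else 0)"
        by (simp add: lookup_sum lookup_single when_def)
      then show "Poly_Mapping.lookup f j = Poly_Mapping.lookup (\<Sum>k\<in>Poly_Mapping.keys f. Poly_Mapping.single k (Poly_Mapping.lookup f k)) j"
        by (simp add: sum.delta in_keys_iff)
    qed
    also have "\<dots> \<in> loop_span ?M"
    proof (intro lvec.span_sum monomial)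
      fix k assume "k \<in> Poly_Mapping.keys f"
      then show "m \<le> k" "Poly_Mapping.lookup f k \<in> cspan B"
        using f by (auto simp: loops_from_def in_keys_iff not_less[symmetric])
    qed
    finally show "f \<in> loop_span ?M" .
  qed
qed

context root_datum
begin

lemma affine_root_spaces_union:
  assumes "D \<subseteq> R"
  shows "(\<Union>\<beta>\<in>{aff G k \<alpha> |k \<alpha>. \<alpha> \<in> D \<and> m \<le> k}. affine_root_space G \<beta>)
    = {Poly_Mapping.single k x |k x. m \<le> k \<and> x \<in> (\<Union>\<alpha>\<in>D. root_space G \<alpha>)}" (is "?L = ?M")
proof
  show "?L \<subseteq> ?M"
  proof
    fix f assume "f \<in> ?L"
    then obtain k \<alpha> where \<alpha>: "\<alpha> \<in> D" "m \<le> k" "f \<in> affine_root_space G (aff G k \<alpha>)"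
      by blast
    then obtain l \<gamma> x where \<gamma>: "f = Poly_Mapping.single l x" "\<gamma> \<in> R" "aff G k \<alpha> = aff G l \<gamma>" "x \<in> root_space G \<gamma>"
      unfolding affine_root_space_def by blast
    then have "k = l \<and> \<alpha> = \<gamma>"
      using \<alpha>(1) assms by (intro aff_inj) auto
    then show "f \<in> ?M"
      using \<alpha> \<gamma> by blast
  qed
  show "?M \<subseteq> ?L"
  proof
    fix f assume "f \<in> ?M"
    then obtain k \<alpha> x where f: "f = Poly_Mapping.single k x" "m \<le> k" "\<alpha> \<in> D" "x \<in> root_space G \<alpha>"
      by blast
    then have "f \<in> affine_root_space G (aff G k \<alpha>)"
      unfolding affine_root_space_def using assms by blast
    then show "f \<in> ?L"
      using f by blast
  qed
qed

lemma loop_span_upper: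
  "loop_span (\<Union>\<beta>\<in>{aff G k \<alpha> |k \<alpha>. \<alpha> \<in> Pos \<and> 0 \<le> k}. affine_root_space G \<beta>) = loops_from 0 (nplus G)"
proof -
  have "Pos \<subseteq> R"
    by (auto simp: Pos_iff)
  then show ?thesis
    by (simp only: affine_root_spaces_union loop_span_monomials nplus_def)
qed

lemma loop_span_lower:
  "loop_span (\<Union>\<beta>\<in>{aff G k (neg_fun \<alpha>) |k \<alpha>. \<alpha> \<in> Pos \<and> 1 \<le> k}. affine_root_space G \<beta>)
    = loops_from 1 (nminus G)"
proof -
  have "{aff G k (neg_fun \<alpha>) |k \<alpha>. \<alpha> \<in> Pos \<and> 1 \<le> k} = {aff G k \<alpha> |k \<alpha>. \<alpha> \<in> neg_fun ` Pos \<and> 1 \<le> k}"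
    by blast
  moreover have "neg_fun ` Pos \<subseteq> R"
    using neg_root by (auto simp: Pos_iff)
  moreover have "(\<Union>\<alpha>\<in>neg_fun ` Pos. root_space G \<alpha>) = (\<Union>\<alpha>\<in>Pos. root_space G (neg_fun \<alpha>))"
    by blast
  ultimately show ?thesis
    by (simp only: affine_root_spaces_union loop_span_monomials nminus_def)
qed

end


section \<open>The root datum of a compact simple Lie algebra\<close>

context compact_root_spaces
begin

lemma simple_system: "is_simple_system G"
  using setting by (simp add: lie_setting_def)

lemma cartan_real_itorus: "cartan_real G \<subseteq> itorus"
  unfolding cartan_real_def using simple_system
  by (intro span_minimal subspace_itorus) (auto simp: is_simple_system_def coroot_itorus)

lemma ip_sum_left: "ip (sum f A) z = (\<Sum>i\<in>A. ip (f i) z)"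
  by (induction A rule: infinite_finite_induct) (simp_all add: ip_add_left)

text \<open>The vector that represents a root by the inner product; unlike the coroot it depends
  linearly on the root.\<close>

definition root_rep :: "('k cplx \<Rightarrow> complex) \<Rightarrow> 'k cplx" where
  "root_rep \<alpha> = (2 / ip (coroot G \<alpha>) (coroot G \<alpha>)) *\<^sub>R coroot G \<alpha>"

lemma root_rep_itorus: "\<alpha> \<in> roots G \<Longrightarrow> root_rep \<alpha> \<in> itorus"
  unfolding root_rep_def by (intro subspace_mul subspace_itorus coroot_itorus)

lemma ip_root_rep:
  assumes "\<alpha> \<in> roots G" "z \<in> itorus"
  shows "ip (root_rep \<alpha>) z = Re (\<alpha> z)"
  using ip_coroot[OF assms] ip_pos[OF coroot_nonzero[OF assms(1)]]
  by (simp add: root_rep_def ip_scale_left field_simps)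

lemma coroot_root_rep:
  assumes "\<alpha> \<in> roots G"
  shows "coroot G \<alpha> = (ip (coroot G \<alpha>) (coroot G \<alpha>) / 2) *\<^sub>R root_rep \<alpha>"
  using ip_pos[OF coroot_nonzero[OF assms]] by (simp add: root_rep_def)

text \<open>Linearity reduces this to simple roots, whose coroots span the real Cartan subalgebra. It follows
  that roots are determined by their values there.\<close>

lemma root_rep_cartan_real:
  assumes "\<alpha> \<in> roots G"
  shows "root_rep \<alpha> \<in> cartan_real G"
proof -
  have simple_rep: "root_rep (simple_root G i) \<in> cartan_real G" if "i \<in> {1..rk G}" for i
    unfolding root_rep_def cartan_real_def using that by (intro span_scale span_base imageI)
  have comb: "root_rep \<beta> \<in> cartan_real G" if \<beta>: "\<beta> \<in> roots G" "\<beta> \<in> nonneg_combs G" for \<beta>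
  proof -
    obtain n :: "nat \<Rightarrow> nat" where n: "\<beta> = simple_comb G (\<lambda>i. of_nat (n i))"
      using \<beta>(2) by (auto simp: nonneg_combs_def)
    define u where "u = (\<Sum>i=1..rk G. of_nat (n i) *\<^sub>R root_rep (simple_root G i))"
    have simple: "simple_root G i \<in> roots G" if "i \<in> {1..rk G}" for i
      using that simple_system by (simp add: is_simple_system_def)
    have "root_rep \<beta> = u"
    proof (rule itorus_eqI)
      show "u \<in> itorus"
        unfolding u_def using simple
        by (intro subspace_sum subspace_mul subspace_itorus root_rep_itorus)
      fix z assume z: "z \<in> itorus"
      have "ip u z = (\<Sum>i=1..rk G. of_nat (n i) * ip (root_rep (simple_root G i)) z)"
        by (simp add: u_def ip_sum_left ip_scale_left)
      also have "\<dots> = (\<Sum>i=1..rk G. of_nat (n i) * Re (simple_root G i z))"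
        using simple z by (intro sum.cong) (simp_all add: ip_root_rep)
      also have "\<dots> = Re (\<beta> z)"
        by (subst n) (simp add: simple_comb_def)
      finally show "ip (root_rep \<beta>) z = ip u z"
        using \<beta>(1) z by (simp add: ip_root_rep)
    qed (use \<beta> in \<open>simp add: root_rep_itorus\<close>)
    also have "u \<in> cartan_real G"
      unfolding u_def using simple_rep
      by (intro subspace_sum subspace_mul) (simp_all add: cartan_real_def)
    finally show ?thesis .
  qed
  consider "\<alpha> \<in> nonneg_combs G" | "neg_fun \<alpha> \<in> nonneg_combs G"
    using assms simple_system by (auto simp: is_simple_system_def)
  then show ?thesis
  proof cases
    case 2
    then have "root_rep (neg_fun \<alpha>) \<in> cartan_real G"
      using comb neg_root[OF assms] by blast
    moreover have "root_rep (neg_fun \<alpha>) = - root_rep \<alpha>"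
      by (simp add: root_rep_def coroot_neg[OF assms] ip_minus_left ip_minus_right)
    ultimately show ?thesis
      using span_neg[of "- root_rep \<alpha>"] unfolding cartan_real_def by simp
  qed (use comb assms in blast)
qed

lemma root_datum: "root_datum G"
proof
  fix \<alpha> \<beta> x y a n
  show "finite (roots G)"
    by (rule finite_roots)
  show "is_simple_system G" "is_highest_root G (highest_root G)"
    using setting by (simp_all add: lie_setting_def)
  assume \<alpha>: "\<alpha> \<in> roots G"
  show "\<alpha> (x + y) = \<alpha> x + \<alpha> y" if "x \<in> cartan_real G" "y \<in> cartan_real G"
    using that \<alpha> cartan_real_itorus by (intro dual_add) (auto simp: roots_dual itorus_cartan)
  show "\<alpha> (a *\<^sub>R x) = of_real a * \<alpha> x" if "x \<in> cartan_real G"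
    using that \<alpha> cartan_real_itorus by (intro dual_scaleR) (auto simp: roots_dual itorus_cartan)
  show "Im (\<alpha> x) = 0" if "x \<in> cartan_real G"
    using that \<alpha> cartan_real_itorus by (intro root_real) auto
  show "n = 1" if "(\<lambda>x. of_nat n * \<alpha> x) \<in> roots G"
    using \<alpha> that by (rule root_multiple)
  show "coroot G \<alpha> \<in> cartan_real G"
    using root_rep_cartan_real[OF \<alpha>] unfolding cartan_real_def
    by (subst coroot_root_rep[OF \<alpha>]) (rule span_scale)
  show "\<alpha> (coroot G \<alpha>) = 2"
    using \<alpha> by (rule root_coroot)
  assume \<beta>: "\<beta> \<in> roots G"
  show "\<alpha> = \<beta>" if eq: "\<And>x. x \<in> cartan_real G \<Longrightarrow> \<alpha> x = \<beta> x"
  proof -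
    let ?u = "root_rep \<alpha> - root_rep \<beta>"
    have u: "?u \<in> cartan_real G"
      using root_rep_cartan_real[OF \<alpha>] root_rep_cartan_real[OF \<beta>] by (simp add: cartan_real_def span_diff)
    then have "?u \<in> itorus"
      using cartan_real_itorus by blast
    then have "ip ?u ?u = Re (\<alpha> ?u) - Re (\<beta> ?u)"
      by (simp only: ip_diff_left[of _ _ ?u] ip_root_rep[OF \<alpha>] ip_root_rep[OF \<beta>])
    then have "root_rep \<alpha> = root_rep \<beta>"
      using eq[OF u] by (simp add: ip_self_eq_0_iff)
    then have "\<alpha> z = \<beta> z" if "z \<in> itorus" for z
      using ip_root_rep[OF \<alpha> that] ip_root_rep[OF \<beta> that] root_real[OF \<alpha> that] root_real[OF \<beta> that]
      by (simp add: complex_eq_iff)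
    then show ?thesis
      using \<alpha> \<beta> by (intro dual_eqI) (auto simp: roots_dual)
  qed
  obtain m where m: "\<beta> (coroot G \<alpha>) = of_int m" "(\<lambda>x. \<beta> x - of_int m * \<alpha> x) \<in> roots G"
    using \<alpha> \<beta> by (rule root_reflection)
  show "\<beta> (coroot G \<alpha>) \<in> \<int>"
    using m by simp
  show refl: "(\<lambda>x. \<beta> x - \<beta> (coroot G \<alpha>) * \<alpha> x) \<in> roots G"
    using m by simp
  show "coroot G (\<lambda>x. \<beta> x - \<beta> (coroot G \<alpha>) * \<alpha> x) = coroot G \<beta> - Re (\<alpha> (coroot G \<beta>)) *\<^sub>R coroot G \<alpha>"
    using \<alpha> \<beta> refl by (rule coroot_reflection)
  show "0 < Re (\<beta> (coroot G \<alpha>))" if "0 < Re (\<alpha> (coroot G \<beta>))"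
    using \<alpha> \<beta> that by (rule pairing_pos)
qed

end


section \<open>Reduced sequences for the two halves of the loop algebra\<close>

lemma lie_setting_root_datum: "lie_setting G \<Longrightarrow> root_datum G"
  by (rule compact_root_spaces.root_datum) (rule compact_root_spaces.intro)

theorem theorem2p1:
  fixes G :: "('k::euclidean_space) lie_data"
  assumes "lie_setting G"
  shows
    "(\<exists>\<rho>. lower_sequence G \<rho>) \<and>
     (\<forall>h \<in> chamber G \<inter> coroot_lattice G. \<exists>\<rho>. lower_sequence G \<rho> \<and> has_period G \<rho> h) \<and>
     (\<forall>\<rho>. lower_sequence G \<rho> \<longrightarrow>
        (\<forall>j\<ge>1. tau G \<rho> j \<in> positive_affine_roots G \<and>
           tau G \<rho> j = weyl_act (word_prod G (map \<rho> [1..j - 1])) (simple_affine_root G (\<rho> j))) \<and>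
        loop_span (\<Union>j\<in>{1..}. affine_root_space G (tau G \<rho> j)) = loops_from 1 (nminus G)) \<and>
     (\<forall>\<rho> (N::nat). lower_sequence G \<rho> \<and>
        reduced_expression G {1..rk G} (map \<rho> [- int N..0]) \<and>
        is_longest_element G (word_prod G (map \<rho> [- int N..0])) \<longrightarrow>
        reduced_sequence G \<rho> (- int N) \<and>
        (\<Union>n\<in>{- int N..}. inversions G (wseq G \<rho> (- int N) n)) =
          {aff G k \<alpha> | k \<alpha>. \<alpha> \<in> positive_roots G \<and> 0 \<le> k} \<and>
        loop_span (\<Union>\<beta>\<in>(\<Union>n\<in>{- int N..}. inversions G (wseq G \<rho> (- int N) n)).
            affine_root_space G \<beta>) =
          loops_from 0 (nplus G))"
proof -
  interpret root_datum G
    using assms by (rule lie_setting_root_datum)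
  have "\<exists>\<rho>. lower_sequence G \<rho>"
    using periodic_sequence_exists[OF height_point_chamber height_point_lattice] by blast
  moreover have "\<exists>\<rho>. lower_sequence G \<rho> \<and> has_period G \<rho> h" if "h \<in> chamber G \<inter> Q" for h
    using that by (intro periodic_sequence_exists) auto
  moreover have "(\<forall>j\<ge>1. tau G \<rho> j \<in> positive_affine_roots G \<and>
        tau G \<rho> j = weyl_act (word_prod G (map \<rho> [1..j - 1])) (simple_affine_root G (\<rho> j))) \<and>
      loop_span (\<Union>j\<in>{1..}. affine_root_space G (tau G \<rho> j)) = loops_from 1 (nminus G)"
    if \<rho>: "lower_sequence G \<rho>" for \<rho>
  proof -
    have red: "reduced_sequence G \<rho> 1"
      and taus: "{tau G \<rho> j |j. 1 \<le> j} = {aff G k (neg_fun \<alpha>) |k \<alpha>. \<alpha> \<in> Pos \<and> 1 \<le> k}"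
      using \<rho> by (simp_all add: lower_sequence_def)
    have "tau G \<rho> j \<in> positive_affine_roots G" if "1 \<le> j" for j
    proof -
      have "tau G \<rho> j \<in> inverted (positive_affine_roots G) (wseq G \<rho> 1 (int (nat j)))"
        unfolding inverted_wseq[OF red] using that by (intro CollectI exI[of _ j]) simp
      then show ?thesis
        by (simp add: inverted_def)
    qed
    moreover have "tau G \<rho> j = weyl_act (word_prod G (map \<rho> [1..j - 1])) (simple_affine_root G (\<rho> j))" for j
    proof -
      have "set (seq_word \<rho> 1 (j - 1)) \<subseteq> {0..rk G}"
        using reduced_seq[OF red] by (rule affine.reduced_letters)
      moreover have "rev (seq_word \<rho> 1 (j - 1)) = map \<rho> [1..j - 1]"
        by (simp add: seq_word_def rev_map)
      ultimately have "inv (wseq G \<rho> 1 (j - 1)) = word_prod G (map \<rho> [1..j - 1])"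
        unfolding wseq_def by (simp only: affine.inv_word)
      then show ?thesis
        by (simp only: tau_def)
    qed
    moreover have "loop_span (\<Union>j\<in>{1..}. affine_root_space G (tau G \<rho> j)) = loops_from 1 (nminus G)"
    proof -
      have "(\<Union>j\<in>{1..}. affine_root_space G (tau G \<rho> j)) = (\<Union>\<beta>\<in>{tau G \<rho> j |j. 1 \<le> j}. affine_root_space G \<beta>)"
        by auto
      then show ?thesis
        unfolding taus loop_span_lower[symmetric] by (rule arg_cong)
    qed
    ultimately show ?thesis
      by blast
  qed
  moreover have "reduced_sequence G \<rho> (- int N) \<and>
      (\<Union>n\<in>{- int N..}. inversions G (wseq G \<rho> (- int N) n)) = {aff G k \<alpha> |k \<alpha>. \<alpha> \<in> Pos \<and> 0 \<le> k} \<and>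
      loop_span (\<Union>\<beta>\<in>(\<Union>n\<in>{- int N..}. inversions G (wseq G \<rho> (- int N) n)). affine_root_space G \<beta>)
        = loops_from 0 (nplus G)"
    if "lower_sequence G \<rho> \<and> reduced_expression G {1..rk G} (map \<rho> [- int N..0]) \<and>
      is_longest_element G (word_prod G (map \<rho> [- int N..0]))" for \<rho> and N :: nat
  proof -
    have prem: "lower_sequence G \<rho>" "spherical.reduced (map \<rho> [- int N..0])"
      "is_longest_element G (word_prod G (map \<rho> [- int N..0]))"
      using that reduced_expression_finite by blast+
    show ?thesis
      unfolding longest_prefix(2)[OF prem] using longest_prefix(1)[OF prem] loop_span_upper by blast
  qed
  ultimately show ?thesis
    by blast
qed

end
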